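(* Let $G$ be a connected cograph on $n$ vertices. Deciding whether $G$ admits an equitable partition with $\frac{n}{2}$ cells, each of size $2$, and deciding whether $G$ admits a weight-equitable partition with $\frac{n}{2}$ cells, each of size $2$, can each be done in $O(n^2)$ time.
   Context: A cograph is a simple undirected graph containing no induced path on $4$ vertices. Let $\nu$ be the Perron eigenvector of $G$ (positive eigenvector of the adjacency matrix for the largest eigenvalue, minimum entry $1$). A partition $\{V_1,\dots,V_m\}$ of $V(G)$ is weight-equitable if for all $i,j$ the quantity $b^*_{ij}(u)=\frac{1}{\nu_u}\sum_{v\in V_j,\,v\sim u}\nu_v$ is the same for all $u\in V_i$; it is equitable if for all $i,j$ the number of neighbors in $V_j$ of $u\in V_i$ is the same for all $u\in V_i$. *)

theory Defs
  imports
    "Graph_Theory.Digraph_Component"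
    "Jordan_Normal_Form.Spectral_Radius"
    "HOL-Library.Disjoint_Sets"
    "HOL-Library.Landau_Symbols"
begin

section \<open>Cographs\<close>

text \<open>
  A finite simple undirected graph is a \<^locale>\<open>pair_graph\<close>: a finite, loop-free digraph
  with a symmetric arc set.
\<close>

definition induced_P4 :: "'a pair_pre_digraph \<Rightarrow> (nat \<Rightarrow> 'a) \<Rightarrow> bool" where
  "induced_P4 G p \<longleftrightarrow>
     inj_on p {..<4} \<and> p ` {..<4} \<subseteq> pverts G \<and>
     (\<forall>i<4. \<forall>j<4. (p i, p j) \<in> parcs G \<longleftrightarrow> j = Suc i \<or> i = Suc j)"

definition cograph :: "'a pair_pre_digraph \<Rightarrow> bool" where
  "cograph G \<longleftrightarrow> pair_graph G \<and> (\<nexists>p. induced_P4 G p)"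

definition connected_cograph :: "'a pair_pre_digraph \<Rightarrow> bool" where
  "connected_cograph G \<longleftrightarrow> cograph G \<and> Digraph_Component.connected (with_proj G)"


section \<open>Equitable and weight-equitable partitions\<close>

definition neighbours_in :: "'a pair_pre_digraph \<Rightarrow> 'a set \<Rightarrow> 'a \<Rightarrow> 'a set" where
  "neighbours_in G C u = {v \<in> C. (u, v) \<in> parcs G}"

definition equitable_partition :: "'a pair_pre_digraph \<Rightarrow> 'a set set \<Rightarrow> bool" where
  "equitable_partition G P \<longleftrightarrow>
     partition_on (pverts G) P \<and>
     (\<forall>C\<in>P. \<forall>D\<in>P. \<forall>u\<in>C. \<forall>u'\<in>C.
        card (neighbours_in G D u) = card (neighbours_in G D u'))"

text \<open>
  Matrices and vectors are indexed from 0, so the spectral notions below are meant for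
  graphs with vertex set \<open>{..<n}\<close>.
\<close>

definition adjacency_matrix :: "nat pair_pre_digraph \<Rightarrow> real mat" where
  "adjacency_matrix G =
     mat (card (pverts G)) (card (pverts G)) (\<lambda>(i, j). if (i, j) \<in> parcs G then 1 else 0)"

text \<open>
  For connected \<open>G\<close> the Perron-Frobenius theorem makes the following description definite.
  The matrix is real symmetric, so its real spectrum is its whole spectrum and, as \<open>G\<close> is
  nonempty, the maximum is taken over a finite nonempty set.
\<close>

definition perron_vector :: "nat pair_pre_digraph \<Rightarrow> real vec" where
  "perron_vector G =
     (THE x. eigenvector (adjacency_matrix G) x (Max (spectrum (adjacency_matrix G))) \<and>
             (\<forall>u\<in>pverts G. 0 < x $ u) \<and>
             Min ((\<lambda>u. x $ u) ` pverts G) = 1)"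

definition weighted_degree_into :: "nat pair_pre_digraph \<Rightarrow> nat set \<Rightarrow> nat \<Rightarrow> real" where
  "weighted_degree_into G D u =
     1 / (perron_vector G $ u) * (\<Sum>v\<in>neighbours_in G D u. perron_vector G $ v)"

definition weight_equitable_partition :: "nat pair_pre_digraph \<Rightarrow> nat set set \<Rightarrow> bool" where
  "weight_equitable_partition G P \<longleftrightarrow>
     partition_on (pverts G) P \<and>
     (\<forall>C\<in>P. \<forall>D\<in>P. \<forall>u\<in>C. \<forall>u'\<in>C.
        weighted_degree_into G D u = weighted_degree_into G D u')"

text \<open>\<open>n / 2\<close> is the exact quotient: for odd \<open>n\<close> no partition qualifies.\<close>

definition into_pairs :: "'a pair_pre_digraph \<Rightarrow> 'a set set \<Rightarrow> bool" where
  "into_pairs G P \<longleftrightarrow>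
     real (card P) = real (card (pverts G)) / 2 \<and> (\<forall>C\<in>P. card C = 2)"


section \<open>Machine model\<close>

text \<open>
  A random access machine with numbered registers and numbered arrays of natural numbers,
  programmed by structured commands. A program mentions only finitely many registers and
  arrays, all by fixed number. Every constant, register access, array access, comparison,
  Boolean connective, assignment and branch costs one unit.

  The only arithmetic is increment and decrement. Hence after \<open>t\<close> steps every stored value is
  at most \<open>t\<close> plus the largest of the input values and the program constants: unit cost never
  hides computation with long numbers, and every program also runs, within the same bounds up
  to a constant factor, on the usual RAMs with addition and on word RAMs.
\<close>

record ram_state =
  regs :: "nat \<Rightarrow> nat"
  arrs :: "nat \<Rightarrow> nat \<Rightarrow> nat"

datatype exp = Const nat | Reg nat | Read nat exp | Inc exp | Dec exp

datatype test = Lt exp exp | Eq exp exp | Neg test | And test test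

datatype com =
    Skip
  | Assign nat exp
  | Write nat exp exp
  | Seq com com
  | Cond test com com
  | While test com

fun exp_val :: "exp \<Rightarrow> ram_state \<Rightarrow> nat" where
  "exp_val (Const k) s = k"
| "exp_val (Reg r) s = regs s r"
| "exp_val (Read a e) s = arrs s a (exp_val e s)"
| "exp_val (Inc e) s = exp_val e s + 1"
| "exp_val (Dec e) s = exp_val e s - 1"

fun exp_cost :: "exp \<Rightarrow> nat" where
  "exp_cost (Const k) = 1"
| "exp_cost (Reg r) = 1"
| "exp_cost (Read a e) = 1 + exp_cost e"
| "exp_cost (Inc e) = 1 + exp_cost e"
| "exp_cost (Dec e) = 1 + exp_cost e"

fun test_val :: "test \<Rightarrow> ram_state \<Rightarrow> bool" where
  "test_val (Lt e f) s \<longleftrightarrow> exp_val e s < exp_val f s"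
| "test_val (Eq e f) s \<longleftrightarrow> exp_val e s = exp_val f s"
| "test_val (Neg b) s \<longleftrightarrow> \<not> test_val b s"
| "test_val (And b c) s \<longleftrightarrow> test_val b s \<and> test_val c s"

fun test_cost :: "test \<Rightarrow> nat" where
  "test_cost (Lt e f) = 1 + exp_cost e + exp_cost f"
| "test_cost (Eq e f) = 1 + exp_cost e + exp_cost f"
| "test_cost (Neg b) = 1 + test_cost b"
| "test_cost (And b c) = 1 + test_cost b + test_cost c"

text \<open>\<open>exec c s t s'\<close>: started in \<open>s\<close>, command \<open>c\<close> halts in \<open>s'\<close> after exactly \<open>t\<close> steps.\<close>

inductive exec :: "com \<Rightarrow> ram_state \<Rightarrow> nat \<Rightarrow> ram_state \<Rightarrow> bool" where
  Skip: "exec Skip s 1 s"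
| Assign: "exec (Assign r e) s (1 + exp_cost e) (s\<lparr>regs := (regs s)(r := exp_val e s)\<rparr>)"
| Write: "exec (Write a e f) s (1 + exp_cost e + exp_cost f)
    (s\<lparr>arrs := (arrs s)(a := (arrs s a)(exp_val e s := exp_val f s))\<rparr>)"
| Seq: "exec c s t s' \<Longrightarrow> exec d s' u s'' \<Longrightarrow> exec (Seq c d) s (t + u) s''"
| Cond_True: "test_val b s \<Longrightarrow> exec c s t s' \<Longrightarrow>
    exec (Cond b c d) s (1 + test_cost b + t) s'"
| Cond_False: "\<not> test_val b s \<Longrightarrow> exec d s t s' \<Longrightarrow>
    exec (Cond b c d) s (1 + test_cost b + t) s'"
| While_False: "\<not> test_val b s \<Longrightarrow> exec (While b c) s (1 + test_cost b) s"
| While_True: "test_val b s \<Longrightarrow> exec c s t s' \<Longrightarrow> exec (While b c) s' u s'' \<Longrightarrow>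
    exec (While b c) s (1 + test_cost b + t + u) s''"

inductive_cases exec_SkipE: "exec Skip s t s'"
  and exec_AssignE: "exec (Assign r e) s t s'"
  and exec_WriteE: "exec (Write a e f) s t s'"
  and exec_SeqE: "exec (Seq c d) s t s'"
  and exec_CondE: "exec (Cond b c d) s t s'"
  and exec_WhileE: "exec (While b c) s t s'"

text \<open>Runs are unique, so existence of a terminating run is total correctness.\<close>

lemma exec_deterministic:
  "exec c s t s' \<Longrightarrow> exec c s u s'' \<Longrightarrow> u = t \<and> s'' = s'"
proof (induction arbitrary: u s'' rule: exec.induct)
  case (Skip s)
  from Skip.prems show ?case by (rule exec_SkipE) simp
next
  case (Assign r e s)
  from Assign.prems show ?case by (rule exec_AssignE) simp
next
  case (Write a e f s)
  from Write.prems show ?case by (rule exec_WriteE) simp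
next
  case (Seq c s t s' d v s1)
  from Seq.prems show ?case by (rule exec_SeqE) (auto dest!: Seq.IH)
next
  case (Cond_True b s c t s' d)
  from Cond_True.prems show ?case
    by (rule exec_CondE) (use Cond_True.hyps in \<open>auto dest!: Cond_True.IH\<close>)
next
  case (Cond_False b s d t s' c)
  from Cond_False.prems show ?case
    by (rule exec_CondE) (use Cond_False.hyps in \<open>auto dest!: Cond_False.IH\<close>)
next
  case (While_False b s c)
  from While_False.prems show ?case
    by (rule exec_WhileE) (use While_False.hyps in auto)
next
  case (While_True b s c t s' v s1)
  from While_True.prems show ?case
    by (rule exec_WhileE) (use While_True.hyps in \<open>auto dest!: While_True.IH\<close>)
qed


section \<open>Decision problems on graphs\<close>

text \<open>
  A graph on \<open>{..<n}\<close> is presented by \<open>n\<close> in register 0 and its adjacency matrix, row by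
  row, in array 0; everything else is 0. The answer is returned in register 1.
\<close>

definition input_state :: "nat \<Rightarrow> nat pair_pre_digraph \<Rightarrow> ram_state" where
  "input_state n G =
     \<lparr>regs = (\<lambda>_. 0)(0 := n),
      arrs = (\<lambda>_ _. 0)(0 := (\<lambda>k. if k < n * n \<and> (k div n, k mod n) \<in> parcs G then 1 else 0))\<rparr>"

text \<open>
  The set \<open>I\<close> is a promise on the input: nothing is required of the program on graphs
  outside \<open>I\<close>.
\<close>

definition decides_within ::
  "com \<Rightarrow> (nat \<Rightarrow> nat) \<Rightarrow> nat pair_pre_digraph set \<Rightarrow> (nat pair_pre_digraph \<Rightarrow> bool) \<Rightarrow> bool"
where
  "decides_within c T I Q \<longleftrightarrow>
     (\<forall>n. \<forall>G\<in>I. pverts G = {..<n} \<longrightarrow>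
        (\<exists>t s. exec c (input_state n G) t s \<and> t \<le> T n \<and> regs s 1 = (if Q G then 1 else 0)))"

definition decidable_in_time ::
  "(nat \<Rightarrow> real) \<Rightarrow> nat pair_pre_digraph set \<Rightarrow> (nat pair_pre_digraph \<Rightarrow> bool) \<Rightarrow> bool"
where
  "decidable_in_time f I Q \<longleftrightarrow>
     (\<exists>c T. decides_within c T I Q \<and> (\<lambda>n. real (T n)) \<in> O(f))"

end

theory Submission
  imports Defs "HOL-Analysis.Function_Topology" "HOL-Library.Multiset"
begin

text \<open>
  Both questions ask for the same thing: a fixed-point-free involutive automorphism \<open>f\<close> of \<open>G\<close>.
  Between two cells of size 2 of an equitable partition there are no edges, a perfect matching
  or all edges, so swapping the two vertices of every cell is an automorphism. For a
  weight-equitable partition into pairs, an edge from the heavier vertex of a cell can only lead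
  to the heavier vertex of another cell: the remaining adjacency patterns contradict the weight
  equations or contain an induced path on four vertices. As \<open>G\<close> is connected, the Perron vector is
  therefore constant on every cell, and the partition is equitable. Conversely, the Perron
  vector is unique, hence invariant under \<open>f\<close>, so the orbits of \<open>f\<close> are the cells of a partition
  of both kinds.

  A cograph is determined up to isomorphism by its cotree, and \<open>f\<close> exists iff at its root the
  isomorphism types of children without such an involution occur with even multiplicity. The
  cotree is found by repeatedly merging twins. A stack of vertices is kept in which no vertex
  distinguishes two vertices above it. A vertex that distinguishes the two topmost vertices is
  pushed; if there is none, these two are twins and one of them is deleted. Every vertex is pushed
  and deleted at most once, and each step inspects two rows of the adjacency matrix. Isomorphism
  types of cotrees are numbered through a trie of multisets of numbers, which costs linear
  time for each merge.
\<close>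

section \<open>Cotrees\<close>

text \<open>The quadratic bound rests on two counts. The children of a merged node carry disjoint
  nonempty vertex sets, so their multiplicities sum to at most \<open>n\<close>; a merge can
  therefore afford to spell them in unary, which is also what a machine that only increments can do.
  And twice the number of living vertices minus the height of the stack falls in every round, so
  that linearly many rounds of linear cost suffice. The same statements are needed for edges and for
  non-edges: union and join in the cotree, both kinds of twins, both types of stack edges. They are
  therefore parametrised by a type \<open>a\<close>, \<open>True\<close> for edges and
  \<open>False\<close> for non-edges, and a single argument serves both because the path on four
  vertices is isomorphic to its complement. The Perron vector is given by a description operator and
  the maximum of a spectrum. Nothing can be said about weights before existence, positivity,
  maximality of the eigenvalue and uniqueness are established; existence comes from maximising the
  quadratic form of the graph over the unit sphere.\<close>

datatype cotree = Leaf | Node bool "cotree multiset"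

fun rooted :: "bool \<Rightarrow> cotree \<Rightarrow> bool" where
  "rooted a Leaf \<longleftrightarrow> False"
| "rooted a (Node b M) \<longleftrightarrow> a = b"

text \<open>What a cotree contributes to a new root of type \<open>a\<close>: a root of that type is
  dissolved into its children, since otherwise two nested nodes would have the same type.\<close>

fun kids :: "bool \<Rightarrow> cotree \<Rightarrow> cotree multiset" where
  "kids a Leaf = {#Leaf#}"
| "kids a (Node b M) = (if a = b then M else {#Node b M#})"

definition merge_cotrees :: "bool \<Rightarrow> cotree \<Rightarrow> cotree \<Rightarrow> cotree" where
  "merge_cotrees a s t = Node a (kids a s + kids a t)"

text \<open>
  Isomorphic children that admit no fixed-point-free involution of their own have to be
  exchanged in pairs.
\<close>

inductive swappable :: "cotree \<Rightarrow> bool" where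
  "(\<And>t. t \<in># M \<Longrightarrow> swappable t \<or> even (count M t)) \<Longrightarrow> swappable (Node a M)"

lemma swappable_Leaf: "\<not> swappable Leaf"
  by (auto elim: swappable.cases)

lemma swappable_Node: "swappable (Node a M) \<longleftrightarrow> (\<forall>t. swappable t \<or> even (count M t))"
  by (subst swappable.simps) (metis cotree.inject count_inI even_zero)

locale simple_graph =
  fixes E :: "'a \<Rightarrow> 'a \<Rightarrow> bool"
  assumes E_sym: "E x y \<longleftrightarrow> E y x" and E_irrefl: "\<not> E x x"
begin

definition joined :: "bool \<Rightarrow> 'a set \<Rightarrow> 'a set \<Rightarrow> bool" where
  "joined a S T \<longleftrightarrow> (\<forall>x\<in>S. \<forall>y\<in>T. E x y = a)"

lemma joined_sym: "joined a S T \<longleftrightarrow> joined a T S"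
  using E_sym by (auto simp: joined_def)

lemma joined_Un [simp]:
  "joined a (S \<union> S') T \<longleftrightarrow> joined a S T \<and> joined a S' T"
  "joined a S (T \<union> T') \<longleftrightarrow> joined a S T \<and> joined a S T'"
  by (auto simp: joined_def)

lemma joined_empty [simp]: "joined a {} T" "joined a S {}"
  by (auto simp: joined_def)

text \<open>
  \<open>family a S M\<close>: \<open>S\<close> splits into pairwise \<open>a\<close>-joined parts whose cotrees form \<open>M\<close>. Since no member
  of \<open>M\<close> has an \<open>a\<close>-root, the types of the nodes alternate, which makes the cotree canonical.
\<close>

inductive represents :: "'a set \<Rightarrow> cotree \<Rightarrow> bool"
  and family :: "bool \<Rightarrow> 'a set \<Rightarrow> cotree multiset \<Rightarrow> bool"
where
  leaf: "represents {v} Leaf"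
| node: "family a S M \<Longrightarrow> size M \<ge> 2 \<Longrightarrow> represents S (Node a M)"
| empty: "family a {} {#}"
| insert: "represents C t \<Longrightarrow> \<not> rooted a t \<Longrightarrow> family a S M \<Longrightarrow> C \<inter> S = {} \<Longrightarrow>
    joined a C S \<Longrightarrow> family a (C \<union> S) (add_mset t M)"

lemma represents_leafE: "represents S Leaf \<Longrightarrow> (\<And>v. S = {v} \<Longrightarrow> P) \<Longrightarrow> P"
  by (auto elim: represents.cases)

lemma represents_nodeE:
  "represents S (Node a M) \<Longrightarrow> (family a S M \<Longrightarrow> size M \<ge> 2 \<Longrightarrow> P) \<Longrightarrow> P"
  by (auto elim: represents.cases)

lemma family_emptyE: "family a S {#} \<Longrightarrow> S = {}"
  by (auto elim: family.cases)

text \<open>Parts are disjoint and nonempty, so a family has at most as many members as vertices.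
  This bound later pays for the unary words in the trie.\<close>

lemma represents_finite: "represents S t \<Longrightarrow> finite S \<and> S \<noteq> {}"
  and family_finite: "family a S M \<Longrightarrow> finite S \<and> size M \<le> card S \<and> (S = {} \<longrightarrow> M = {#})"
proof (induction rule: represents_family.inducts)
  case (insert C t a S M)
  have h: "represents C t" "\<not> rooted a t" "family a S M" "C \<inter> S = {}" "joined a C S"
    by fact+
  then have "card (C \<union> S) = card C + card S" "card C > 0"
    using insert.IH by (auto simp: card_Un_disjoint card_gt_0_iff)
  with insert.IH show ?case by auto
qed auto

lemma family_Un:
  "represents S' t \<Longrightarrow> True"
  "family a S M \<Longrightarrow> family a T N \<Longrightarrow> S \<inter> T = {} \<Longrightarrow> joined a S T \<Longrightarrow> family a (S \<union> T) (M + N)"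
proof (induction rule: represents_family.inducts)
  case (insert C t a S M)
  have h: "represents C t" "\<not> rooted a t" "family a S M" "C \<inter> S = {}" "joined a C S"
    by fact+
  then have "family a (C \<union> (S \<union> T)) (add_mset t (M + N))"
    using h insert.IH insert.prems by (intro represents_family.insert) auto
  then show ?case by (simp add: Un_assoc)
qed auto

lemma represents_kids: "represents S t \<Longrightarrow> family a S (kids a t)"
proof (cases "rooted a t")
  case True
  moreover assume "represents S t"
  ultimately show ?thesis by (cases t) (auto elim: represents_nodeE)
next
  case False
  assume "represents S t"
  from represents_family.insert[OF this False represents_family.empty]
  have "family a S {#t#}" by simp
  with False show ?thesis by (cases t) auto
qed

lemma kids_nonempty: "represents S t \<Longrightarrow> kids a t \<noteq> {#}"
  by (cases t) (auto elim!: represents_nodeE)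

text \<open>Each side supplies at least one child, whether dissolved or not, so the new root has the
  two children that an inner node requires.\<close>

lemma represents_merge:
  assumes "represents S s" "represents T t" "S \<inter> T = {}" "joined a S T"
  shows "represents (S \<union> T) (merge_cotrees a s t)"
proof -
  have "family a (S \<union> T) (kids a s + kids a t)"
    using assms by (intro family_Un represents_kids)
  moreover have "size (kids a s) \<ge> 1" "size (kids a t) \<ge> 1"
    using kids_nonempty assms by (auto simp: Suc_le_eq nonempty_has_size)
  ultimately show ?thesis unfolding merge_cotrees_def by (intro node) auto
qed

lemma family_split:
  "represents S' t' \<Longrightarrow> True"
  "family a S N \<Longrightarrow> t \<in># N \<Longrightarrow> \<exists>C S'. S = C \<union> S' \<and> C \<inter> S' = {} \<and> joined a C S' \<and>
     represents C t \<and> \<not> rooted a t \<and> family a S' (N - {#t#})"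
proof (induction rule: represents_family.inducts)
  case (insert C t0 a S M)
  have h: "represents C t0" "\<not> rooted a t0" "family a S M" "C \<inter> S = {}" "joined a C S"
    by fact+
  show ?case
  proof (cases "t = t0")
    case True
    with h show ?thesis by auto
  next
    case False
    with insert.prems have "t \<in># M" by simp
    then obtain D S' where D: "S = D \<union> S'" "D \<inter> S' = {}" "joined a D S'" "represents D t"
      "\<not> rooted a t" "family a S' (M - {#t#})"
      using insert.IH by blast
    have "family a (C \<union> S') (add_mset t0 (M - {#t#}))"
      using h D by (intro represents_family.insert) auto
    then have "family a (C \<union> S') (add_mset t0 M - {#t#})"
      using False \<open>t \<in># M\<close> by simp
    moreover have "C \<union> S = D \<union> (C \<union> S')" "D \<inter> (C \<union> S') = {}" "joined a D (C \<union> S')"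
      using h D joined_sym by auto
    ultimately show ?thesis using D by blast
  qed
qed auto

text \<open>Here the part is selected by one of its vertices, whereas \<open>family_split\<close>
  selects it by its tree. Uniqueness and the analysis of a given involution have to follow a
  vertex.\<close>

lemma family_part:
  "represents S' t' \<Longrightarrow> True"
  "family a S N \<Longrightarrow> x \<in> S \<Longrightarrow> \<exists>C S' t. S = C \<union> S' \<and> C \<inter> S' = {} \<and> joined a C S' \<and> x \<in> C \<and>
     represents C t \<and> \<not> rooted a t \<and> t \<in># N \<and> family a S' (N - {#t#})"
proof (induction rule: represents_family.inducts)
  case (insert C t0 a S M)
  have h: "represents C t0" "\<not> rooted a t0" "family a S M" "C \<inter> S = {}" "joined a C S"
    by fact+
  show ?case
  proof (cases "x \<in> C")
    case True
    with h show ?thesis by (intro exI[of _ C] exI[of _ S] exI[of _ t0]) auto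
  next
    case False
    with insert.prems have "x \<in> S" by simp
    then obtain D S' t where D: "S = D \<union> S'" "D \<inter> S' = {}" "joined a D S'" "x \<in> D" "represents D t"
      "\<not> rooted a t" "t \<in># M" "family a S' (M - {#t#})"
      using insert.IH by blast
    have "family a (C \<union> S') (add_mset t0 (M - {#t#}))"
      using h D by (intro represents_family.insert) auto
    then have "family a (C \<union> S') (add_mset t0 M - {#t#})"
      using D by (cases "t = t0") auto
    moreover have "C \<union> S = D \<union> (C \<union> S')" "D \<inter> (C \<union> S') = {}" "joined a D (C \<union> S')"
      using h D joined_sym by auto
    ultimately show ?thesis using D by (metis union_single_eq_member add_mset_add_single insertCI set_mset_add_mset_insert)
  qed
qed auto

section \<open>Uniqueness of the cotree\<close>

definition indecomposable :: "bool \<Rightarrow> 'a set \<Rightarrow> bool" where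
  "indecomposable a C \<longleftrightarrow>
     C \<noteq> {} \<and> (\<forall>X Y. C = X \<union> Y \<longrightarrow> X \<inter> Y = {} \<longrightarrow> joined a X Y \<longrightarrow> X = {} \<or> Y = {})"

text \<open>A graph and its complement cannot both be disconnected. A vertex in
  \<open>X \<inter> X'\<close> and one in \<open>Y \<inter> Y'\<close> would be joined by both
  types, and likewise on the other diagonal; so one intersection on each diagonal is empty, and any
  such choice empties one of the four sets.\<close>

lemma joined_conflict:
  assumes "X \<union> Y = X' \<union> Y'" "joined a X Y" "joined (\<not> a) X' Y'"
    and "X \<noteq> {}" "Y \<noteq> {}" "X' \<noteq> {}" "Y' \<noteq> {}" "X \<inter> Y = {}" "X' \<inter> Y' = {}"
  shows False
proof -
  have 1: "X \<inter> X' = {} \<or> Y \<inter> Y' = {}" 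
    using assms(2,3) unfolding joined_def by blast
  have "joined a Y X" using assms(2) joined_sym by simp
  then have 2: "X \<inter> Y' = {} \<or> Y \<inter> X' = {}"
    using assms(3) unfolding joined_def by blast
  from 1 2 have "X \<inter> (X' \<union> Y') = {} \<or> Y \<inter> (X' \<union> Y') = {} \<or> X' \<inter> (X \<union> Y) = {} \<or> Y' \<inter> (X \<union> Y) = {}"
    by blast
  then have "X \<inter> (X \<union> Y) = {} \<or> Y \<inter> (X \<union> Y) = {} \<or> X' \<inter> (X' \<union> Y') = {} \<or> Y' \<inter> (X' \<union> Y') = {}"
    using assms(1) by simp
  then have "X = {} \<or> Y = {} \<or> X' = {} \<or> Y' = {}"
    by blast
  then show False using assms(4-7) by blast
qed

lemma node_split:
  assumes "represents S (Node a M)"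
  shows "\<exists>X Y. S = X \<union> Y \<and> X \<noteq> {} \<and> Y \<noteq> {} \<and> X \<inter> Y = {} \<and> joined a X Y"
proof -
  from assms have f: "family a S M" and s: "size M \<ge> 2" by (auto elim: represents_nodeE)
  then obtain t where t: "t \<in># M" by (cases M) auto
  from family_split(2)[OF f t] obtain C S' where
    C: "S = C \<union> S'" "C \<inter> S' = {}" "joined a C S'" "represents C t" "family a S' (M - {#t#})" by blast
  have "size (M - {#t#}) \<noteq> 0" using s t by (simp add: size_Diff_singleton)
  then have "M - {#t#} \<noteq> {#}" by (metis size_empty)
  then have "S' \<noteq> {}" using family_finite[OF C(5)] by blast
  moreover have "C \<noteq> {}" using represents_finite[OF C(4)] by blast
  ultimately show ?thesis using C(1-3) by blast
qed

text \<open>A root of the opposite type splits \<open>C\<close> with that type, which by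
  \<open>joined_conflict\<close> excludes a split of type \<open>a\<close>. A singleton has no split
  at all.\<close>

lemma represents_indecomposable:
  assumes "represents C t" "\<not> rooted a t"
  shows "indecomposable a C"
proof (cases t)
  case Leaf
  with assms(1) obtain v where "C = {v}" by (auto elim: represents_leafE)
  have "X = {} \<or> Y = {}" if "{v} = X \<union> Y" "X \<inter> Y = {}" for X Y :: "'a set"
    using that by (cases "v \<in> X") auto
  then show ?thesis unfolding \<open>C = {v}\<close> indecomposable_def by simp
next
  case (Node b M)
  with assms have b: "b = (\<not> a)" by auto
  have "represents C (Node (\<not> a) M)" using assms(1) Node b by simp
  from node_split[OF this] obtain X Y where XY:
    "C = X \<union> Y" "X \<noteq> {}" "Y \<noteq> {}" "X \<inter> Y = {}" "joined (\<not> a) X Y" by blast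
  show ?thesis unfolding indecomposable_def
  proof (intro conjI allI impI)
    show "C \<noteq> {}" using XY by blast
    fix X' Y' assume "C = X' \<union> Y'" "X' \<inter> Y' = {}" "joined a X' Y'"
    then show "X' = {} \<or> Y' = {}"
      using joined_conflict[of X' Y' X Y a] XY by argo
  qed
qed

text \<open>For \<open>a = False\<close> these are the connected components of the subgraph induced
  on \<open>S\<close>, for \<open>a = True\<close> those of its complement.\<close>

definition component :: "bool \<Rightarrow> 'a set \<Rightarrow> 'a set \<Rightarrow> bool" where
  "component a S C \<longleftrightarrow> C \<subseteq> S \<and> joined a C (S - C) \<and> indecomposable a C"

text \<open>\<open>C - D\<close> lies outside \<open>D\<close> and is therefore
  \<open>a\<close>-joined to \<open>C \<inter> D\<close>. As \<open>C\<close> is indecomposable and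
  meets \<open>D\<close>, nothing is left in \<open>C - D\<close>.\<close>

lemma component_subset:
  assumes "component a S C" "component a S D" "x \<in> C" "x \<in> D"
  shows "C \<subseteq> D"
proof -
  have "joined a (C \<inter> D) (C - D)"
    using assms(1,2) unfolding component_def joined_def by auto
  moreover have "C = (C \<inter> D) \<union> (C - D)" "(C \<inter> D) \<inter> (C - D) = {}" by auto
  ultimately have "C \<inter> D = {} \<or> C - D = {}"
    using assms(1) unfolding component_def indecomposable_def by metis
  with assms show ?thesis by auto
qed

lemma component_unique:
  "component a S C \<Longrightarrow> component a S D \<Longrightarrow> x \<in> C \<Longrightarrow> x \<in> D \<Longrightarrow> C = D"
  using component_subset by (metis subset_antisym)

lemma component_represents:
  assumes "represents C t" "\<not> rooted a t" "joined a C S" "C \<inter> S = {}"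
  shows "component a (C \<union> S) C"
proof -
  have "C \<union> S - C = S" using assms(4) by auto
  then show ?thesis
    using represents_indecomposable assms unfolding component_def by auto
qed

text \<open>The type of the root is forced by \<open>joined_conflict\<close>. Below it every part is
  a component, hence determined by any of its vertices, so two families over the same set agree part
  by part.\<close>

lemma represents_unique:
  "represents S t \<Longrightarrow> \<forall>t'. represents S t' \<longrightarrow> t = t'"
  "family a S M \<Longrightarrow> \<forall>M'. family a S M' \<longrightarrow> M = M'"
proof (induction rule: represents_family.inducts)
  case (leaf v)
  show ?case
  proof (intro allI impI)
    fix t' assume t': "represents {v} t'"
    show "Leaf = t'"
    proof (cases t')
      case (Node a M)
      with t' have "family a {v} M" "size M \<ge> 2" by (auto elim: represents_nodeE)
      then show ?thesis using family_finite[of a "{v}" M] by auto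
    qed simp
  qed
next
  case (node a S M)
  have h: "family a S M" "size M \<ge> 2" by fact+
  show ?case
  proof (intro allI impI)
    fix t' assume t': "represents S t'"
    have r: "represents S (Node a M)" using h by (intro represents_family.node)
    show "Node a M = t'"
    proof (cases t')
      case Leaf
      with t' obtain v where "S = {v}" by (auto elim: represents_leafE)
      then show ?thesis using family_finite h by force
    next
      case (Node b M')
      have "b = a"
      proof (rule ccontr)
        assume "b \<noteq> a"
        then have "b = (\<not> a)" by auto
        obtain X Y where X: "S = X \<union> Y" "X \<noteq> {}" "Y \<noteq> {}" "X \<inter> Y = {}" "joined a X Y"
          using node_split[OF r] by blast
        obtain X' Y' where X': "S = X' \<union> Y'" "X' \<noteq> {}" "Y' \<noteq> {}" "X' \<inter> Y' = {}" "joined (\<not> a) X' Y'"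
          using node_split[of S b M'] t' Node \<open>b = (\<not> a)\<close> by blast
        show False by (rule joined_conflict[of X Y X' Y' a]) (use X X' in auto)
      qed
      moreover have "family b S M'" using t' unfolding Node by (auto elim: represents_nodeE)
      ultimately have "M = M'" using node.IH by blast
      with Node \<open>b = a\<close> show ?thesis by simp
    qed
  qed
next
  case (empty a)
  then show ?case using family_finite by auto
next
  case (insert C t a S M)
  have h: "represents C t" "\<not> rooted a t" "family a S M" "C \<inter> S = {}" "joined a C S"
    by fact+
  show ?case
  proof (intro allI impI)
    fix M' assume f: "family a (C \<union> S) M'"
    obtain x where x: "x \<in> C" using represents_finite h by blast
    from family_part(2)[OF f, of x] x obtain D S' t' where D: "C \<union> S = D \<union> S'" "D \<inter> S' = {}"
      "joined a D S'" "x \<in> D" "represents D t'" "\<not> rooted a t'" "t' \<in># M'" "family a S' (M' - {#t'#})" by blast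
    have "component a (C \<union> S) C" using h component_represents by blast
    moreover have "component a (C \<union> S) D" using D component_represents by metis
    ultimately have "C = D" using component_unique x D(4) by metis
    moreover from this D(1,2) h have "S = S'" by blast
    ultimately have "t = t'" "M = M' - {#t'#}" using insert.IH D by auto
    then show "add_mset t M = M'" using D by auto
  qed
qed

section \<open>Isomorphisms and fixed-point-free involutions\<close>

definition isomorphic_on :: "('a \<Rightarrow> 'a) \<Rightarrow> 'a set \<Rightarrow> 'a set \<Rightarrow> bool" where
  "isomorphic_on f S T \<longleftrightarrow> bij_betw f S T \<and> (\<forall>x\<in>S. \<forall>y\<in>S. E (f x) (f y) = E x y)"

lemma isomorphic_on_Un:
  assumes "isomorphic_on f S T" "isomorphic_on g S' T'" "S \<inter> S' = {}" "T \<inter> T' = {}"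
    and "joined a S S'" "joined a T T'"
  shows "isomorphic_on (\<lambda>x. if x \<in> S then f x else g x) (S \<union> S') (T \<union> T')"
proof -
  let ?h = "\<lambda>x. if x \<in> S then f x else g x"
  have "bij_betw ?h S T" "bij_betw ?h S' T'"
    using assms(1-3) bij_betw_cong[of S ?h f] bij_betw_cong[of S' ?h g]
    unfolding isomorphic_on_def by (force+)
  then have "bij_betw ?h (S \<union> S') (T \<union> T')" using assms(4) bij_betw_combine by blast
  moreover have "E (?h x) (?h y) = E x y" if x: "x \<in> S \<union> S'" and y: "y \<in> S \<union> S'" for x y
  proof -
    have f: "f x \<in> T" if "x \<in> S" for x
      using assms(1) that unfolding isomorphic_on_def by (auto dest: bij_betwE)
    have g: "g x \<in> T'" if "x \<in> S'" for x
      using assms(2) that unfolding isomorphic_on_def by (auto dest: bij_betwE)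
    have j: "E x y = a" "E y x = a" if "x \<in> S" "y \<in> S'" for x y
      using assms(5) that E_sym by (auto simp: joined_def)
    have k: "E x y = a" "E y x = a" if "x \<in> T" "y \<in> T'" for x y
      using assms(6) that E_sym by (auto simp: joined_def)
    show ?thesis
    proof (cases "x \<in> S"; cases "y \<in> S")
      assume "x \<in> S" "y \<in> S"
      then show ?thesis using assms(1) by (simp add: isomorphic_on_def)
    next
      assume "x \<notin> S" "y \<notin> S"
      then show ?thesis using assms(2) x y by (simp add: isomorphic_on_def)
    qed (use x y f g j k in simp_all)
  qed
  ultimately show ?thesis unfolding isomorphic_on_def by blast
qed

text \<open>Parts with the same tree are matched one by one and their bijections glued. Adjacency is
  preserved because pairs from different parts have type \<open>a\<close> on both sides.\<close>

lemma represents_isomorphic: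
  "represents S t \<Longrightarrow> \<forall>T. represents T t \<longrightarrow> (\<exists>f. isomorphic_on f S T)"
  "family a S M \<Longrightarrow> \<forall>T. family a T M \<longrightarrow> (\<exists>f. isomorphic_on f S T)"
proof (induction rule: represents_family.inducts)
  case (leaf v)
  show ?case
  proof (intro allI impI)
    fix T assume "represents T Leaf"
    then obtain w where "T = {w}" by (auto elim: represents_leafE)
    then have "isomorphic_on (\<lambda>_. w) {v} T"
      using E_irrefl by (auto simp: isomorphic_on_def bij_betw_def)
    then show "\<exists>f. isomorphic_on f {v} T" by blast
  qed
next
  case (node a S M)
  then show ?case by (auto elim: represents_nodeE)
next
  case (empty a)
  then show ?case using family_emptyE by (fastforce simp: isomorphic_on_def)
next
  case (insert C t a S M)
  have h: "represents C t" "\<not> rooted a t" "family a S M" "C \<inter> S = {}" "joined a C S"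
    by fact+
  show ?case
  proof (intro allI impI)
    fix T assume f: "family a T (add_mset t M)"
    from family_split(2)[OF f, of t] obtain D T' where D: "T = D \<union> T'" "D \<inter> T' = {}"
      "joined a D T'" "represents D t" "family a T' M" by auto
    with insert.IH obtain f g where "isomorphic_on f C D" "isomorphic_on g S T'" by blast
    with D h show "\<exists>f. isomorphic_on f (C \<union> S) T" using isomorphic_on_Un by blast
  qed
qed

text \<open>Together with uniqueness this is the converse of \<open>represents_isomorphic\<close>: a
  set and its isomorphic image have the same cotree.\<close>

lemma represents_image:
  "represents S t \<Longrightarrow> inj_on f S \<Longrightarrow> (\<forall>x\<in>S. \<forall>y\<in>S. E (f x) (f y) = E x y) \<Longrightarrow> represents (f ` S) t"
  "family a S M \<Longrightarrow> inj_on f S \<Longrightarrow> (\<forall>x\<in>S. \<forall>y\<in>S. E (f x) (f y) = E x y) \<Longrightarrow> family a (f ` S) M"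
proof (induction rule: represents_family.inducts)
  case (leaf v)
  then show ?case by (auto intro: represents_family.leaf)
next
  case (insert C t a S M)
  have h: "represents C t" "\<not> rooted a t" "family a S M" "C \<inter> S = {}" "joined a C S"
    by fact+
  have "f ` C \<inter> f ` S = {}"
    using h insert.prems(1) by (metis image_empty inj_on_image_Int sup_ge1 sup_ge2)
  moreover have "joined a (f ` C) (f ` S)"
    using h(5) insert.prems(2) by (simp add: joined_def)
  ultimately show ?case unfolding image_Un
    using insert by (intro represents_family.insert) (auto simp: inj_on_Un)
next
  case (node a S M)
  then show ?case by (auto intro: represents_family.node)
next
  case (empty a)
  then show ?case by (simp add: represents_family.empty)
qed

definition fpf_involution :: "('a \<Rightarrow> 'a) \<Rightarrow> 'a set \<Rightarrow> bool" where
  "fpf_involution f S \<longleftrightarrow> (\<forall>x\<in>S. f x \<in> S \<and> f x \<noteq> x \<and> f (f x) = x) \<and>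
     (\<forall>x\<in>S. \<forall>y\<in>S. E (f x) (f y) = E x y)"

lemma fpf_involution_Un:
  assumes "fpf_involution f S" "fpf_involution g T" "S \<inter> T = {}" "joined a S T"
  shows "fpf_involution (\<lambda>x. if x \<in> S then f x else g x) (S \<union> T)"
proof -
  let ?h = "\<lambda>x. if x \<in> S then f x else g x"
  have f: "f x \<in> S" "f x \<noteq> x" "f (f x) = x" if "x \<in> S" for x
    using assms(1) that by (auto simp: fpf_involution_def)
  have g: "g x \<in> T" "g x \<notin> S" "g x \<noteq> x" "g (g x) = x" if "x \<in> T" for x
    using assms(2,3) that by (auto simp: fpf_involution_def)
  have j: "E x y = a" "E y x = a" if "x \<in> S" "y \<in> T" for x y
    using assms(4) that E_sym by (auto simp: joined_def)
  show ?thesis unfolding fpf_involution_def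
  proof (intro conjI ballI)
    fix x assume x: "x \<in> S \<union> T"
    then show "?h x \<in> S \<union> T" "?h x \<noteq> x" "?h (?h x) = x" using f g by auto
    fix y assume y: "y \<in> S \<union> T"
    show "E (?h x) (?h y) = E x y"
    proof (cases "x \<in> S"; cases "y \<in> S")
      assume "x \<in> S" "y \<in> S"
      then show ?thesis using assms(1) by (simp add: fpf_involution_def)
    next
      assume "x \<notin> S" "y \<notin> S"
      then show ?thesis using assms(2) x y by (simp add: fpf_involution_def)
    qed (use x y f g j in simp_all)
  qed
qed

text \<open>The isomorphism is used in one direction and its inverse in the other. Pairs across the
  two sets are exchanged for pairs across, and these all have type \<open>a\<close>.\<close>

lemma fpf_involution_swap:
  assumes "isomorphic_on f S T" "S \<inter> T = {}" "joined a S T"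
  shows "fpf_involution (\<lambda>x. if x \<in> S then f x else inv_into S f x) (S \<union> T)"
proof -
  have b: "bij_betw f S T" and e: "\<And>x y. x \<in> S \<Longrightarrow> y \<in> S \<Longrightarrow> E (f x) (f y) = E x y"
    using assms(1) by (auto simp: isomorphic_on_def)
  let ?g = "inv_into S f"
  have f: "\<And>x. x \<in> S \<Longrightarrow> f x \<in> T \<and> f x \<notin> S \<and> ?g (f x) = x"
    using b assms(2) by (auto simp: bij_betw_def)
  have g: "\<And>y. y \<in> T \<Longrightarrow> ?g y \<in> S \<and> f (?g y) = y \<and> y \<notin> S"
    using b assms(2) by (auto simp: bij_betw_def f_inv_into_f inv_into_into)
  have eg: "E (?g x) (?g y) = E x y" if "x \<in> T" "y \<in> T" for x y
    using e[of "?g x" "?g y"] g that by auto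
  show ?thesis unfolding fpf_involution_def
  proof (intro conjI ballI)
    fix x assume x: "x \<in> S \<union> T"
    let ?h = "\<lambda>x. if x \<in> S then f x else ?g x"
    show "?h x \<in> S \<union> T" "?h (?h x) = x" using x f g by (auto split: if_splits)
    show "?h x \<noteq> x" using x f g by (metis Un_iff)
    fix y assume y: "y \<in> S \<union> T"
    show "E (?h x) (?h y) = E x y"
    proof (cases "x \<in> S"; cases "y \<in> S")
      assume "x \<in> S" "y \<notin> S"
      then have "E (f x) (?g y) = a" "E x y = a"
        using y f g assms(3) E_sym unfolding joined_def by (metis Un_iff)+
      then show ?thesis using \<open>x \<in> S\<close> \<open>y \<notin> S\<close> by simp
    next
      assume "x \<notin> S" "y \<in> S"
      then have "E (?g x) (f y) = a" "E x y = a"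
        using x f g assms(3) E_sym unfolding joined_def by (metis Un_iff)+
      then show ?thesis using \<open>x \<notin> S\<close> \<open>y \<in> S\<close> by simp
    qed (use x y e eg in auto)
  qed
qed

text \<open>Peel off one child with an involution of its own, or two equal children to be exchanged.
  The hypothesis survives for the rest: children of the first kind are exempt from parity, and
  removing a pair keeps the parity. It speaks of involutions rather than of \<open>swappable\<close>
  so that it matches the induction hypothesis over \<open>swappable\<close>.\<close>

lemma family_fpf_involution:
  assumes "family a S M" "\<And>t. t \<in># M \<Longrightarrow> (\<forall>C. represents C t \<longrightarrow> (\<exists>f. fpf_involution f C)) \<or> even (count M t)"
  shows "\<exists>f. fpf_involution f S"
  using assms
proof (induction "size M" arbitrary: S M rule: less_induct)
  case less
  show ?case
  proof (cases "M = {#}")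
    case True
    with less show ?thesis using family_emptyE by (auto simp: fpf_involution_def)
  next
    case False
    then obtain t where t: "t \<in># M" by blast
    from family_split(2)[OF less.prems(1) t] obtain C S' where C: "S = C \<union> S'" "C \<inter> S' = {}"
      "joined a C S'" "represents C t" "family a S' (M - {#t#})" by blast
    have s: "size (M - {#t#}) < size M" using t by (simp add: size_Diff1_less)
    show ?thesis
    proof (cases "\<forall>C. represents C t \<longrightarrow> (\<exists>f. fpf_involution f C)")
      case True
      have "\<exists>f. fpf_involution f S'"
      proof (rule less.hyps[OF s C(5)])
        fix t' assume "t' \<in># M - {#t#}"
        then show "(\<forall>C. represents C t' \<longrightarrow> (\<exists>f. fpf_involution f C)) \<or> even (count (M - {#t#}) t')"
          using less.prems(2)[of t'] True by (cases "t = t'") (auto dest: in_diffD)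
      qed
      with True C show ?thesis using fpf_involution_Un by blast
    next
      case False
      then have ev: "even (count M t)" using less.prems(2) t by blast
      then have t2: "t \<in># M - {#t#}" using t
        by (simp flip: count_greater_zero_iff) presburger
      from family_split(2)[OF C(5) t2] obtain D S'' where D: "S' = D \<union> S''" "D \<inter> S'' = {}"
        "joined a D S''" "represents D t" "family a S'' (M - {#t#} - {#t#})" by blast
      have "\<exists>f. fpf_involution f S''"
      proof (rule less.hyps[OF _ D(5)])
        show "size (M - {#t#} - {#t#}) < size M" using s t2 by (meson order_less_trans size_Diff1_less)
        fix t' assume t': "t' \<in># M - {#t#} - {#t#}"
        then show "(\<forall>C. represents C t' \<longrightarrow> (\<exists>f. fpf_involution f C)) \<or> even (count (M - {#t#} - {#t#}) t')"
          using less.prems(2)[of t'] ev by (cases "t = t'") (auto dest: in_diffD)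
      qed
      then obtain g where g: "fpf_involution g S''" by blast
      obtain f where f: "isomorphic_on f C D" using represents_isomorphic(1) C D by blast
      have "fpf_involution (\<lambda>x. if x \<in> C then f x else inv_into C f x) (C \<union> D)"
        using f C D by (intro fpf_involution_swap) auto
      then have "\<exists>f. fpf_involution f ((C \<union> D) \<union> S'')"
        using fpf_involution_Un[OF _ g, of _ "C \<union> D" a] C D by auto
      then show ?thesis using C D by (simp add: Un_assoc)
    qed
  qed
qed

lemma swappable_imp_fpf_involution:
  "swappable t \<Longrightarrow> represents S t \<Longrightarrow> \<exists>f. fpf_involution f S"
proof (induction arbitrary: S rule: swappable.induct)
  case (1 M a)
  from 1(2) have "family a S M" by (auto elim: represents_nodeE)
  then show ?case by (rule family_fpf_involution) (use 1(1) in blast)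
qed

lemma fpf_involution_subset:
  "fpf_involution f S \<Longrightarrow> T \<subseteq> S \<Longrightarrow> (\<And>x. x \<in> T \<Longrightarrow> f x \<in> T) \<Longrightarrow> fpf_involution f T"
  unfolding fpf_involution_def by blast

lemma fpf_involution_inj: "fpf_involution f S \<Longrightarrow> inj_on f S"
  by (rule inj_on_inverseI[of _ f]) (auto simp: fpf_involution_def)

lemma fpf_involution_component:
  assumes f: "fpf_involution f S" and C: "component a S C"
  shows "component a S (f ` C)"
proof -
  have CS: "C \<subseteq> S" using C by (simp add: component_def)
  have i: "f (f x) = x" "f x \<in> S" if "x \<in> S" for x using f that by (auto simp: fpf_involution_def)
  have e: "E (f x) (f y) = E x y" if "x \<in> S" "y \<in> S" for x y using f that by (auto simp: fpf_involution_def)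
  have j: "joined a (f ` X) (f ` Y) \<longleftrightarrow> joined a X Y" if "X \<subseteq> S" "Y \<subseteq> S" for X Y
    using e that unfolding joined_def by (auto simp: subset_iff)
  have inv: "f ` f ` X = X" if "X \<subseteq> S" for X using i that by (force simp: image_iff)
  have sub: "f ` X \<subseteq> S" if "X \<subseteq> S" for X using i that by auto
  have "f ` S = S" using inv[of S] sub[of S] i by blast
  then have "S - f ` C = f ` (S - C)"
    using CS inj_on_image_set_diff[OF fpf_involution_inj[OF f], of S C] by auto
  then have "joined a (f ` C) (S - f ` C)" using j[of C "S - C"] CS C by (auto simp: component_def)
  moreover have "indecomposable a (f ` C)"
    unfolding indecomposable_def
  proof (intro conjI allI impI)
    show "f ` C \<noteq> {}" using C by (auto simp: component_def indecomposable_def)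
    fix X Y assume XY: "f ` C = X \<union> Y" "X \<inter> Y = {}" "joined a X Y"
    then have s: "X \<subseteq> S" "Y \<subseteq> S" using sub[OF CS] by auto
    have "C = f ` X \<union> f ` Y" using inv[OF CS] XY by (metis image_Un)
    moreover have "f ` X \<inter> f ` Y = {}"
      using inj_on_image_Int[OF fpf_involution_inj[OF f] s] XY by auto
    moreover have "joined a (f ` X) (f ` Y)" using j s XY by blast
    ultimately have "f ` X = {} \<or> f ` Y = {}"
      using C unfolding component_def indecomposable_def by blast
    then show "X = {} \<or> Y = {}" by simp
  qed
  ultimately show ?thesis using sub[OF CS] unfolding component_def by blast
qed

text \<open>An involution permutes the components of \<open>S\<close>. A component mapped to itself
  is swappable by the outer induction; the others come in pairs with equal cotrees. The inner
  induction removes one fixed component or one exchanged pair at a time.\<close>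

lemma fpf_involution_imp_swappable:
  "represents S t \<Longrightarrow> fpf_involution f S \<Longrightarrow> swappable t"
proof (induction "card S" arbitrary: S t rule: less_induct)
  case less
  note outer = less.hyps
  have fam: "swappable t \<or> even (count M t)" if "family a T M" "size M \<ge> 2" "T = S" for a T M t
  proof -
    \<comment> \<open>The last condition makes every part of \<open>T\<close> strictly smaller than
      \<open>S\<close>, as the outer induction requires: either \<open>T\<close> is smaller already,
      or at least two parts share it.\<close>
    have "swappable t \<or> even (count M t)"
      if "family a T M" "fpf_involution f T" "T \<subseteq> S" "size M \<ge> 2 \<or> T \<noteq> S" for a T M t
      using that
    proof (induction "card T" arbitrary: T M rule: less_induct)
      case (less T M)
      have finT: "finite T" using family_finite less.prems by blast
      have finS: "finite S" using represents_finite \<open>represents S _\<close> by blast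
      show ?case
      proof (cases "T = {}")
        case True
        then have "M = {#}" using family_finite[OF less.prems(1)] by blast
        then show ?thesis by simp
      next
        case False
        then obtain x where x: "x \<in> T" by blast
        from family_part(2)[OF less.prems(1) x] obtain C R s where C: "T = C \<union> R" "C \<inter> R = {}"
          "joined a C R" "x \<in> C" "represents C s" "\<not> rooted a s" "s \<in># M" "family a R (M - {#s#})" by blast
        have "card C < card S"
        proof (cases "T = S")
          case True
          then have "size M \<ge> 2" using less.prems by blast
          then have "size (M - {#s#}) \<ge> 1" using C by (simp add: size_Diff_singleton)
          then have "R \<noteq> {}" using family_emptyE family_finite[OF C(8)] by force
          then show ?thesis using C True finS by (intro psubset_card_mono) auto
        next
          case False
          then have "card T < card S" using less.prems finS by (intro psubset_card_mono) auto
          moreover have "card C \<le> card T" using C finT by (intro card_mono) auto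
          ultimately show ?thesis by simp
        qed
        note cardC = this
        have cardR: "card R' < card T" if "R' \<subseteq> R" for R' using C that finT by (intro psubset_card_mono) auto
        have compC: "component a T C" using C component_represents by metis
        have inv: "f y \<in> T" "f (f y) = y" if "y \<in> T" for y
          using less.prems(2) that by (auto simp: fpf_involution_def)
        have adj: "\<forall>y\<in>T. \<forall>z\<in>T. E (f y) (f z) = E y z"
          using less.prems(2) by (simp add: fpf_involution_def)
        have RS: "R \<subseteq> S" "R \<noteq> S" using C less.prems by auto
        show ?thesis
        proof (cases "f x \<in> C")
          case True
          have compfC: "component a T (f ` C)"
            using fpf_involution_component[OF less.prems(2) compC] .
          then have eq: "f ` C = C" using component_unique[OF compfC compC, of "f x"] True C(4) by blast
          have "fpf_involution f C"
            by (rule fpf_involution_subset[OF less.prems(2)]) (use eq C(1) in blast)+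
          then have sw: "swappable s" using outer[OF cardC C(5)] by blast
          have "f y \<in> R" if "y \<in> R" for y
          proof -
            have yT: "y \<in> T" "y \<notin> C" using that C(1,2) by blast+
            then have "f y \<notin> C" using eq inv(2)[of y] by (metis image_eqI)
            then show ?thesis using inv(1)[OF yT(1)] C(1) by blast
          qed
          then have fR: "fpf_involution f R"
            by (intro fpf_involution_subset[OF less.prems(2)]) (use C(1) in blast)+
          have "swappable t \<or> even (count (M - {#s#}) t)"
            by (rule less.hyps[OF cardR C(8) fR]) (simp_all add: RS)
          then show ?thesis using sw by (cases "s = t") simp_all
        next
          case False
          then have fx: "f x \<in> R" using inv(1)[OF x] C(1) by blast
          from family_part(2)[OF C(8) fx] obtain D Q s' where D: "R = D \<union> Q" "D \<inter> Q = {}"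
            "joined a D Q" "f x \<in> D" "represents D s'" "\<not> rooted a s'" "s' \<in># M - {#s#}"
            "family a Q (M - {#s#} - {#s'#})" by blast
          have "component a (D \<union> (C \<union> Q)) D"
            using D C joined_sym by (intro component_represents) auto
          then have compD: "component a T D" using C D by (simp add: Un_left_commute)
          have compfC: "component a T (f ` C)"
            using fpf_involution_component[OF less.prems(2) compC] .
          have eq: "f ` C = D" using component_unique[OF compfC compD, of "f x"] C(4) D(4) by blast
          have "f ` f ` C = (\<lambda>y. y) ` C"
            unfolding image_image using inv(2) C(1) by (intro image_cong) auto
          then have eq2: "f ` D = C" unfolding eq by simp
          have "C \<subseteq> T" using C(1) by blast
          then have "represents (f ` C) s"
            using C(5) inj_on_subset[OF fpf_involution_inj[OF less.prems(2)]] adj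
            by (intro represents_image(1)) blast+
          then have ss: "s = s'" using represents_unique(1) D(5) eq by blast
          have "f y \<in> Q" if "y \<in> Q" for y
          proof -
            have yT: "y \<in> T" "y \<notin> C" "y \<notin> D" using that C(1,2) D(1,2) by blast+
            then have "f y \<notin> C" "f y \<notin> D" using eq eq2 inv(2)[of y] by (metis image_eqI)+
            then show ?thesis using inv(1)[OF yT(1)] C(1) D(1) by blast
          qed
          then have fQ: "fpf_involution f Q"
            by (intro fpf_involution_subset[OF less.prems(2)]) (use C(1) D(1) in blast)+
          have QR: "Q \<subseteq> R" "Q \<subseteq> S" "Q \<noteq> S" using D(1) RS by blast+
          have "swappable t \<or> even (count (M - {#s#} - {#s'#}) t)"
            by (rule less.hyps[OF cardR D(8) fQ]) (simp_all add: QR)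
          then have "swappable t \<or> even (count (M - {#s#} - {#s#}) t)"
            using ss by simp
          moreover have "count (M - {#s#}) s > 0" using D(7) unfolding ss count_greater_zero_iff .
          then have "count M s \<ge> 2" by simp
          ultimately show ?thesis by (cases "s = t") simp_all
        qed
      qed
    qed
    from this[OF that(1)] that(2,3) less.prems(2) show ?thesis by blast
  qed
  show ?case
  proof (cases t)
    case Leaf
    then obtain v where "S = {v}" using less.prems by (auto elim: represents_leafE)
    then show ?thesis using less.prems(2) by (auto simp: fpf_involution_def)
  next
    case (Node a M)
    then have "family a S M" "size M \<ge> 2" using less.prems(1) by (auto elim: represents_nodeE)
    then show ?thesis unfolding Node swappable_Node using fam by blast
  qed
qed

end

section \<open>Time credits for the random access machine\<close>

text \<open>
  \<open>T\<close> is a number of time credits; the postcondition \<open>Q\<close> also sees the credits left over.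
  Loops need no separate termination argument, because each test consumes a credit.
\<close>

definition run :: "com \<Rightarrow> (nat \<Rightarrow> ram_state \<Rightarrow> bool) \<Rightarrow> nat \<Rightarrow> ram_state \<Rightarrow> bool" where
  "run c Q T s \<longleftrightarrow> (\<exists>t s'. exec c s t s' \<and> t \<le> T \<and> Q (T - t) s')"

lemma run_mono: "run c Q T s \<Longrightarrow> (\<And>T' s'. Q T' s' \<Longrightarrow> Q' T' s') \<Longrightarrow> run c Q' T s"
  unfolding run_def by blast

lemma run_Skip [simp]: "run Skip Q T s \<longleftrightarrow> 1 \<le> T \<and> Q (T - 1) s"
  unfolding run_def using exec.Skip by (fastforce elim: exec_SkipE)

lemma run_Assign [simp]: "run (Assign r e) Q T s \<longleftrightarrow>
    1 + exp_cost e \<le> T \<and> Q (T - (1 + exp_cost e)) (s\<lparr>regs := (regs s)(r := exp_val e s)\<rparr>)"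
  unfolding run_def using exec.Assign by (fastforce elim: exec_AssignE)

lemma run_Write [simp]: "run (Write a e f) Q T s \<longleftrightarrow>
    1 + exp_cost e + exp_cost f \<le> T \<and> Q (T - (1 + exp_cost e + exp_cost f))
      (s\<lparr>arrs := (arrs s)(a := (arrs s a)(exp_val e s := exp_val f s))\<rparr>)"
  unfolding run_def using exec.Write by (fastforce elim: exec_WriteE)

lemma run_Seq [simp]: "run (Seq c d) Q T s \<longleftrightarrow> run c (run d Q) T s"
proof
  assume "run (Seq c d) Q T s"
  then obtain t1 t2 s1 s2 where "exec c s t1 s1" "exec d s1 t2 s2" "t1 + t2 \<le> T" "Q (T - (t1 + t2)) s2"
    unfolding run_def by (auto elim: exec_SeqE)
  then show "run c (run d Q) T s"
    unfolding run_def by (intro exI[of _ t1] exI[of _ s1] conjI exI[of _ t2] exI[of _ s2]) auto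
next
  assume "run c (run d Q) T s"
  then obtain t1 t2 s1 s2 where "exec c s t1 s1" "t1 \<le> T" "exec d s1 t2 s2" "t2 \<le> T - t1"
    "Q (T - t1 - t2) s2" unfolding run_def by blast
  then show "run (Seq c d) Q T s"
    unfolding run_def by (intro exI[of _ "t1 + t2"] exI[of _ s2]) (auto intro: exec.Seq)
qed

lemma run_Cond [simp]: "run (Cond b c d) Q T s \<longleftrightarrow> 1 + test_cost b \<le> T \<and>
    (if test_val b s then run c Q (T - (1 + test_cost b)) s else run d Q (T - (1 + test_cost b)) s)"
proof -
  have "run (Cond b c d) Q T s" if "run e Q (T - (1 + test_cost b)) s" "1 + test_cost b \<le> T"
    "e = (if test_val b s then c else d)" for e
  proof -
    from that obtain t s' where "exec e s t s'" "t \<le> T - (1 + test_cost b)" "Q (T - (1 + test_cost b) - t) s'"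
      unfolding run_def by blast
    moreover from this have "exec (Cond b c d) s (1 + test_cost b + t) s'"
      using that(3) exec.Cond_True exec.Cond_False by (metis (full_types))
    ultimately show ?thesis unfolding run_def using that(2)
      by (intro exI[of _ "1 + test_cost b + t"] exI[of _ s']) auto
  qed
  moreover have "1 + test_cost b \<le> T \<and> run (if test_val b s then c else d) Q (T - (1 + test_cost b)) s"
    if "run (Cond b c d) Q T s"
  proof -
    from that obtain t s' where t: "exec (Cond b c d) s t s'" "t \<le> T" "Q (T - t) s'"
      unfolding run_def by blast
    from t(1) obtain t' where "exec (if test_val b s then c else d) s t' s'" "t = 1 + test_cost b + t'"
      by (rule exec_CondE) auto
    with t show ?thesis unfolding run_def by (auto intro!: exI[of _ t'] exI[of _ s'])
  qed
  ultimately show ?thesis by (smt (verit))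
qed

lemma run_While:
  assumes "I T s"
    and cost: "\<And>T s. I T s \<Longrightarrow> 1 + test_cost b \<le> T"
    and step: "\<And>T s. I T s \<Longrightarrow> test_val b s \<Longrightarrow> run c I (T - (1 + test_cost b)) s"
    and exit: "\<And>T s. I T s \<Longrightarrow> \<not> test_val b s \<Longrightarrow> Q (T - (1 + test_cost b)) s"
  shows "run (While b c) Q T s"
  using assms(1)
proof (induction T arbitrary: s rule: less_induct)
  case (less T)
  let ?k = "1 + test_cost b"
  have k: "?k \<le> T" using cost[OF less.prems] .
  show ?case
  proof (cases "test_val b s")
    case True
    with step[OF less.prems] obtain t s' where t: "exec c s t s'" "t \<le> T - ?k" "I (T - ?k - t) s'"
      unfolding run_def by auto
    have "T - ?k - t < T" using k by simp
    from less.IH[OF this t(3)] obtain u s'' where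
      "exec (While b c) s' u s''" "u \<le> T - ?k - t" "Q (T - ?k - t - u) s''"
      unfolding run_def by blast
    with t True k show ?thesis unfolding run_def
      by (intro exI[of _ "1 + test_cost b + t + u"] exI[of _ s'']) (use exec.While_True[OF True t(1)] in auto)
  next
    case False
    with exit[OF less.prems] k exec.While_False[OF False, of c] show ?thesis
      unfolding run_def by blast
  qed
qed

text \<open>
  Multiplication being unavailable, \<open>offA\<close> holds the row offsets \<open>i * n\<close>. \<open>typeA\<close> is 0 for a leaf
  and 1 or 2 for a node of type \<open>False\<close> or \<open>True\<close>, \<open>classA\<close> is the number of the isomorphism type of
  the cotree of a vertex and \<open>rowA\<close> the multiplicities of the types of its children. \<open>swapA\<close> is
  indexed by isomorphism types. \<open>downA\<close> and \<open>rightA\<close> are the two child pointers of the trie and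
  \<open>nodeA\<close> its payload, where 0 means absent (type 0 is the leaf, which is not stored).
\<close>

abbreviation (input) "matA \<equiv> 0 :: nat"
abbreviation (input) "offA \<equiv> 1 :: nat"
abbreviation (input) "stackA \<equiv> 2 :: nat"
abbreviation (input) "deadA \<equiv> 3 :: nat"
abbreviation (input) "typeA \<equiv> 4 :: nat"
abbreviation (input) "classA \<equiv> 5 :: nat"
abbreviation (input) "rowA \<equiv> 6 :: nat"
abbreviation (input) "swapA \<equiv> 7 :: nat"
abbreviation (input) "downA \<equiv> 8 :: nat"
abbreviation (input) "rightA \<equiv> 9 :: nat"
abbreviation (input) "nodeA \<equiv> 10 :: nat"

abbreviation (input) "nR \<equiv> 0 :: nat"
abbreviation (input) "outR \<equiv> 1 :: nat"
abbreviation (input) "aliveR \<equiv> 2 :: nat"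
abbreviation (input) "heightR \<equiv> 3 :: nat"
abbreviation (input) "vR \<equiv> 4 :: nat"
abbreviation (input) "uR \<equiv> 5 :: nat"
abbreviation (input) "zR \<equiv> 6 :: nat"
abbreviation (input) "pR \<equiv> 7 :: nat"
abbreviation (input) "qR \<equiv> 8 :: nat"
abbreviation (input) "wR \<equiv> 9 :: nat"
abbreviation (input) "foundR \<equiv> 10 :: nat"
abbreviation (input) "gR \<equiv> 11 :: nat"
abbreviation (input) "eR \<equiv> 12 :: nat"
abbreviation (input) "xR \<equiv> 13 :: nat"
abbreviation (input) "cR \<equiv> 14 :: nat"
abbreviation (input) "goodR \<equiv> 15 :: nat"
abbreviation (input) "freshR \<equiv> 16 :: nat"
abbreviation (input) "countR \<equiv> 17 :: nat"
abbreviation (input) "mR \<equiv> 18 :: nat"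
abbreviation (input) "parR \<equiv> 19 :: nat"
abbreviation (input) "yR \<equiv> 20 :: nat"
abbreviation (input) "tR \<equiv> 21 :: nat"

section \<open>The program\<close>

fun block :: "com list \<Rightarrow> com" where
  "block [] = Skip"
| "block [c] = c"
| "block (c # d # cs) = Seq c (block (d # cs))"

definition advance_row :: com where
  "advance_row = While (Lt (Reg cR) (Reg nR))
     (Seq (Assign pR (Inc (Reg pR))) (Assign cR (Inc (Reg cR))))"

definition init_offsets :: com where
  "init_offsets = block [Assign zR (Const 0), Assign pR (Const 0),
     While (Lt (Reg zR) (Reg nR)) (block [
       Write offA (Reg zR) (Reg pR), Assign cR (Const 0), advance_row,
       Assign zR (Inc (Reg zR))])]"

text \<open>
  On a stack of height 1 both \<open>u\<close> and \<open>v\<close> are its only element, by truncated subtraction; then any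
  other vertex is a candidate. The swap in \<open>push\<close> has no effect in this case.
\<close>

definition candidate_test :: test where
  "candidate_test = And (Eq (Read deadA (Reg zR)) (Const 0)) (And (Neg (Eq (Reg zR) (Reg uR)))
     (And (Neg (Eq (Reg zR) (Reg vR)))
          (Neg (And (Neg (Eq (Reg uR) (Reg vR))) (Eq (Read matA (Reg pR)) (Read matA (Reg qR)))))))"

text \<open>Addresses such as \<open>u * n + z\<close> cannot be computed, so \<open>pR\<close> and
  \<open>qR\<close> walk along the rows of \<open>v\<close> and \<open>u\<close> in step with
  \<open>zR\<close>. The adjacency of \<open>u\<close> and \<open>v\<close> is picked up in
  \<open>eR\<close> when column \<open>v\<close> is passed. Of several candidates the last one is
  kept.\<close>

definition scan :: com where
  "scan = block [
     Assign pR (Read offA (Reg vR)), Assign qR (Read offA (Reg uR)),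
     Assign zR (Const 0), Assign foundR (Const 0), Assign eR (Const 0),
     While (Lt (Reg zR) (Reg nR)) (block [
       Cond (Eq (Reg zR) (Reg vR)) (Assign eR (Read matA (Reg qR))) Skip,
       Cond candidate_test (block [Assign foundR (Const 1), Assign wR (Reg zR), Assign gR (Read matA (Reg qR))]) Skip,
       Assign zR (Inc (Reg zR)), Assign pR (Inc (Reg pR)), Assign qR (Inc (Reg qR))])]"

text \<open>Alternation requires the edge from the old top to \<open>w\<close> to have the type
  opposite to that of \<open>uv\<close>. As \<open>w\<close> distinguishes \<open>u\<close> and
  \<open>v\<close>, exactly one of them has such an edge, and the swap puts it on top.\<close>

definition push :: com where
  "push = block [
     Cond (Eq (Reg gR) (Reg eR))
       (Seq (Write stackA (Dec (Dec (Reg heightR))) (Reg uR))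
            (Write stackA (Dec (Reg heightR)) (Reg vR))) Skip,
     Write stackA (Reg heightR) (Reg wR),
     Assign heightR (Inc (Reg heightR))]"

text \<open>Memory starts with zeros and trie nodes are numbered from 1, so a 0 is a missing child,
  which is then created on the first visit.\<close>

definition follow :: "nat \<Rightarrow> com" where
  "follow a = Seq
     (Cond (Eq (Read a (Reg xR)) (Const 0))
       (Seq (Write a (Reg xR) (Reg freshR)) (Assign freshR (Inc (Reg freshR)))) Skip)
     (Assign xR (Read a (Reg xR)))"

definition add_loop :: com where
  "add_loop = While (Lt (Const 0) (Reg yR)) (Seq (Assign mR (Inc (Reg mR))) (Assign yR (Dec (Reg yR))))"

definition descend :: com where
  "descend = While (Lt (Const 0) (Reg mR)) (block [
     follow downA,
     Cond (Eq (Reg parR) (Const 0)) (Assign parR (Const 1)) (Assign parR (Const 0)),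
     Assign mR (Dec (Reg mR))])"

text \<open>A vertex whose cotree has the type of the new root hands over the stored multiplicities
  of its children. Any other vertex is a single child: one occurrence of its own class.\<close>

definition fetch :: "nat \<Rightarrow> nat \<Rightarrow> nat \<Rightarrow> com" where
  "fetch x p r = Cond (Eq (Read typeA (Reg x)) (Reg tR)) (Assign r (Read rowA (Reg p)))
     (Cond (Eq (Reg cR) (Read classA (Reg x))) (Assign r (Const 1)) (Assign r (Const 0)))"

definition mark_odd :: com where
  "mark_odd = Cond (And (Eq (Read swapA (Reg cR)) (Const 0)) (Eq (Reg parR) (Const 1)))
     (Assign goodR (Const 0)) Skip"

text \<open>
  One column \<open>c\<close> of a merge: the multiplicity of class \<open>c\<close> among the children of the merged
  node is stored in the row of \<open>v\<close> and spelt into the trie in unary.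
\<close>

definition column :: com where
  "column = block [
     fetch vR pR mR, fetch uR qR yR, add_loop,
     Write rowA (Reg pR) (Reg mR), Assign parR (Const 0), descend, mark_odd, follow rightA,
     Assign cR (Inc (Reg cR)), Assign pR (Inc (Reg pR)), Assign qR (Inc (Reg qR))]"

text \<open>\<open>v\<close> survives and stands for both. The type code \<open>tR\<close>, 1 or 2,
  is at the same time the number of the trie root from which multisets of that type are
  spelt.\<close>

definition merge_twins :: com where
  "merge_twins = block [
     Write deadA (Reg uR) (Const 1),
     Assign heightR (Dec (Reg heightR)), Assign aliveR (Dec (Reg aliveR)),
     Assign tR (Inc (Reg eR)), Assign xR (Reg tR),
     Assign pR (Read offA (Reg vR)), Assign qR (Read offA (Reg uR)),
     Assign cR (Const 0), Assign goodR (Const 1),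
     While (Lt (Reg cR) (Reg nR)) column,
     Cond (Eq (Read nodeA (Reg xR)) (Const 0)) (block [
       Write nodeA (Reg xR) (Reg countR),
       Write swapA (Reg countR) (Reg goodR),
       Assign countR (Inc (Reg countR))]) Skip,
     Write classA (Reg vR) (Read nodeA (Reg xR)),
     Write typeA (Reg vR) (Reg tR)]"

definition iteration :: com where
  "iteration = block [
     Assign vR (Read stackA (Dec (Dec (Reg heightR)))),
     Assign uR (Read stackA (Dec (Reg heightR))),
     scan,
     Cond (Eq (Reg foundR) (Const 1)) push merge_twins]"

text \<open>\<open>countR\<close> starts at 1 because class 0 is the leaf, \<open>freshR\<close> at
  3 because nodes 1 and 2 are the trie roots. The zeros of the initial memory already say that
  vertex 0 is on the stack and that a leaf is not swappable.\<close>

definition decide_swappable :: com where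
  "decide_swappable = block [
     init_offsets,
     Assign aliveR (Reg nR), Assign heightR (Const 1), Assign countR (Const 1), Assign freshR (Const 3),
     While (Lt (Const 1) (Reg aliveR)) iteration,
     Assign outR (Read swapA (Read classA (Read stackA (Const 0))))]"

section \<open>Correctness and cost of the elementary routines\<close>

definition unchanged :: "nat set \<Rightarrow> nat set \<Rightarrow> ram_state \<Rightarrow> ram_state \<Rightarrow> bool" where
  "unchanged R A s s' \<longleftrightarrow> (\<forall>r. r \<notin> R \<longrightarrow> regs s' r = regs s r) \<and> (\<forall>a. a \<notin> A \<longrightarrow> arrs s' a = arrs s a)"

lemma unchanged_trans:
  "unchanged R A s s' \<Longrightarrow> unchanged R' A' s' s'' \<Longrightarrow> R \<union> R' \<subseteq> R'' \<Longrightarrow> A \<union> A' \<subseteq> A'' \<Longrightarrow> unchanged R'' A'' s s''"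
  unfolding unchanged_def by (metis UnCI subsetD)

text \<open>Stands in for the addition of a row length. The credit bounds of this and the following
  routines are rounded up.\<close>

lemma advance_row:
  assumes "T \<ge> X + 15 * (n - regs s cR) + 10" "regs s cR \<le> n" "regs s nR = n"
  shows "run advance_row (\<lambda>T' s'. T' \<ge> X \<and> unchanged {pR, cR} {} s s' \<and>
           regs s' pR = regs s pR + (n - regs s cR)) T s"
  unfolding advance_row_def
proof (rule run_While[where I = "\<lambda>T s'. unchanged {pR, cR} {} s s' \<and> regs s' cR \<le> n \<and>
       regs s' pR + regs s cR = regs s pR + regs s' cR \<and> T \<ge> X + 10 + 15 * (n - regs s' cR)"], goal_cases)
  case 1
  then show ?case using assms by (simp add: unchanged_def)
next
  case (2 T s')
  then show ?case by simp
next
  case (3 T s')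
  then show ?case using assms(2,3) by (auto simp: unchanged_def)
next
  case (4 T s')
  then show ?case using assms(2,3) by (auto simp: unchanged_def)
qed

lemma init_offsets:
  assumes "T \<ge> X + (15 * n * n + 50 * n + 30)" and n: "regs s nR = n"
  shows "run init_offsets (\<lambda>T' s'. T' \<ge> X \<and> unchanged {zR, pR, cR} {offA} s s' \<and>
           (\<forall>i<n. arrs s' offA i = i * n)) T s"
proof -
  let ?I = "\<lambda>T s'. unchanged {zR, pR, cR} {offA} s s' \<and> regs s' zR \<le> n \<and>
     regs s' pR = regs s' zR * n \<and> (\<forall>i<regs s' zR. arrs s' offA i = i * n) \<and>
     T \<ge> X + 10 + (n - regs s' zR) * (15 * n + 50)"
  show ?thesis
    unfolding init_offsets_def block.simps run_Seq run_Assign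
  proof (intro conjI, goal_cases)
    case 3
    show ?case
    proof (rule run_While[where I = ?I], goal_cases)
      case 1
      then show ?case using assms by (simp add: unchanged_def algebra_simps)
    next
      case (2 T s')
      then show ?case by simp
    next
      case (4 T s')
      then show ?case using n by (auto simp: unchanged_def)
    next
      case (3 T s')
      have lt: "regs s' zR < n" using 3 n by (simp add: unchanged_def)
      then have "n - regs s' zR = Suc (n - Suc (regs s' zR))" by simp
      with 3 have T: "T \<ge> X + 10 + (n - Suc (regs s' zR)) * (15 * n + 50) + (15 * n + 50)"
        by simp
      show ?case
        apply (simp del: One_nat_def)
        apply (intro conjI)
        subgoal using T by simp
        subgoal using T by simp
        apply (rule run_mono[OF advance_row[where n = n and X = "T - 19 - 15 * n"]])
        subgoal using T by simp
        subgoal by simp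
        subgoal using 3 n by (simp add: unchanged_def)
        subgoal using 3 n T lt by (auto simp: unchanged_def less_Suc_eq)
        done
    qed
  qed (use assms in auto)
qed

lemma scan:
  fixes E :: "nat \<Rightarrow> nat \<Rightarrow> bool"
  assumes T: "T \<ge> X + 80 * n + 40" and n: "regs s nR = n"
    and off: "\<And>i. i < n \<Longrightarrow> arrs s offA i = i * n"
    and mat: "\<And>i j. i < n \<Longrightarrow> j < n \<Longrightarrow> arrs s matA (i * n + j) = of_bool (E i j)"
    and v: "v < n" "regs s vR = v" and u: "u < n" "regs s uR = u"
    and cand: "\<And>z. cand z \<longleftrightarrow> z < n \<and> arrs s deadA z = 0 \<and> z \<noteq> u \<and> z \<noteq> v \<and> (u = v \<or> E v z \<noteq> E u z)"
  shows "run scan (\<lambda>T' s'. T' \<ge> X \<and> unchanged {pR, qR, zR, foundR, eR, wR, gR} {} s s' \<and>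
     regs s' eR = of_bool (E u v) \<and>
     (if \<exists>z. cand z then regs s' foundR = 1 \<and> cand (regs s' wR) \<and> regs s' gR = of_bool (E u (regs s' wR))
      else regs s' foundR = 0)) T s"
proof -
  let ?I = "\<lambda>T s'. unchanged {pR, qR, zR, foundR, eR, wR, gR} {} s s' \<and> regs s' zR \<le> n \<and>
     regs s' pR = v * n + regs s' zR \<and> regs s' qR = u * n + regs s' zR \<and>
     regs s' eR = of_bool (v < regs s' zR \<and> E u v) \<and>
     (if \<exists>z<regs s' zR. cand z
      then regs s' foundR = 1 \<and> cand (regs s' wR) \<and> regs s' gR = of_bool (E u (regs s' wR))
      else regs s' foundR = 0) \<and>
     T \<ge> X + 10 + (n - regs s' zR) * 80"
  show ?thesis
    unfolding scan_def block.simps run_Seq run_Assign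
  proof (intro conjI, goal_cases)
    case 6
    show ?case
    proof (rule run_While[where I = ?I], goal_cases)
      case 1
      then show ?case using T n off[OF v(1)] off[OF u(1)] v u by (simp add: unchanged_def)
    next
      case (2 T s')
      then show ?case by simp
    next
      case (4 T s')
      then have z: "regs s' zR = n" using n by (simp add: unchanged_def)
      have "(\<exists>z<n. cand z) \<longleftrightarrow> (\<exists>z. cand z)" using cand by blast
      then show ?case using 4 v z by auto
    next
      case (3 T s')
      have lt: "regs s' zR < n" using 3 n by (simp add: unchanged_def)
      then have "n - regs s' zR = Suc (n - Suc (regs s' zR))" by simp
      with 3 have T: "T \<ge> X + 10 + (n - Suc (regs s' zR)) * 80 + 80"
        by simp
      obtain i where i: "regs s' 6 = i" by blast
      have W: "X + (n - (i + 1)) * 80 + 90 \<le> T" using T unfolding i by simp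
      have mats: "arrs s 0 (v * n + i) = of_bool (E v i)"
        "arrs s 0 (u * n + i) = of_bool (E u i)"
        using mat[OF v(1) lt] mat[OF u(1) lt] by (simp_all add: i)
      have s': "\<And>r. r \<notin> {7, 8, 6, 10, 12, 9, 11} \<Longrightarrow> regs s' r = regs s r" "arrs s' = arrs s"
        "regs s' 7 = v * n + i" "regs s' 8 = u * n + i" "regs s' 12 = of_bool (v < i \<and> E u v)"
        using 3 i by (auto simp: unchanged_def)
      have old: "if \<exists>z<i. cand z
        then regs s' foundR = 1 \<and> cand (regs s' wR) \<and> regs s' gR = of_bool (E u (regs s' wR))
        else regs s' foundR = 0" using 3 i by simp
      have frame: "regs s' 4 = v" "regs s' 5 = u" "regs s' 0 = n"
        using s'(1) v u n by simp_all
      have c: "(\<exists>z<i + 1. cand z) \<longleftrightarrow> (\<exists>z<i. cand z) \<or> cand i"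
        by (auto simp: less_Suc_eq simp flip: Suc_eq_plus1)
      have lt': "i < n" using lt i by simp
      have ci: "cand i \<longleftrightarrow> arrs s 3 i = 0 \<and> i \<noteq> u \<and> i \<noteq> v \<and> (u = v \<or> E v i \<noteq> E u i)"
        unfolding cand[of i] using lt' by simp
      have test: "test_val candidate_test (s'\<lparr>regs := (regs s')(12 := e)\<rparr>) = cand i" for e
        unfolding ci by (simp add: candidate_test_def s' frame i mats)
      then have test': "test_val candidate_test s' = cand i"
        unfolding ci by (simp add: candidate_test_def s' frame i mats)
      have cost: "test_cost candidate_test = 26" by (simp add: candidate_test_def)
      have e: "v < i + 1 \<longleftrightarrow> v < i \<or> i = v" by auto
      have frame': "\<forall>r. r \<notin> {7, 8, 6, 10, 12, 9, 11} \<longrightarrow> regs s' r = regs s r" using s' by blast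
      show ?case
      proof (cases "cand i")
        case True
        then have "i \<noteq> v" using ci by blast
        with True W lt' show ?thesis
          by (simp add: unchanged_def Nat.le_diff_conv2 i s'(2-) frame frame'[simplified] mats c e test' cost del: One_nat_def)
      next
        case nc: False
        show ?thesis
        proof (cases "i = v")
          case True
          with nc W lt' old mats(2) show ?thesis
            by (simp add: unchanged_def Nat.le_diff_conv2 i s'(2-) frame frame'[simplified] c[unfolded True] test cost
                del: One_nat_def split del: if_split cong: if_cong)
        next
          case False
          with nc W lt' old show ?thesis
            by (simp add: unchanged_def Nat.le_diff_conv2 i s'(2-) frame frame'[simplified] c e test' cost
                del: One_nat_def split del: if_split cong: if_cong)
        qed
      qed
    qed
  qed (use T in auto)
qed

section \<open>A trie of multiset codes\<close>

type_synonym key = "bool \<times> nat list \<times> nat"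

text \<open>
  The key \<open>(a, ks, j)\<close> of a trie node says that for a node of type \<open>a\<close> the multiplicities \<open>ks\<close> have
  been read completely and \<open>j\<close> occurrences of the next class so far.
\<close>

fun step_key :: "bool \<Rightarrow> key \<Rightarrow> key" where
  "step_key False (a, ks, j) = (a, ks, Suc j)"
| "step_key True (a, ks, j) = (a, ks @ [j], 0)"

lemma step_key_eq: "step_key b k = step_key c l \<longleftrightarrow> b = c \<and> k = l"
  by (cases k; cases l; cases b; cases c) auto

lemma step_key_root: "step_key b k \<noteq> (a, [], 0)"
  by (cases k; cases b) auto

lemma step_key_neq: "step_key b k \<noteq> k"
  by (cases k; cases b) auto

definition trie :: "nat \<Rightarrow> (bool \<Rightarrow> nat \<Rightarrow> nat) \<Rightarrow> (nat \<Rightarrow> key) \<Rightarrow> bool" where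
  "trie m N key \<longleftrightarrow> 3 \<le> m \<and> key 1 = (False, [], 0) \<and> key 2 = (True, [], 0) \<and>
     inj_on key {1..<m} \<and>
     (\<forall>b k. step_key b k \<in> key ` {1..<m} \<longrightarrow> k \<in> key ` {1..<m}) \<and>
     (\<forall>b. \<forall>x\<in>{1..<m}. N b x \<noteq> 0 \<longrightarrow> N b x \<in> {1..<m} \<and> key (N b x) = step_key b (key x)) \<and>
     (\<forall>b. \<forall>x\<in>{1..<m}. N b x = 0 \<longrightarrow> step_key b (key x) \<notin> key ` {1..<m}) \<and>
     (\<forall>b. \<forall>x\<ge>m. N b x = 0)"

text \<open>The new key was absent because the pointer to it was 0. Its own extensions are absent
  too, as closure under prefixes would otherwise have put the key there before; and since
  \<open>step_key\<close> is injective, no other zero pointer becomes wrong.\<close>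

lemma trie_alloc:
  assumes t: "trie m N key" and x: "x \<in> {1..<m}" and N: "N b x = 0"
  shows "trie (Suc m) (N(b := (N b)(x := m))) (key(m := step_key b (key x)))"
proof -
  let ?N = "N(b := (N b)(x := m))" and ?key = "key(m := step_key b (key x))"
  have m: "3 \<le> m" using t by (simp add: trie_def)
  have new: "step_key b (key x) \<notin> key ` {1..<m}" using t x N by (simp add: trie_def)
  have img: "?key ` {1..<Suc m} = insert (step_key b (key x)) (key ` {1..<m})"
  proof -
    have "{1..<Suc m} = insert m {1..<m}" using m by auto
    then show ?thesis by auto
  qed
  have inj: "inj_on key {1..<m}" using t by (simp add: trie_def)
  have closed: "k \<in> key ` {1..<m}" if "step_key c k \<in> key ` {1..<m}" for c k
    using t that unfolding trie_def by blast
  have "inj_on ?key {1..<Suc m}"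
  proof -
    have "{1..<Suc m} = insert m {1..<m}" using m by auto
    moreover have "inj_on ?key {1..<m}" using inj by (auto simp: inj_on_def)
    moreover have "?key ` {1..<m} = key ` {1..<m}" by auto
    ultimately show ?thesis using new by (simp add: inj_on_insert)
  qed
  moreover have "k \<in> ?key ` {1..<Suc m}" if "step_key c k \<in> ?key ` {1..<Suc m}" for c k
  proof -
    from that have "step_key c k = step_key b (key x) \<or> step_key c k \<in> key ` {1..<m}"
      unfolding img by blast
    then have "k = key x \<or> k \<in> key ` {1..<m}" using closed[of c k] by (auto simp only: step_key_eq)
    then show ?thesis using x unfolding img by blast
  qed
  moreover have "?N c y \<in> {1..<Suc m} \<and> ?key (?N c y) = step_key c (?key y)"
    if y: "y \<in> {1..<Suc m}" and nz: "?N c y \<noteq> 0" for c y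
  proof (cases "c = b \<and> y = x")
    case True
    then show ?thesis using x m by auto
  next
    case False
    then have e: "?N c y = N c y" by auto
    have "y \<noteq> m" using nz t unfolding e by (auto simp: trie_def)
    with y have y': "y \<in> {1..<m}" by auto
    then have "N c y \<in> {1..<m} \<and> key (N c y) = step_key c (key y)"
      using t nz unfolding e by (simp add: trie_def)
    with y' show ?thesis unfolding e by auto
  qed
  moreover have "step_key c (?key y) \<notin> ?key ` {1..<Suc m}"
    if y: "y \<in> {1..<Suc m}" and z: "?N c y = 0" for c y
  proof (cases "y = m")
    case True
    have "step_key c (step_key b (key x)) \<notin> key ` {1..<m}"
      using closed new by blast
    with True show ?thesis unfolding img by (simp add: step_key_neq)
  next
    case False
    with y have y': "y \<in> {1..<m}" by auto
    have ne: "\<not> (c = b \<and> y = x)"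
    proof
      assume "c = b \<and> y = x"
      then have "?N c y = m" by simp
      with z m show False by simp
    qed
    then have "N c y = 0" using z by (cases "c = b") auto
    then have "step_key c (key y) \<notin> key ` {1..<m}" using t y' by (simp add: trie_def)
    moreover have "step_key c (key y) \<noteq> step_key b (key x)"
      using ne inj y' x by (auto simp: step_key_eq inj_on_def)
    ultimately show ?thesis using False unfolding img by simp
  qed
  moreover have "?N c y = 0" if "y \<ge> Suc m" for c y
    using t x that by (auto simp: trie_def)
  ultimately show ?thesis
    using t m unfolding trie_def by auto
qed

definition trie_state :: "ram_state \<Rightarrow> (nat \<Rightarrow> key) \<Rightarrow> bool" where
  "trie_state s key \<longleftrightarrow> trie (regs s freshR) (\<lambda>b. arrs s (if b then rightA else downA)) key"

text \<open>A label once given is never changed, so what the class table says about old nodes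
  outlives the growth of the trie.\<close>

definition extends :: "nat \<Rightarrow> (nat \<Rightarrow> key) \<Rightarrow> (nat \<Rightarrow> key) \<Rightarrow> bool" where
  "extends m key key' \<longleftrightarrow> (\<forall>x\<in>{1..<m}. key' x = key x)"

abbreviation trie_at :: "ram_state \<Rightarrow> (nat \<Rightarrow> key) \<Rightarrow> ram_state \<Rightarrow> key \<Rightarrow> bool" where
  "trie_at s key s' k \<equiv> \<exists>key'. trie_state s' key' \<and> extends (regs s freshR) key key' \<and>
     regs s freshR \<le> regs s' freshR \<and> regs s' xR \<in> {1..<regs s' freshR} \<and>
     key' (regs s' xR) = k"

abbreviation column_frame :: "ram_state \<Rightarrow> ram_state \<Rightarrow> bool" where
  "column_frame \<equiv> unchanged {cR, pR, qR, xR, freshR, parR, mR, yR, goodR} {rowA, downA, rightA}"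

abbreviation merge_frame :: "ram_state \<Rightarrow> ram_state \<Rightarrow> bool" where
  "merge_frame \<equiv> unchanged
     {heightR, aliveR, tR, xR, pR, qR, cR, goodR, freshR, parR, mR, yR, countR}
     {deadA, classA, typeA, rowA, swapA, downA, rightA, nodeA}"

lemma follow:
  assumes T: "T \<ge> X + 20" and t: "trie_state s key" and x: "regs s xR \<in> {1..<regs s freshR}"
    and a: "a = (if b then rightA else downA)"
  shows "run (follow a) (\<lambda>T' s'. T' \<ge> X \<and> unchanged {xR, freshR} {a} s s' \<and>
     trie_at s key s' (step_key b (key (regs s xR)))) T s"
proof -
  let ?x = "regs s xR" and ?m = "regs s freshR"
  show ?thesis
  proof (cases "arrs s a ?x = 0")
    case True
    let ?s = "s\<lparr>arrs := (arrs s)(a := (arrs s a)(?x := ?m)), regs := (regs s)(freshR := Suc ?m, xR := ?m)\<rparr>"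
    have "trie (Suc ?m) ((\<lambda>b. arrs s (if b then rightA else downA))(b := (arrs s a)(?x := ?m)))
       (key(?m := step_key b (key ?x)))"
      using trie_alloc[of ?m "\<lambda>b. arrs s (if b then rightA else downA)" key ?x b] t x True a
      by (simp add: trie_state_def)
    moreover have "(\<lambda>b. arrs s (if b then rightA else downA))(b := (arrs s a)(?x := ?m)) =
        (\<lambda>b. arrs ?s (if b then rightA else downA))"
      using a by (auto simp: fun_eq_iff)
    ultimately have "trie_state ?s (key(?m := step_key b (key ?x)))"
      by (simp add: trie_state_def)
    moreover have "extends ?m key (key(?m := step_key b (key ?x)))" by (simp add: extends_def)
    moreover have "?m \<ge> 3" using t by (simp add: trie_state_def trie_def)
    ultimately show ?thesis
      unfolding follow_def using T True x
      by (auto simp: unchanged_def intro!: exI[of _ "key(?m := step_key b (key ?x))"])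
  next
    case False
    then have "arrs s a ?x \<in> {1..<?m} \<and> key (arrs s a ?x) = step_key b (key ?x)"
      using t x a unfolding trie_state_def trie_def by auto
    moreover have "trie_state (s\<lparr>regs := (regs s)(xR := arrs s a ?x)\<rparr>) key"
      using t by (simp add: trie_state_def)
    ultimately show ?thesis
      unfolding follow_def using T False by (auto simp: unchanged_def extends_def intro!: exI[of _ key])
  qed
qed

lemma add_loop:
  assumes "T \<ge> X + 10 + 15 * regs s yR"
  shows "run add_loop (\<lambda>T' s'. T' \<ge> X \<and> unchanged {mR, yR} {} s s' \<and>
           regs s' mR = regs s mR + regs s yR) T s"
  unfolding add_loop_def
proof (rule run_While[where I = "\<lambda>T s'. unchanged {mR, yR} {} s s' \<and>
       regs s' mR + regs s' yR = regs s mR + regs s yR \<and> T \<ge> X + 10 + 15 * regs s' yR"], goal_cases)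
  case 1
  then show ?case using assms by (simp add: unchanged_def)
next
  case (2 T s')
  then show ?case by simp
next
  case (3 T s')
  then show ?case by (auto simp: unchanged_def)
next
  case (4 T s')
  then show ?case by (auto simp: unchanged_def)
qed

text \<open>One \<open>False\<close> step per unit of \<open>mR\<close>. The parity of the
  multiplicity is toggled along the way, as the machine cannot divide.\<close>

lemma descend:
  assumes T: "T \<ge> X + 10 + 50 * regs s mR" and t: "trie_state s key"
    and x: "regs s xR \<in> {1..<regs s freshR}" "key (regs s xR) = (a, ks, 0)" and par: "regs s parR = 0"
  shows "run descend (\<lambda>T' s'. T' \<ge> X \<and> unchanged {xR, freshR, parR, mR} {downA} s s' \<and>
     trie_at s key s' (a, ks, regs s mR) \<and>
     regs s' parR = of_bool (odd (regs s mR))) T s"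
  unfolding descend_def
proof (rule run_While[where I = "\<lambda>T s'. T \<ge> X + 10 + 50 * regs s' mR \<and>
     unchanged {xR, freshR, parR, mR} {downA} s s' \<and> regs s' mR \<le> regs s mR \<and>
     trie_at s key s' (a, ks, regs s mR - regs s' mR) \<and>
     regs s' parR = of_bool (odd (regs s mR - regs s' mR))"], goal_cases)
  case 1
  then show ?case using assms by (auto simp: unchanged_def extends_def intro!: exI[of _ key])
next
  case (2 T s')
  then show ?case by simp
next
  case (4 T s')
  then show ?case by auto
next
  case (3 T s')
  then have m: "regs s' mR > 0" by simp
  from 3 obtain key' where key': "trie_state s' key'" "extends (regs s freshR) key key'"
    "regs s freshR \<le> regs s' freshR" "regs s' xR \<in> {1..<regs s' freshR}"
    "key' (regs s' xR) = (a, ks, regs s mR - regs s' mR)" by blast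
  have odd: "odd (regs s mR - (regs s' mR - 1)) \<longleftrightarrow> even (regs s mR - regs s' mR)"
    "regs s mR - (regs s' mR - 1) = Suc (regs s mR - regs s' mR)"
    using m 3 by auto
  have T: "T \<ge> X + 10 + 50 * (regs s' mR - 1) + 50" using 3 m by (cases "regs s' mR") auto
  show ?case unfolding block.simps run_Seq
  proof (rule run_mono[OF follow[where X = "T - 24" and b = False and key = key']], goal_cases)
    case (5 T'' s'')
    then obtain key'' where k: "trie_state s'' key''" "extends (regs s' freshR) key' key''"
        "regs s' freshR \<le> regs s'' freshR" "regs s'' xR \<in> {1..<regs s'' freshR}"
        "key'' (regs s'' xR) = (a, ks, Suc (regs s mR - regs s' mR))"
      using key'(5) by auto
    have e: "extends (regs s freshR) key key''"
      using k(2) key'(2,3) by (auto simp: extends_def)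
    define od where "od = odd (regs s mR - regs s' mR)"
    have s'': "T \<le> T'' + 24" "regs s'' mR = regs s' mR" "regs s'' parR = of_bool od"
      "unchanged {xR, freshR, parR, mR} {downA} s s''"
      using 5 3 by (auto simp: unchanged_def od_def)
    let ?s = "s''\<lparr>regs := (regs s'')(parR := of_bool (\<not> od), mR := regs s' mR - 1)\<rparr>"
    have "trie_state ?s key''" using k(1) by (simp add: trie_state_def)
    then have ex: "trie_at s key ?s (a, ks, regs s mR - regs ?s mR)"
      using k e key'(3) odd(2) by (intro exI[of _ key'']) simp
    have u: "unchanged {xR, freshR, parR, mR} {downA} s ?s"
      using s''(4) by (simp add: unchanged_def)
    have p: "of_bool (\<not> od) = (of_bool (odd (regs s mR - regs ?s mR)) :: nat)"
      using odd(1) by (simp add: od_def)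
    have step: "run (Cond (Eq (Reg parR) (Const 0)) (Assign parR (Const 1)) (Assign parR (Const 0)))
        (run (Assign mR (Dec (Reg mR))) Q) T'' s''"
      if "\<And>T6. T6 + 40 \<ge> T \<Longrightarrow> Q T6 ?s" for Q
      using that[of "T'' - 9"] s''(1-3) T
      by (cases od) (simp_all add: Nat.le_diff_conv2 del: One_nat_def)
    have "regs s' mR \<le> regs s mR" using 3 by blast
    then have le: "regs s' mR - 1 \<le> regs s mR" by simp
    show ?case
    proof (rule step, intro conjI)
      fix T6 assume "T \<le> T6 + 40"
      then show "X + 10 + 50 * regs ?s mR \<le> T6" using T by simp
    next
      show "regs ?s parR = of_bool (odd (regs s mR - regs ?s mR))" using p by simp
    qed (use ex u le in simp_all)
  qed (use T key' in auto)
qed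

lemma fetch:
  assumes "T \<ge> 15"
    and "\<And>T'. T' + 15 \<ge> T \<Longrightarrow> Q T' (s\<lparr>regs := (regs s)(r :=
      if arrs s typeA (regs s x) = regs s tR then arrs s rowA (regs s p)
      else of_bool (regs s cR = arrs s classA (regs s x)))\<rparr>)"
  shows "run (fetch x p r) Q T s"
proof (cases "arrs s typeA (regs s x) = regs s tR")
  case True
  then show ?thesis unfolding fetch_def using assms(1) assms(2)[of "T - 8"]
    by (simp add: Nat.le_diff_conv2 del: One_nat_def)
next
  case False
  then show ?thesis unfolding fetch_def using assms(1) assms(2)[of "T - 12"]
    by (cases "regs s cR = arrs s classA (regs s x)") (simp_all add: Nat.le_diff_conv2 del: One_nat_def)
qed

lemma mark_odd:
  assumes "T \<ge> 15" and "\<And>T'. T' + 15 \<ge> T \<Longrightarrow> Q T' (s\<lparr>regs := (regs s)(goodR :=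
      if arrs s swapA (regs s cR) = 0 \<and> regs s parR = 1 then 0 else regs s goodR)\<rparr>)"
  shows "run mark_odd Q T s"
proof (cases "arrs s swapA (regs s cR) = 0 \<and> regs s parR = 1")
  case True
  then show ?thesis unfolding mark_odd_def using assms(1) assms(2)[of "T - 11"]
    by (simp add: Nat.le_diff_conv2 del: One_nat_def)
next
  case False
  have "Q (T - 10) s" using assms(1) assms(2)[of "T - 10", unfolded if_not_P[OF False]] by simp
  with False assms(1) show ?thesis unfolding mark_odd_def
    by (cases "arrs s swapA (regs s cR) = 0") (simp_all add: Nat.le_diff_conv2 del: One_nat_def)
qed

lemma column:
  assumes T: "T \<ge> X + 150 + 50 * k + 15 * y" and t: "trie_state s key"
    and x: "regs s xR \<in> {1..<regs s freshR}" "key (regs s xR) = (a, ks, 0)"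
    and m: "m = (if arrs s typeA (regs s vR) = regs s tR then arrs s rowA (regs s pR)
                 else of_bool (regs s cR = arrs s classA (regs s vR)))"
    and y: "y = (if arrs s typeA (regs s uR) = regs s tR then arrs s rowA (regs s qR)
                 else of_bool (regs s cR = arrs s classA (regs s uR)))"
    and k: "k = m + y"
  shows "run column (\<lambda>T' s'. T' \<ge> X \<and>
     column_frame s s' \<and>
     regs s' cR = Suc (regs s cR) \<and> regs s' pR = Suc (regs s pR) \<and> regs s' qR = Suc (regs s qR) \<and>
     arrs s' rowA = (arrs s rowA)(regs s pR := k) \<and>
     regs s' goodR = (if arrs s swapA (regs s cR) = 0 \<and> odd k then 0 else regs s goodR) \<and>
     trie_at s key s' (a, ks @ [k], 0)) T s" (is "run _ ?Q _ _")
proof -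
  let ?s1 = "s\<lparr>regs := (regs s)(mR := m, yR := y)\<rparr>"
  define R1 where "R1 = run add_loop (run (Write rowA (Reg pR) (Reg mR)) (run (Assign parR (Const 0))
     (run descend (run mark_odd (run (follow rightA) (run (Assign cR (Inc (Reg cR)))
       (run (Assign pR (Inc (Reg pR))) (run (Assign qR (Inc (Reg qR))) ?Q))))))))"
  have R1: "R1 T1 ?s1" if T1: "T1 + 30 \<ge> T" for T1
    unfolding R1_def
  proof (rule run_mono[OF add_loop[where X = "X + 110 + 50 * k"]], goal_cases)
    case 1
    then show ?case using T T1 by simp
  next
    case (2 T2 s2)
    let ?s2 = "s2\<lparr>arrs := (arrs s2)(rowA := (arrs s2 rowA)(regs s2 pR := k)), regs := (regs s2)(parR := 0)\<rparr>"
    have s2: "regs s2 mR = k" "\<And>r. r \<noteq> mR \<Longrightarrow> r \<noteq> yR \<Longrightarrow> regs s2 r = regs s r" "arrs s2 = arrs s"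
      using 2 k by (auto simp: unchanged_def)
    have t2: "trie_state ?s2 key" using t s2 by (simp add: trie_state_def if_distrib cong: if_cong)
    define R2 where "R2 = run mark_odd (run (follow rightA) (run (Assign cR (Inc (Reg cR)))
       (run (Assign pR (Inc (Reg pR))) (run (Assign qR (Inc (Reg qR))) ?Q))))"
    have "run descend R2 (T2 - 5) ?s2"
    proof (rule run_mono[OF descend[where X = "X + 90" and key = key and a = a and ks = ks]], goal_cases)
      case 1
      have "T2 \<ge> X + 110 + 50 * k" using 2 by simp
      then show ?case using s2(1) by simp
    next
      case (6 T3 s3)
      then obtain key3 where k3: "trie_state s3 key3" "extends (regs s freshR) key key3"
          "regs s freshR \<le> regs s3 freshR" "regs s3 xR \<in> {1..<regs s3 freshR}"
          "key3 (regs s3 xR) = (a, ks, k)" using s2 by auto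
      have s3: "T3 \<ge> X + 90" "regs s3 parR = of_bool (odd k)"
        "\<And>r. r \<notin> {xR, freshR, parR, mR, yR} \<Longrightarrow> regs s3 r = regs s r"
        "\<And>a. a \<notin> {rowA, downA} \<Longrightarrow> arrs s3 a = arrs s a"
        "arrs s3 rowA = (arrs s rowA)(regs s pR := k)"
        using 6 s2 by (auto simp: unchanged_def)
      show ?case unfolding R2_def
      proof (rule mark_odd, goal_cases)
        case 1
        then show ?case using s3 by simp
      next
        case (2 T4)
        let ?good = "if arrs s swapA (regs s cR) = 0 \<and> odd k then 0 else regs s goodR"
        have good: "(if arrs s3 swapA (regs s3 cR) = 0 \<and> regs s3 parR = 1 then 0 else regs s3 goodR) = ?good"
          using s3 by simp
        show ?case unfolding good
        proof (rule run_mono[OF follow[where X = "X + 30" and key = key3 and b = True]], goal_cases)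
          case 1
          then show ?case using 2 s3 by simp
        next
          case 2
          then show ?case using k3(1) by (simp add: trie_state_def)
        next
          case 3
          then show ?case using k3(4) by simp
        next
          case (5 T5 s5)
          then obtain key5 where k5: "trie_state s5 key5" "extends (regs s3 freshR) key3 key5"
            "regs s3 freshR \<le> regs s5 freshR" "regs s5 xR \<in> {1..<regs s5 freshR}"
            "key5 (regs s5 xR) = (a, ks @ [k], 0)" using k3(5) by auto
          have e: "extends (regs s freshR) key key5"
            using k3(2,3) k5(2) by (auto simp: extends_def)
          have s5: "T5 \<ge> X + 30" "\<And>r. r \<notin> {xR, freshR, parR, mR, yR, goodR} \<Longrightarrow> regs s5 r = regs s r"
            "regs s5 goodR = ?good"
            "\<And>a. a \<notin> {rowA, downA, rightA} \<Longrightarrow> arrs s5 a = arrs s a"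
            "arrs s5 rowA = (arrs s rowA)(regs s pR := k)"
            using 5 s3 by (auto simp: unchanged_def)
          let ?s6 = "s5\<lparr>regs := (regs s5)(cR := regs s cR + 1, pR := regs s pR + 1, qR := regs s qR + 1)\<rparr>"
          have "trie_state ?s6 key5"
            using k5(1) by (simp add: trie_state_def)
          moreover have "regs s freshR \<le> regs s5 freshR" using k3(3) k5(3) by simp
          ultimately have "trie_at s key ?s6 (a, ks @ [k], 0)"
            using e k5 by (intro exI[of _ key5]) simp
          moreover have "column_frame s ?s6"
            using s5 by (simp add: unchanged_def)
          ultimately have Q: "?Q T6 ?s6" if "T6 \<ge> X" for T6
            using that s5 by simp
          have step: "run (Assign cR (Inc (Reg cR))) (run (Assign pR (Inc (Reg pR)))
             (run (Assign qR (Inc (Reg qR))) Q)) T5 s5" if "\<And>T6. T6 \<ge> X \<Longrightarrow> Q T6 ?s6" for Q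
            using that s5(1) s5(2)[of cR] s5(2)[of pR] s5(2)[of qR]
            by (simp add: Nat.le_diff_conv2 del: One_nat_def)
          show ?case by (rule step, rule Q)
        qed simp
      qed
    qed (use t2 x s2 in simp_all)
    then have D: "run descend R2 (T2 - 5) ?s2" .
    have "run (Write rowA (Reg pR) (Reg mR)) (run (Assign parR (Const 0)) R) T2 s2"
      if "R (T2 - 5) ?s2" for R
      using that 2 s2 by (simp add: Nat.le_diff_conv2 del: One_nat_def)
    from this[of "run descend R2", OF D] show ?case unfolding R2_def .
  qed
  let ?sm = "s\<lparr>regs := (regs s)(mR := m)\<rparr>"
  have yv: "(if arrs ?sm typeA (regs ?sm uR) = regs ?sm tR then arrs ?sm rowA (regs ?sm qR)
      else of_bool (regs ?sm cR = arrs ?sm classA (regs ?sm uR))) = y" using y by simp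
  have "run (fetch vR pR mR) (run (fetch uR qR yR) R1) T s"
  proof (rule fetch, goal_cases)
    case 1
    then show ?case using T by simp
  next
    case (2 T')
    show ?case unfolding m[symmetric]
    proof (rule fetch, goal_cases)
      case 1
      then show ?case using T 2 by simp
    next
      case (2 T'')
      have "T'' + 30 \<ge> T" using 2 \<open>T \<le> T' + 15\<close> by simp
      from R1[OF this] show ?case unfolding yv by simp
    qed
  qed
  then show ?thesis unfolding column_def block.simps run_Seq R1_def .
qed

section \<open>Merging twins\<close>

definition class_counts :: "nat \<Rightarrow> (nat \<Rightarrow> cotree) \<Rightarrow> cotree multiset \<Rightarrow> nat \<Rightarrow> nat" where
  "class_counts K tree_of M c = (if c < K then count M (tree_of c) else 0)"

definition class_key :: "nat \<Rightarrow> nat \<Rightarrow> (nat \<Rightarrow> cotree) \<Rightarrow> bool \<Rightarrow> cotree multiset \<Rightarrow> key" where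
  "class_key n K tree_of a M = (a, map (class_counts K tree_of M) [0..<n], 0)"

fun type_code :: "cotree \<Rightarrow> nat" where
  "type_code Leaf = 0"
| "type_code (Node a M) = Suc (of_bool a)"

text \<open>\<open>K\<close>, \<open>F\<close>, \<open>C\<close> and \<open>m\<close> stand for
  \<open>countR\<close>, \<open>swapA\<close>, \<open>nodeA\<close> and \<open>freshR\<close>. The
  payload \<open>C\<close> inverts the map from classes to trie nodes: a nonzero payload names a
  class that is spelt by the key of its node, and every class except the leaf sits at some
  node.\<close>

definition class_table :: "nat \<Rightarrow> nat \<Rightarrow> (nat \<Rightarrow> nat) \<Rightarrow> (nat \<Rightarrow> nat) \<Rightarrow> nat \<Rightarrow>
    (nat \<Rightarrow> cotree) \<Rightarrow> (nat \<Rightarrow> key) \<Rightarrow> bool" where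
  "class_table n K F C m tree_of key \<longleftrightarrow>
     1 \<le> K \<and> tree_of 0 = Leaf \<and> inj_on tree_of {..<K} \<and>
     (\<forall>c<K. F c = of_bool (swappable (tree_of c))) \<and>
     (\<forall>x. C x \<noteq> 0 \<longrightarrow> x \<in> {1..<m} \<and> C x < K \<and>
        (\<exists>a M. tree_of (C x) = Node a M \<and> set_mset M \<subseteq> tree_of ` {..<K} \<and> key x = class_key n K tree_of a M)) \<and>
     (\<forall>c<K. 0 < c \<longrightarrow> (\<exists>x. C x = c))"

definition labelled :: "nat \<Rightarrow> nat \<Rightarrow> (nat \<Rightarrow> cotree) \<Rightarrow> nat \<Rightarrow> nat \<Rightarrow> (nat \<Rightarrow> nat) \<Rightarrow> cotree \<Rightarrow> bool" where
  "labelled n K tree_of cls ty cnt t \<longleftrightarrow> cls < K \<and> tree_of cls = t \<and> ty = type_code t \<and>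
     (\<forall>a M. t = Node a M \<longrightarrow> set_mset M \<subseteq> tree_of ` {..<K} \<and> (\<forall>c<n. cnt c = class_counts K tree_of M c))"

lemma image_extend:
  fixes K :: nat
  shows "f ` {..<K} \<subseteq> (f(K := t)) ` {..<Suc K}"
proof
  fix y assume "y \<in> f ` {..<K}"
  then obtain c where "c < K" "y = f c" by auto
  then show "y \<in> (f(K := t)) ` {..<Suc K}" by (intro image_eqI[of _ _ c]) auto
qed

text \<open>
  The counts are padded with 0, so that the keys already in the trie stay correct when a new
  class is created.
\<close>

lemma class_counts_extend:
  assumes "set_mset M \<subseteq> tree_of ` {..<K}" "t \<notin> tree_of ` {..<K}"
  shows "class_counts (Suc K) (tree_of(K := t)) M = class_counts K tree_of M"
proof
  fix c
  have "count M t = 0" using assms by (auto simp: count_eq_zero_iff)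
  then show "class_counts (Suc K) (tree_of(K := t)) M c = class_counts K tree_of M c"
    by (auto simp: class_counts_def less_Suc_eq)
qed

text \<open>Since \<open>K \<le> n\<close>, the \<open>n\<close> columns cover every class, so no
  part of a multiset of known trees is cut off.\<close>

lemma class_counts_inj:
  assumes "set_mset M \<subseteq> tree_of ` {..<K}" "set_mset N \<subseteq> tree_of ` {..<K}" "K \<le> n"
    and "map (class_counts K tree_of M) [0..<n] = map (class_counts K tree_of N) [0..<n]"
  shows "M = N"
proof (rule multiset_eqI)
  fix t
  show "count M t = count N t"
  proof (cases "t \<in> tree_of ` {..<K}")
    case True
    then obtain c where c: "c < K" "t = tree_of c" by auto
    then have "class_counts K tree_of M c = class_counts K tree_of N c" using assms(3,4) by simp
    then show ?thesis using c by (simp add: class_counts_def)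
  next
    case False
    then have "t \<notin># M" "t \<notin># N" using assms(1,2) by auto
    then show ?thesis by (simp add: not_in_iff)
  qed
qed

text \<open>The left side is the total length of the unary words spelt in a merge. Different columns
  count different trees, hence the bound.\<close>

lemma sum_class_counts_le:
  assumes "inj_on tree_of {..<K}"
  shows "(\<Sum>c<n. class_counts K tree_of M c) \<le> size M"
proof -
  have "(\<Sum>c<n. class_counts K tree_of M c) = (\<Sum>c\<in>{..<n} \<inter> {..<K}. count M (tree_of c))"
    unfolding class_counts_def by (simp add: sum.If_cases lessThan_def Int_def)
  also have "\<dots> = (\<Sum>t\<in>tree_of ` ({..<n} \<inter> {..<K}). count M t)"
    using assms by (subst sum.reindex) (auto intro: inj_on_subset)
  also have "\<dots> = (\<Sum>t\<in>tree_of ` ({..<n} \<inter> {..<K}) \<inter> set_mset M. count M t)"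
    by (rule sum.mono_neutral_right) (auto simp: count_eq_zero_iff)
  also have "\<dots> \<le> (\<Sum>t\<in>set_mset M. count M t)"
    by (rule sum_mono2) auto
  finally show ?thesis by (simp add: size_multiset_overloaded_eq)
qed

lemma kids_subset:
  assumes "labelled n K tree_of cls ty cnt t"
  shows "set_mset (kids a t) \<subseteq> tree_of ` {..<K}"
proof -
  have "t \<in> tree_of ` {..<K}" using assms by (auto simp: labelled_def)
  then show ?thesis using assms by (cases t) (auto simp: labelled_def)
qed

text \<open>Links \<open>fetch\<close> to \<open>kids\<close>. If the root has type
  \<open>a\<close>, the row holds the multiplicities; otherwise \<open>kids\<close> is a singleton,
  and injectivity of the numbering singles out the column of the tree's own class.\<close>

lemma fetch_value:
  assumes "labelled n K tree_of cls ty cnt t" "inj_on tree_of {..<K}" "c < n"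
  shows "(if ty = Suc (of_bool a) then cnt c else of_bool (c = cls)) = class_counts K tree_of (kids a t) c"
proof (cases "rooted a t")
  case True
  then obtain M where "t = Node a M" by (cases t) auto
  then show ?thesis using assms by (auto simp: labelled_def)
next
  case False
  then have "ty \<noteq> Suc (of_bool a)" "kids a t = {#t#}"
    using assms(1) by (cases t; auto simp: labelled_def split: if_splits)+
  moreover have "(if c < K then count {#t#} (tree_of c) else 0) = of_bool (c = cls)"
    using assms(1,2) by (auto simp: labelled_def inj_on_def)
  ultimately show ?thesis by (simp add: class_counts_def)
qed

lemma class_counts_add: "class_counts K tree_of (M + N) c = class_counts K tree_of M c + class_counts K tree_of N c"
  by (simp add: class_counts_def)

lemma swappable_class_counts:
  assumes "set_mset M \<subseteq> tree_of ` {..<K}" "K \<le> n" "\<And>c. c < K \<Longrightarrow> F c = (of_bool (swappable (tree_of c)) :: nat)"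
  shows "swappable (Node a M) \<longleftrightarrow> (\<forall>c<n. F c \<noteq> 0 \<or> even (class_counts K tree_of M c))"
proof
  assume s: "swappable (Node a M)"
  show "\<forall>c<n. F c \<noteq> 0 \<or> even (class_counts K tree_of M c)"
  proof (intro allI impI)
    fix c assume "c < n"
    show "F c \<noteq> 0 \<or> even (class_counts K tree_of M c)"
    proof (cases "c < K")
      case True
      then show ?thesis using s assms(3)[OF True] by (auto simp: swappable_Node class_counts_def)
    qed (simp add: class_counts_def)
  qed
next
  assume s: "\<forall>c<n. F c \<noteq> 0 \<or> even (class_counts K tree_of M c)"
  show "swappable (Node a M)" unfolding swappable_Node
  proof
    fix t
    show "swappable t \<or> even (count M t)"
    proof (cases "t \<in> tree_of ` {..<K}")
      case True
      then obtain c where c: "c < K" "t = tree_of c" by auto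
      then have "F c \<noteq> 0 \<or> even (class_counts K tree_of M c)" using s assms(2) by simp
      then show ?thesis using c assms(3)[of c] by (auto simp: class_counts_def split: if_splits)
    next
      case False
      then have "t \<notin># M" using assms(1) by auto
      then have "count M t = 0" by (simp add: not_in_iff)
      then show ?thesis by simp
    qed
  qed
qed

lemma class_table_extends:
  assumes "class_table n K F C m tree_of key" "extends m key key'" "m \<le> m'"
  shows "class_table n K F C m' tree_of key'"
proof -
  have "x \<in> {1..<m'} \<and> key' x = key x" if "x \<in> {1..<m}" for x
    using that assms(2,3) by (auto simp: extends_def)
  with assms(1) show ?thesis unfolding class_table_def by metis
qed

text \<open>The key reveals type and counts, and the counts determine the multiset, so the class
  found at the node is that of the tree just spelt.\<close>

lemma class_table_found:
  assumes ct: "class_table n K F C m tree_of key" and "K \<le> n" and M: "set_mset M \<subseteq> tree_of ` {..<K}"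
    and x: "key x = class_key n K tree_of a M" "C x \<noteq> 0"
  shows "tree_of (C x) = Node a M" "C x < K"
proof -
  from ct x obtain b N where N: "C x < K" "tree_of (C x) = Node b N" "set_mset N \<subseteq> tree_of ` {..<K}"
    "key x = class_key n K tree_of b N" unfolding class_table_def by blast
  with x have "b = a" "map (class_counts K tree_of N) [0..<n] = map (class_counts K tree_of M) [0..<n]"
    by (auto simp: class_key_def)
  with class_counts_inj[OF N(3) M assms(2)] N show "tree_of (C x) = Node a M" "C x < K" by auto
qed

text \<open>If the tree had a class, that class would sit at a node with the same key, which is
  \<open>x\<close> by injectivity; but the payload of \<open>x\<close> is 0. Old keys keep their
  meaning because the new tree occurs in none of the old multisets.\<close>

lemma class_table_new:
  assumes ct: "class_table n K F C m tree_of key" and Kn: "K < n" and M: "set_mset M \<subseteq> tree_of ` {..<K}"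
    and x: "key x = class_key n K tree_of a M" "C x = 0" "x \<in> {1..<m}" and inj: "inj_on key {1..<m}"
    and g: "g = of_bool (swappable (Node a M))"
  shows "Node a M \<notin> tree_of ` {..<K}"
    and "class_table n (Suc K) (F(K := g)) (C(x := K)) m (tree_of(K := Node a M)) key"
proof -
  have K: "1 \<le> K" "tree_of 0 = Leaf" "inj_on tree_of {..<K}" using ct by (auto simp: class_table_def)
  show new: "Node a M \<notin> tree_of ` {..<K}"
  proof
    assume "Node a M \<in> tree_of ` {..<K}"
    then obtain c where c: "c < K" "tree_of c = Node a M" by auto
    then have "0 < c" using K(2) by (cases c) auto
    with ct c obtain y where y: "C y = c" unfolding class_table_def by blast
    with \<open>0 < c\<close> ct obtain b N where N: "y \<in> {1..<m}" "tree_of (C y) = Node b N" "key y = class_key n K tree_of b N"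
      unfolding class_table_def by (metis less_numeral_extra(3))
    then have "key y = key x" using c y x by simp
    then have "y = x" using inj N(1) x(3) by (auto simp: inj_on_def)
    then show False using x y \<open>0 < c\<close> by simp
  qed
  let ?tree_of = "tree_of(K := Node a M)"
  note sub = image_extend[of tree_of K "Node a M"]
  have code: "class_key n (Suc K) ?tree_of b N = class_key n K tree_of b N" if "set_mset N \<subseteq> tree_of ` {..<K}" for b N
    unfolding class_key_def by (simp only: class_counts_extend[OF that new])
  show "class_table n (Suc K) (F(K := g)) (C(x := K)) m ?tree_of key"
    unfolding class_table_def
  proof (intro conjI allI impI)
    show "inj_on ?tree_of {..<Suc K}"
    proof -
      have "?tree_of ` {..<K} = tree_of ` {..<K}" by auto
      moreover have "inj_on ?tree_of {..<K}" using K(3) by (auto simp: inj_on_def)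
      ultimately show ?thesis using new by (simp add: lessThan_Suc)
    qed
    show "?tree_of 0 = Leaf" using K by simp
    fix c assume c: "c < Suc K"
    show "(F(K := g)) c = of_bool (swappable (?tree_of c))"
      using ct c g by (auto simp: class_table_def less_Suc_eq)
    assume "0 < c"
    show "\<exists>y. (C(x := K)) y = c"
    proof (cases "c = K")
      case False
      with ct c \<open>0 < c\<close> obtain y where "C y = c" unfolding class_table_def by (metis less_SucE)
      with x(2) \<open>0 < c\<close> have "(C(x := K)) y = c" by auto
      then show ?thesis ..
    qed auto
  next
    fix y assume y: "(C(x := K)) y \<noteq> 0"
    show "y \<in> {1..<m}" using y x ct unfolding class_table_def by (cases "y = x") auto
    show "(C(x := K)) y < Suc K" using y ct unfolding class_table_def by (cases "y = x") (auto simp: less_SucI)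
    show "\<exists>b N. ?tree_of ((C(x := K)) y) = Node b N \<and> set_mset N \<subseteq> ?tree_of ` {..<Suc K} \<and>
        key y = class_key n (Suc K) ?tree_of b N"
    proof (cases "y = x")
      case True
      then show ?thesis using M sub x(1) code[OF M]
        by (intro exI[of _ a] exI[of _ M]) auto
    next
      case False
      then have "C y \<noteq> 0" using y by simp
      with ct obtain b N where N: "C y < K" "tree_of (C y) = Node b N" "set_mset N \<subseteq> tree_of ` {..<K}"
        "key y = class_key n K tree_of b N" unfolding class_table_def by blast
      then show ?thesis using False sub code[OF N(3)]
        by (intro exI[of _ b] exI[of _ N]) auto
    qed
  qed simp
qed

lemma labelled_extend:
  assumes l: "labelled n K tree_of cls ty cnt t" and new: "t' \<notin> tree_of ` {..<K}"
  shows "labelled n (Suc K) (tree_of(K := t')) cls ty cnt t"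
  unfolding labelled_def
proof (intro conjI allI impI)
  show "cls < Suc K" "(tree_of(K := t')) cls = t" "ty = type_code t"
    using l by (auto simp: labelled_def)
  fix a M assume "t = Node a M"
  with l have M: "set_mset M \<subseteq> tree_of ` {..<K}" "\<forall>c<n. cnt c = class_counts K tree_of M c"
    by (auto simp: labelled_def)
  show "set_mset M \<subseteq> (tree_of(K := t')) ` {..<Suc K}" by (rule subset_trans[OF M(1) image_extend])
  fix c assume "c < n"
  then show "cnt c = class_counts (Suc K) (tree_of(K := t')) M c" using M class_counts_extend[OF M(1) new] by simp
qed

text \<open>Rows start \<open>n\<close> cells apart. Hence rewriting the first \<open>d\<close>
  columns of the row of \<open>v\<close> leaves the other rows intact.\<close>

lemma row_disjoint:
  fixes u v n c d :: nat
  assumes "u \<noteq> v" "c < n" "d \<le> n"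
  shows "\<not> (v * n \<le> u * n + c \<and> u * n + c < v * n + d)"
proof (cases "u < v")
  case True
  then have "Suc u * n \<le> v * n" by (intro mult_le_mono1) simp
  then show ?thesis using assms(2) by simp
next
  case False
  with assms(1) have "Suc v * n \<le> u * n" by (intro mult_le_mono1) simp
  then show ?thesis using assms(3) by simp
qed

abbreviation table_of :: "nat \<Rightarrow> ram_state \<Rightarrow> (nat \<Rightarrow> cotree) \<Rightarrow> (nat \<Rightarrow> key) \<Rightarrow> bool" where
  "table_of n s tree_of key \<equiv>
     class_table n (regs s countR) (arrs s swapA) (arrs s nodeA) (regs s freshR) tree_of key"

abbreviation label_of :: "nat \<Rightarrow> ram_state \<Rightarrow> (nat \<Rightarrow> cotree) \<Rightarrow> nat \<Rightarrow> cotree \<Rightarrow> bool" where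
  "label_of n s tree_of v t \<equiv> labelled n (regs s countR) tree_of (arrs s classA v) (arrs s typeA v)
     (\<lambda>c. arrs s rowA (v * n + c)) t"

abbreviation relabelled ::
    "nat \<Rightarrow> ram_state \<Rightarrow> (nat \<Rightarrow> cotree) \<Rightarrow> ram_state \<Rightarrow> nat \<Rightarrow> cotree \<Rightarrow> bool" where
  "relabelled n s tree_of s' v t \<equiv> \<exists>tree_of' key'.
     table_of n s' tree_of' key' \<and> trie_state s' key' \<and> label_of n s' tree_of' v t \<and>
     (\<forall>w t. w < n \<longrightarrow> w \<noteq> v \<longrightarrow> label_of n s tree_of w t \<longrightarrow> label_of n s' tree_of' w t)"

lemma columns:
  assumes T: "T \<ge> X + 300 * n + 50" and n: "regs s nR = n"
    and v: "regs s vR = v" "v < n" and u: "regs s uR = u" "u < n" "u \<noteq> v"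
    and ptr: "regs s pR = v * n" "regs s qR = u * n" "regs s cR = 0" "regs s goodR = 1"
    and code: "regs s tR = Suc (of_bool a)" "regs s xR \<in> {1..<regs s freshR}" "key (regs s xR) = (a, [], 0)"
    and trie: "trie_state s key" and inj: "inj_on tree_of {..<K}"
    and lv: "labelled n K tree_of (arrs s classA v) (arrs s typeA v) (\<lambda>c. arrs s rowA (v * n + c)) tv"
    and lu: "labelled n K tree_of (arrs s classA u) (arrs s typeA u) (\<lambda>c. arrs s rowA (u * n + c)) tu"
    and M: "M = kids a tv + kids a tu" "size M \<le> n"
  shows "run (While (Lt (Reg cR) (Reg nR)) column) (\<lambda>T' s'. T' \<ge> X \<and>
     column_frame s s' \<and>
     arrs s' rowA = (\<lambda>i. if v * n \<le> i \<and> i < v * n + n then class_counts K tree_of M (i - v * n) else arrs s rowA i) \<and>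
     regs s' goodR = of_bool (\<forall>c<n. arrs s swapA c \<noteq> 0 \<or> even (class_counts K tree_of M c)) \<and>
     trie_at s key s' (class_key n K tree_of a M)) T s"
proof -
  let ?counts = "class_counts K tree_of M"
  let ?rest = "\<lambda>c. \<Sum>i\<in>{c..<n}. ?counts i"
  have sum: "?rest 0 \<le> n" using sum_class_counts_le[OF inj, where n = n and M = M] M(2) by (simp add: lessThan_atLeast0)
  \<comment> \<open>Each column still to come holds 160 credits and each occurrence still to be
    spelt 65: 50 for the trie and up to 15 for adding the two multiplicities. The occurrences number
    at most \<open>n\<close>, so the sum is linear.\<close>
  let ?I = "\<lambda>T s'. column_frame s s' \<and>
     regs s' cR \<le> n \<and> regs s' pR = v * n + regs s' cR \<and> regs s' qR = u * n + regs s' cR \<and>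
     arrs s' rowA = (\<lambda>i. if v * n \<le> i \<and> i < v * n + regs s' cR then ?counts (i - v * n) else arrs s rowA i) \<and>
     regs s' goodR = of_bool (\<forall>c<regs s' cR. arrs s swapA c \<noteq> 0 \<or> even (?counts c)) \<and>
     trie_at s key s' (a, map ?counts [0..<regs s' cR], 0) \<and>
     T \<ge> X + 10 + (n - regs s' cR) * 160 + 65 * ?rest (regs s' cR)"
  show ?thesis
  proof (rule run_While[where I = ?I], goal_cases)
    case 1
    have "trie_at s key s (a, map ?counts [0..<regs s cR], 0)"
      using trie code ptr by (intro exI[of _ key]) (simp add: extends_def)
    moreover have "T \<ge> X + 10 + (n - regs s cR) * 160 + 65 * ?rest (regs s cR)"
      using T sum ptr by simp
    moreover have "arrs s rowA = (\<lambda>i. if v * n \<le> i \<and> i < v * n + regs s cR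
        then ?counts (i - v * n) else arrs s rowA i)" using ptr by (auto simp: fun_eq_iff)
    ultimately show ?case using ptr by (simp add: unchanged_def)
  next
    case (2 T s')
    then show ?case by simp
  next
    case (4 T s')
    then have c: "regs s' cR = n" using n by (simp add: unchanged_def)
    have X: "X + 10 \<le> T" using 4 unfolding c by simp
    show ?case using 4 X unfolding c by (simp add: class_key_def Nat.le_diff_conv2 del: One_nat_def)
  next
    case (3 T s')
    define c where "c = regs s' cR"
    have fr: "\<And>r. r \<notin> {cR, pR, qR, xR, freshR, parR, mR, yR, goodR} \<Longrightarrow> regs s' r = regs s r"
      "\<And>a. a \<notin> {rowA, downA, rightA} \<Longrightarrow> arrs s' a = arrs s a"
      using 3 by (auto simp: unchanged_def)
    have c: "c < n" using 3 n fr(1)[of nR] by (simp add: c_def)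
    have ptr': "regs s' pR = v * n + c" "regs s' qR = u * n + c" using 3 by (auto simp: c_def)
    have cnt: "arrs s' rowA = (\<lambda>i. if v * n \<le> i \<and> i < v * n + c then ?counts (i - v * n) else arrs s rowA i)"
      using 3 by (auto simp: c_def)
    have good: "regs s' goodR = of_bool (\<forall>i<c. arrs s swapA i \<noteq> 0 \<or> even (?counts i))"
      using 3 by (auto simp: c_def)
    from 3 obtain key' where k: "trie_state s' key'" "extends (regs s freshR) key key'"
        "regs s freshR \<le> regs s' freshR" "regs s' xR \<in> {1..<regs s' freshR}"
        "key' (regs s' xR) = (a, map ?counts [0..<c], 0)" unfolding c_def by blast
    have T: "T \<ge> X + 10 + (n - c) * 160 + 65 * ?rest c" using 3 by (auto simp: c_def)
    have rest: "?rest c = ?counts c + ?rest (Suc c)" using c by (simp add: sum.atLeast_Suc_lessThan)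
    have nc: "n - c = Suc (n - Suc c)" using c by simp
    have T: "T \<ge> X + 170 + (n - Suc c) * 160 + 65 * ?counts c + 65 * ?rest (Suc c)"
      using T unfolding rest nc by (simp add: algebra_simps)
    have val: "arrs s' typeA (regs s' vR) = arrs s typeA v" "arrs s' typeA (regs s' uR) = arrs s typeA u"
      "regs s' tR = Suc (of_bool a)" "regs s' cR = c"
      "arrs s' classA (regs s' vR) = arrs s classA v" "arrs s' classA (regs s' uR) = arrs s classA u"
      "arrs s' rowA (regs s' pR) = arrs s rowA (v * n + c)"
      using fr v u code(1) by (simp_all add: cnt ptr' c_def)
    have "(v * n \<le> u * n + c \<and> u * n + c < v * n + c) = False"
      using row_disjoint[of u v c n c] c u by simp
    then have valq: "arrs s' rowA (regs s' qR) = arrs s rowA (u * n + c)"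
      unfolding cnt ptr' by (simp only: if_False)
    have fv: "(if arrs s' typeA (regs s' vR) = regs s' tR then arrs s' rowA (regs s' pR)
                 else of_bool (regs s' cR = arrs s' classA (regs s' vR))) = class_counts K tree_of (kids a tv) c"
      unfolding val by (rule fetch_value[OF lv inj c])
    have fu: "(if arrs s' typeA (regs s' uR) = regs s' tR then arrs s' rowA (regs s' qR)
                 else of_bool (regs s' cR = arrs s' classA (regs s' uR))) = class_counts K tree_of (kids a tu) c"
      unfolding val valq by (rule fetch_value[OF lu inj c])
    have k_eq: "?counts c = class_counts K tree_of (kids a tv) c + class_counts K tree_of (kids a tu) c"
      unfolding M(1) by (rule class_counts_add)
    show ?case
    proof (rule run_mono[OF column[where X = "X + 10 + (n - Suc c) * 160 + 65 * ?rest (Suc c)",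
          OF _ k(1,4,5) fv[symmetric] fu[symmetric] k_eq]], goal_cases)
      case 1
      have "class_counts K tree_of (kids a tu) c \<le> ?counts c" using k_eq by simp
      then show ?case using T by simp
    next
      case (2 T2 s2)
      then obtain key2 where k2: "trie_state s2 key2" "extends (regs s' freshR) key' key2"
        "regs s' freshR \<le> regs s2 freshR" "regs s2 xR \<in> {1..<regs s2 freshR}"
        "key2 (regs s2 xR) = (a, map ?counts [0..<c] @ [?counts c], 0)" by blast
      have T2: "T2 \<ge> X + 10 + (n - Suc c) * 160 + 65 * ?rest (Suc c)" using 2 by blast
      have un: "column_frame s s2"
        by (rule unchanged_trans) (use 2 3 in blast)+
      have r: "regs s2 cR = Suc c" "regs s2 pR = v * n + Suc c" "regs s2 qR = u * n + Suc c"
        using 2 ptr' by (simp_all add: c_def)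
      have row2: "arrs s2 rowA = (arrs s' rowA)(v * n + c := ?counts c)" using 2 ptr' by simp
      have good2: "regs s2 goodR = (if arrs s' swapA c = 0 \<and> odd (?counts c) then 0 else regs s' goodR)"
        using 2 by (simp add: c_def)
      have "arrs s2 rowA = (\<lambda>i. if v * n \<le> i \<and> i < v * n + Suc c then ?counts (i - v * n) else arrs s rowA i)"
        unfolding row2 cnt by (auto simp: fun_eq_iff less_Suc_eq)
      moreover have "regs s2 goodR = of_bool (\<forall>i<Suc c. arrs s swapA i \<noteq> 0 \<or> even (?counts i))"
        unfolding good2 good using fr(2)[of swapA] by (auto simp: less_Suc_eq)
      moreover have "trie_at s key s2 (a, map ?counts [0..<Suc c], 0)"
        using k2 k(2,3) by (intro exI[of _ key2]) (auto simp: extends_def)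
      ultimately show ?case using T2 un r c by simp
    qed
  qed
qed

lemma trie_state_cong:
  assumes "trie_state s key" "regs s' freshR = regs s freshR"
    "arrs s' downA = arrs s downA" "arrs s' rightA = arrs s rightA"
  shows "trie_state s' key"
proof -
  have "(\<lambda>b. arrs s' (if b then rightA else downA)) = (\<lambda>b. arrs s (if b then rightA else downA))"
    using assms(3,4) by auto
  then show ?thesis using assms(1,2) by (simp add: trie_state_def)
qed

text \<open>The node reached after all columns carries the key of the merged tree. Its payload is
  the class of that tree or, if it is 0, shows that the class has to be created.\<close>

lemma merge_twins:
  assumes T: "T \<ge> X + 300 * n + 200" and n: "regs s nR = n"
    and off: "\<And>i. i < n \<Longrightarrow> arrs s offA i = i * n"
    and v: "regs s vR = v" "v < n" and u: "regs s uR = u" "u < n" "u \<noteq> v"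
    and e: "regs s eR = of_bool a" and ct: "table_of n s tree_of key" and trie: "trie_state s key"
    and lv: "label_of n s tree_of v tv" and lu: "label_of n s tree_of u tu"
    and K: "regs s countR < n" and sz: "size (kids a tv + kids a tu) \<le> n"
  shows "run merge_twins (\<lambda>T' s'. T' \<ge> X \<and>
     merge_frame s s' \<and>
     regs s' heightR = regs s heightR - 1 \<and> regs s' aliveR = regs s aliveR - 1 \<and>
     arrs s' deadA = (arrs s deadA)(u := 1) \<and> regs s' countR \<le> Suc (regs s countR) \<and>
     (relabelled n s tree_of s' v (merge_cotrees a tv tu))) T s"
  (is "run _ ?Q _ _")
proof -
  define M where "M = kids a tv + kids a tu"
  define b where "b = (of_bool a :: nat)"
  let ?K = "regs s countR"
  have inj: "inj_on tree_of {..<?K}" using ct by (simp add: class_table_def)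
  have Msub: "set_mset M \<subseteq> tree_of ` {..<?K}"
    using kids_subset[OF lv] kids_subset[OF lu] by (simp add: M_def)
  let ?s1 = "s\<lparr>arrs := (arrs s)(deadA := (arrs s deadA)(u := 1)),
     regs := (regs s)(heightR := regs s heightR - 1, aliveR := regs s aliveR - 1,
       tR := b + 1, xR := b + 1, pR := v * n, qR := u * n, cR := 0, goodR := 1)\<rparr>"
  let ?fin = "\<lambda>Q. run (Cond (Eq (Read nodeA (Reg xR)) (Const 0)) (block [
       Write nodeA (Reg xR) (Reg countR),
       Write swapA (Reg countR) (Reg goodR),
       Assign countR (Inc (Reg countR))]) Skip)
     (run (Write classA (Reg vR) (Read nodeA (Reg xR))) (run (Write typeA (Reg vR) (Reg tR)) Q))"
  have start: "run merge_twins Q T s"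
    if "run (While (Lt (Reg cR) (Reg nR)) column) (?fin Q) (T - 24) ?s1" for Q
    unfolding merge_twins_def block.simps run_Seq using that T off v u e[folded b_def]
    by (simp add: Nat.le_diff_conv2 del: One_nat_def)
  have "run (While (Lt (Reg cR) (Reg nR)) column) (?fin ?Q) (T - 24) ?s1"
  proof (rule run_mono[OF columns[where X = "X + 60" and n = n and v = v and u = u and a = a and
        key = key and tree_of = tree_of and K = ?K and tv = tv and tu = tu and M = M]], goal_cases)
    case (21 T2 s2)
    then obtain key2 where k2: "trie_state s2 key2" "extends (regs s freshR) key key2"
        "regs s freshR \<le> regs s2 freshR" "regs s2 xR \<in> {1..<regs s2 freshR}"
        "key2 (regs s2 xR) = class_key n ?K tree_of a M" by auto
    have T2: "T2 \<ge> X + 60" using 21 by blast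
    let ?R = "{heightR, aliveR, tR, xR, pR, qR, cR, goodR, freshR, parR, mR, yR}"
    let ?A = "{deadA, rowA, downA, rightA}"
    have un: "column_frame ?s1 s2"
      using 21 by blast
    have fr: "regs s2 r = regs s r" if "r \<notin> ?R" for r
      using un that by (simp add: unchanged_def)
    have fa: "arrs s2 b = arrs s b" if "b \<notin> ?A" for b
      using un that by (simp add: unchanged_def)
    have ex: "regs s2 heightR = regs s heightR - 1" "regs s2 aliveR = regs s aliveR - 1"
      "regs s2 tR = Suc (of_bool a)" "arrs s2 deadA = (arrs s deadA)(u := 1)"
      using un by (simp_all add: unchanged_def b_def)
    have cnt: "arrs s2 rowA = (\<lambda>i. if v * n \<le> i \<and> i < v * n + n then class_counts ?K tree_of M (i - v * n) else arrs s rowA i)"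
      using 21 by (simp cong: if_cong)
    have roww: "arrs s2 rowA (w * n + c) = arrs s rowA (w * n + c)" if "w \<noteq> v" "c < n" for w c
    proof -
      have "(v * n \<le> w * n + c \<and> w * n + c < v * n + n) = False"
        using row_disjoint[of w v c n n] that by simp
      then show ?thesis unfolding cnt by (simp only: if_False)
    qed
    have Fs: "arrs s swapA c = of_bool (swappable (tree_of c))" if "c < ?K" for c
      using ct that by (simp add: class_table_def)
    have good: "regs s2 goodR = of_bool (swappable (Node a M))"
    proof -
      have "regs s2 goodR = of_bool (\<forall>c<n. arrs ?s1 swapA c \<noteq> 0 \<or> even (class_counts ?K tree_of M c))"
        using 21 by blast
      also have "arrs ?s1 swapA = arrs s swapA" by simp
      also have "(\<forall>c<n. arrs s swapA c \<noteq> 0 \<or> even (class_counts ?K tree_of M c)) \<longleftrightarrow> swappable (Node a M)"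
        using swappable_class_counts[OF Msub less_imp_le[OF K] Fs, of a] by simp
      finally show ?thesis .
    qed
    have ct2: "class_table n ?K (arrs s swapA) (arrs s nodeA) (regs s2 freshR) tree_of key2"
      using class_table_extends[OF ct k2(2,3)] .
    have injk: "inj_on key2 {1..<regs s2 freshR}" using k2(1) by (simp add: trie_state_def trie_def)
    have mc: "merge_cotrees a tv tu = Node a M" by (simp add: merge_cotrees_def M_def)
    have lw: "labelled n ?K tree_of (arrs s classA w) (arrs s typeA w) (\<lambda>c. arrs s2 rowA (w * n + c)) t"
      if "w < n" "w \<noteq> v" "label_of n s tree_of w t" for w t
    proof -
      have "\<forall>c<n. arrs s2 rowA (w * n + c) = arrs s rowA (w * n + c)"
        using roww[OF that(2)] by blast
      then show ?thesis using that(3) unfolding labelled_def by simp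
    qed
    let ?x = "regs s2 xR"
    show ?case
    proof (cases "arrs s nodeA ?x = 0")
      case False
      let ?s = "s2\<lparr>arrs := (arrs s2)(classA := (arrs s classA)(v := arrs s nodeA ?x),
         typeA := (arrs s typeA)(v := regs s2 tR))\<rparr>"
      from class_table_found[OF ct2 less_imp_le[OF K] Msub k2(5) False]
      have cx: "tree_of (arrs s nodeA ?x) = Node a M" "arrs s nodeA ?x < ?K" .
      have l1: "label_of n ?s tree_of v (Node a M)"
        using cx Msub fr[of countR] ex(3) by (simp add: labelled_def cnt)
      have l2: "\<forall>w t. w < n \<longrightarrow> w \<noteq> v \<longrightarrow> label_of n s tree_of w t \<longrightarrow> label_of n ?s tree_of w t"
      proof (intro allI impI)
        fix w t assume w: "w < n" "w \<noteq> v" "label_of n s tree_of w t"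
        show "label_of n ?s tree_of w t" using lw[OF w] w(2) fr[of countR] by simp
      qed
      have t1: "table_of n ?s tree_of key2" using ct2 fr[of countR] fa by simp
      have t2: "trie_state ?s key2" by (rule trie_state_cong[OF k2(1)]) simp_all
      have ex2: "relabelled n s tree_of ?s v (merge_cotrees a tv tu)"
        unfolding mc by (intro exI conjI) (rule t1 t2 l1 l2)+
      have un2: "merge_frame s ?s"
        using fr fa by (simp add: unchanged_def)
      have Q: "?Q T3 ?s" if "T3 \<ge> X" for T3
      proof (intro conjI)
        show "T3 \<ge> X" by fact
        show "merge_frame s ?s" by fact
        show "regs ?s heightR = regs s heightR - 1" "regs ?s aliveR = regs s aliveR - 1"
          "arrs ?s deadA = (arrs s deadA)(u := 1)" "regs ?s countR \<le> Suc ?K"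
          using ex fr[of countR] by simp_all
        show "relabelled n s tree_of ?s v (merge_cotrees a tv tu)" by fact
      qed
      have step: "?fin Q T2 s2" if "\<And>T3. T3 \<ge> X \<Longrightarrow> Q T3 ?s" for Q
        using that[of "T2 - 13"] T2 False fa fr[of vR] v
        by (simp add: Nat.le_diff_conv2 del: One_nat_def)
      show ?thesis by (rule step, rule Q)
    next
      case True
      let ?tree_of = "tree_of(?K := Node a M)"
      let ?s = "s2\<lparr>regs := (regs s2)(countR := ?K + 1), arrs := (arrs s2)(nodeA := (arrs s nodeA)(?x := ?K),
           swapA := (arrs s swapA)(?K := regs s2 goodR),
           classA := (arrs s classA)(v := ?K), typeA := (arrs s typeA)(v := regs s2 tR))\<rparr>"
      note new = class_table_new[OF ct2 K Msub k2(5) True k2(4) injk good]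
      have l1: "label_of n ?s ?tree_of v (Node a M)"
        using Msub class_counts_extend[OF Msub new(1)]
          subset_trans[OF Msub image_extend]
        by (simp add: labelled_def cnt ex(3))
      have l2: "\<forall>w t. w < n \<longrightarrow> w \<noteq> v \<longrightarrow> label_of n s tree_of w t \<longrightarrow> label_of n ?s ?tree_of w t"
      proof (intro allI impI)
        fix w t assume w: "w < n" "w \<noteq> v" "label_of n s tree_of w t"
        show "label_of n ?s ?tree_of w t" using labelled_extend[OF lw[OF w] new(1)] w(2) fr[of countR] by simp
      qed
      have t1: "table_of n ?s ?tree_of key2" using new(2) by simp
      have t2: "trie_state ?s key2" by (rule trie_state_cong[OF k2(1)]) simp_all
      have ex2: "relabelled n s tree_of ?s v (merge_cotrees a tv tu)"
        unfolding mc by (intro exI conjI) (rule t1 t2 l1 l2)+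
      have un2: "merge_frame s ?s"
        using fr fa by (simp add: unchanged_def)
      have Q: "?Q T3 ?s" if "T3 \<ge> X" for T3
      proof (intro conjI)
        show "T3 \<ge> X" by fact
        show "merge_frame s ?s" by fact
        show "regs ?s heightR = regs s heightR - 1" "regs ?s aliveR = regs s aliveR - 1"
          "arrs ?s deadA = (arrs s deadA)(u := 1)" "regs ?s countR \<le> Suc ?K"
          using ex fr[of countR] by simp_all
        show "relabelled n s tree_of ?s v (merge_cotrees a tv tu)" by fact
      qed
      have step: "?fin Q T2 s2" if "\<And>T3. T3 \<ge> X \<Longrightarrow> Q T3 ?s" for Q
        using that[of "T2 - 21"] T2 True fa fr[of vR] fr[of countR] v
        by (simp add: Nat.le_diff_conv2 del: One_nat_def)
      show ?thesis by (rule step, rule Q)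
    qed
  next
    case 13
    have "trie (regs s freshR) (\<lambda>b. arrs s (if b then rightA else downA)) key"
      using trie by (simp add: trie_state_def)
    then show ?case by (cases a) (simp_all add: trie_def b_def numeral_2_eq_2)
  next
    case 15
    show ?case by (rule trie_state_cong[OF trie]) simp_all
  next
    case 14
    have "trie (regs s freshR) (\<lambda>b. arrs s (if b then rightA else downA)) key"
      using trie by (simp add: trie_state_def)
    then show ?case by (cases a) (simp_all add: trie_def b_def numeral_2_eq_2)
  qed (use T n v u inj lv lu sz trie in \<open>simp_all add: trie_state_def M_def b_def\<close>)
  then show ?thesis by (rule start)
qed

section \<open>The twin search\<close>

context simple_graph begin

text \<open>The six adjacencies force the four vertices to be distinct, so distinctness stays
  implicit.\<close>

definition p4_free :: "'a set \<Rightarrow> bool" where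
  "p4_free V \<longleftrightarrow> (\<forall>a\<in>V. \<forall>b\<in>V. \<forall>c\<in>V. \<forall>d\<in>V.
     \<not> (E a b \<and> E b c \<and> E c d \<and> \<not> E a c \<and> \<not> E b d \<and> \<not> E a d))"

lemma p4_freeD:
  assumes "p4_free V" "a \<in> V" "b \<in> V" "c \<in> V" "d \<in> V" "E a b" "E b c" "E c d"
    and "\<not> E a c" "\<not> E b d" "\<not> E a d"
  shows False
  using assms unfolding p4_free_def by blast

text \<open>The path on four vertices is self-complementary: if \<open>a\<close>, \<open>b\<close>,
  \<open>c\<close>, \<open>d\<close> is an induced path of non-edges, then \<open>c\<close>,
  \<open>a\<close>, \<open>d\<close>, \<open>b\<close> is one of edges.\<close>

lemma p4_free_colour:
  assumes p: "p4_free V" and V: "a \<in> V" "b \<in> V" "c \<in> V" "d \<in> V"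
    and e: "E a b = x" "E b c = x" "E c d = x" "E a c \<noteq> x" "E b d \<noteq> x" "E a d \<noteq> x"
  shows False
proof (cases x)
  case True
  then show False using p4_freeD[OF p V] e by simp
next
  case False
  then show False
    using p4_freeD[OF p V(3,1,4,2)] e E_sym[of c a] E_sym[of d b] E_sym[of c b] by simp
qed

text \<open>
  The types of the edges between consecutive stack elements alternate. Without this, a newly
  pushed vertex could be distinguished from the others by an element further down.
\<close>

definition chain :: "'a set \<Rightarrow> (nat \<Rightarrow> 'a) \<Rightarrow> nat \<Rightarrow> bool" where
  "chain V S h \<longleftrightarrow> 1 \<le> h \<and> (\<forall>i<h. S i \<in> V) \<and>
     (\<forall>i j. i < j \<longrightarrow> j < h \<longrightarrow> S i \<noteq> S j \<and> E (S i) (S j) = E (S i) (S (Suc i))) \<and>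
     (\<forall>i. Suc (Suc i) < h \<longrightarrow> E (S i) (S (Suc i)) \<noteq> E (S (Suc i)) (S (Suc (Suc i))))"

lemma chainD:
  assumes "chain V S h"
  shows "1 \<le> h" "\<And>i. i < h \<Longrightarrow> S i \<in> V" "\<And>i j. i < j \<Longrightarrow> j < h \<Longrightarrow> S i \<noteq> S j"
    "\<And>i j. i < j \<Longrightarrow> j < h \<Longrightarrow> E (S i) (S j) = E (S i) (S (Suc i))"
    "\<And>i. Suc (Suc i) < h \<Longrightarrow> E (S i) (S (Suc i)) \<noteq> E (S (Suc i)) (S (Suc (Suc i)))"
  using assms unfolding chain_def by blast+

lemma chain_height: "chain V S h \<Longrightarrow> finite V \<Longrightarrow> h \<le> card V"
proof -
  assume c: "chain V S h" and f: "finite V"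
  have "S i \<noteq> S j" if "i < j" "j < h" for i j using chainD(3)[OF c that] .
  then have "inj_on S {..<h}"
    by (intro inj_onI) (metis lessThan_iff linorder_neqE_nat)
  then have "card (S ` {..<h}) = h" by (simp add: card_image)
  moreover have "S ` {..<h} \<subseteq> V" using chainD(2)[OF c] by blast
  ultimately show ?thesis using card_mono[OF f, of "S ` {..<h}"] by simp
qed

lemma chain_extend:
  assumes c: "chain V S (Suc m)" and w: "w \<in> V"
    and u: "\<And>i. i \<le> m \<Longrightarrow> S i \<noteq> w" "\<And>i. i < m \<Longrightarrow> E (S i) w = E (S i) (S (Suc i))"
    and alt: "\<And>l. m = Suc l \<Longrightarrow> E (S l) (S m) \<noteq> E (S m) w"
  shows "chain V (S(Suc m := w)) (Suc (Suc m))" (is "chain V ?S _")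
  unfolding chain_def
proof (intro conjI allI impI)
  fix i assume "i < Suc (Suc m)"
  then show "?S i \<in> V" using chainD(2)[OF c, of i] w by auto
next
  fix i j assume ij: "i < j" "j < Suc (Suc m)"
  show "?S i \<noteq> ?S j"
  proof (cases "j = Suc m")
    case True
    then show ?thesis using ij u(1)[of i] by auto
  next
    case False
    then show ?thesis using ij chainD(3)[OF c, of i j] by auto
  qed
  show "E (?S i) (?S j) = E (?S i) (?S (Suc i))"
  proof (cases "j = Suc m")
    case True
    then show ?thesis using ij u(2)[of i] by (cases "i = m") auto
  next
    case False
    then have "E (S i) (S j) = E (S i) (S (Suc i))" using ij chainD(4)[OF c, of i j] by simp
    then show ?thesis using ij False by simp
  qed
next
  fix i assume i: "Suc (Suc i) < Suc (Suc m)"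
  show "E (?S i) (?S (Suc i)) \<noteq>
      E (?S (Suc i)) (?S (Suc (Suc i)))"
  proof (cases "m = Suc i")
    case True
    then show ?thesis using alt[of i] by auto
  next
    case False
    then show ?thesis using i chainD(5)[OF c, of i] by simp
  qed
qed simp

text \<open>Induction down the stack. Let \<open>x\<close> lie just below \<open>y\<close> and
  suppose that \<open>x\<close> tells \<open>w\<close> from the vertices above. By induction and
  alternation \<open>y\<close> sees \<open>w\<close> in the type opposite to that of
  \<open>xy\<close>. One of the two top vertices, \<open>z\<close>, sees \<open>w\<close> in the
  type of \<open>xy\<close>, because \<open>w\<close> distinguishes them. Then \<open>y\<close>,
  \<open>x\<close>, \<open>z\<close>, \<open>w\<close> is an induced path in that type.\<close>

lemma chain_push:
  assumes c: "chain V S (Suc (Suc m))" and p4: "p4_free V" and w: "w \<in> V" "w \<noteq> S m" "w \<noteq> S (Suc m)"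
    and d: "E (S m) w \<noteq> E (S (Suc m)) w" "E (S (Suc m)) w \<noteq> E (S (Suc m)) (S m)"
  shows "chain V (S(Suc (Suc m) := w)) (Suc (Suc (Suc m)))"
proof -
  let ?v = "S m" and ?u = "S (Suc m)"
  have SV: "S i \<in> V" if "i < Suc (Suc m)" for i using chainD(2)[OF c that] .
  have un: "S i \<noteq> S j" "E (S i) (S j) = E (S i) (S (Suc i))" if "i < j" "j < Suc (Suc m)" for i j
    using chainD(3,4)[OF c that] .
  have alt: "E (S i) (S (Suc i)) \<noteq> E (S (Suc i)) (S (Suc (Suc i)))" if "i < m" for i
    using chainD(5)[OF c, of i] that by simp
  have key: "S (m - i) \<noteq> w \<and> E (S (m - i)) w = E (S (m - i)) (S (Suc (m - i)))" if "i \<le> m" for i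
    using that
  proof (induction i)
    case 0
    then show ?case using w d E_sym[of ?u ?v] by auto
  next
    case (Suc i)
    define l where "l = m - Suc i"
    have l: "l < m" "m - i = Suc l" using Suc.prems by (auto simp: l_def)
    let ?x = "S l" and ?y = "S (Suc l)"
    have IH: "E ?y w = E ?y (S (Suc (Suc l)))" using Suc l by simp
    have xu: "E ?x ?u = E ?x ?y" and xv: "E ?x ?v = E ?x ?y"
      using un(2)[of l "Suc m"] un(2)[of l m] l by simp_all
    have "?x \<noteq> w"
    proof
      assume "?x = w"
      then show False using d(1) xu xv E_sym[of ?v w] E_sym[of ?u w] by simp
    qed
    moreover have "E ?x w = E ?x ?y"
    proof (rule ccontr)
      assume n: "E ?x w \<noteq> E ?x ?y"
      have yw: "E ?y w \<noteq> E ?x ?y" using IH alt[OF l(1)] by simp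
      have False if z: "z \<in> V" "E ?x z = E ?x ?y" "E ?y z \<noteq> E ?x ?y" "E z w = E ?x ?y" for z
        by (rule p4_free_colour[OF p4, of ?y ?x z w "E ?x ?y"])
          (use z n yw SV l w E_sym[of ?y ?x] in auto)
      note p = this
      have yu: "E ?y ?u \<noteq> E ?x ?y" using un(2)[of "Suc l" "Suc m"] l alt[OF l(1)] by simp
      show False
      proof (cases "E ?u w = E ?x ?y")
        case True
        then show False using p[of ?u] SV xu yu by simp
      next
        case False
        then have vw: "E ?v w = E ?x ?y" using d(1) by auto
        \<comment> \<open>The path needs \<open>z\<close> different from \<open>y\<close>. If
          \<open>v\<close> were \<open>y\<close>, both \<open>uw\<close> and \<open>uv\<close> would
          have the type opposite to \<open>xy\<close>, against the choice of the top vertex.\<close>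
        have "Suc l \<noteq> m"
        proof
          assume "Suc l = m"
          then have "E ?u ?v \<noteq> E ?x ?y" using yu E_sym[of ?u ?v] by simp
          then show False using False d(2) by auto
        qed
        then have "Suc l < m" using l by simp
        then have "E ?y ?v \<noteq> E ?x ?y" using un(2)[of "Suc l" m] alt[OF l(1)] by simp
        then show False using p[of ?v] SV xv vw by simp
      qed
    qed
    ultimately show ?case by (simp add: l_def[symmetric])
  qed
  show ?thesis
  proof (rule chain_extend[OF c w(1)])
    fix i assume "i \<le> Suc m"
    then show "S i \<noteq> w" using key[of "m - i"] w by (cases "i = Suc m") auto
  next
    fix i assume "i < Suc m"
    then show "E (S i) w = E (S i) (S (Suc i))" using key[of "m - i"] by simp
  next
    fix l assume "Suc m = Suc l"
    then show "E (S l) (S (Suc m)) \<noteq> E (S (Suc m)) w" using d(2) E_sym[of ?u ?v] by simp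
  qed
qed

text \<open>No vertex below distinguishes the two topmost ones, and the edge between these two has
  no direction, so the alternation is unaffected.\<close>

lemma chain_swap:
  assumes c: "chain V S (Suc (Suc m))"
  shows "chain V (S(m := S (Suc m), Suc m := S m)) (Suc (Suc m))"
proof -
  let ?S = "S(m := S (Suc m), Suc m := S m)"
  have un: "S i \<noteq> S j" "E (S i) (S j) = E (S i) (S (Suc i))" if "i < j" "j < Suc (Suc m)" for i j
    using chainD(3,4)[OF c that] .
  have alt: "E (S i) (S (Suc i)) \<noteq> E (S (Suc i)) (S (Suc (Suc i)))" if "i < m" for i
    using chainD(5)[OF c, of i] that by simp
  have low: "E (?S i) (?S j) = E (S i) (S (Suc i))" "?S i \<noteq> ?S j" if "i < m" "i < j" "j < Suc (Suc m)" for i j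
    using un[of i j] un[of i m] un[of i "Suc m"] that by auto
  show ?thesis unfolding chain_def
  proof (intro conjI allI impI)
    fix i assume "i < Suc (Suc m)"
    then show "?S i \<in> V" using chainD(2)[OF c] by auto
  next
    fix i j assume ij: "i < j" "j < Suc (Suc m)"
    show "?S i \<noteq> ?S j"
    proof (cases "i < m")
      case True
      then show ?thesis using low(2) ij by blast
    next
      case False
      then have "i = m" "j = Suc m" using ij by auto
      then show ?thesis using un(1)[of m "Suc m"] by auto
    qed
    show "E (?S i) (?S j) = E (?S i) (?S (Suc i))"
    proof (cases "i < m")
      case True
      then show ?thesis using low(1)[of i j] low(1)[of i "Suc i"] ij by simp
    next
      case False
      then have "i = m" "j = Suc m" using ij by auto
      then show ?thesis by simp
    qed
  next
    fix i assume "Suc (Suc i) < Suc (Suc m)"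
    then have i: "i < m" by simp
    have 1: "E (?S i) (?S (Suc i)) = E (S i) (S (Suc i))" using low(1)[of i "Suc i"] i by simp
    show "E (?S i) (?S (Suc i)) \<noteq> E (?S (Suc i)) (?S (Suc (Suc i)))"
    proof (cases "Suc i = m")
      case True
      then have "E (?S (Suc i)) (?S (Suc (Suc i))) = E (S (Suc i)) (S (Suc (Suc i)))"
        using E_sym by simp
      then show ?thesis using 1 alt[OF i] by simp
    next
      case False
      then have "E (?S (Suc i)) (?S (Suc (Suc i))) = E (S (Suc i)) (S (Suc (Suc i)))"
        using low(1)[of "Suc i" "Suc (Suc i)"] i by simp
      then show ?thesis using 1 alt[OF i] by simp
    qed
  qed simp
qed

lemma chain_pop:
  assumes c: "chain V S (Suc (Suc m))"
  shows "chain (V - {S (Suc m)}) S (Suc m)"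
  unfolding chain_def
proof (intro conjI allI impI)
  fix i assume "i < Suc m"
  then show "S i \<in> V - {S (Suc m)}" using chainD(2)[OF c, of i] chainD(3)[OF c, of i "Suc m"] by simp
next
  fix i j assume "i < j" "j < Suc m"
  then show "S i \<noteq> S j" "E (S i) (S j) = E (S i) (S (Suc i))" using chainD(3,4)[OF c, of i j] by simp_all
next
  fix i assume "Suc (Suc i) < Suc m"
  then show "E (S i) (S (Suc i)) \<noteq> E (S (Suc i)) (S (Suc (Suc i)))" using chainD(5)[OF c, of i] by simp
qed simp

text \<open>\<open>md v\<close> collects the original vertices absorbed by the survivor
  \<open>v\<close>. The surviving vertices form a quotient of the graph, in which adjacency of
  representatives is adjacency of whole sets.\<close>

definition modules :: "'a set \<Rightarrow> 'a set \<Rightarrow> ('a \<Rightarrow> 'a set) \<Rightarrow> ('a \<Rightarrow> cotree) \<Rightarrow> bool" where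
  "modules U V md lab \<longleftrightarrow> (\<forall>v\<in>V. represents (md v) (lab v)) \<and> (\<Union>v\<in>V. md v) = U \<and>
     (\<forall>v\<in>V. \<forall>w\<in>V. v \<noteq> w \<longrightarrow> md v \<inter> md w = {} \<and> joined (E v w) (md v) (md w))"

text \<open>A third vertex sees twins alike, so it sees their united sets uniformly. The edge or
  non-edge between the twins gives the type of the new root.\<close>

lemma modules_merge:
  assumes m: "modules U V md lab" and uv: "u \<in> V" "v \<in> V" "u \<noteq> v"
    and twins: "\<And>z. z \<in> V \<Longrightarrow> z \<noteq> u \<Longrightarrow> z \<noteq> v \<Longrightarrow> E v z = E u z"
  shows "modules U (V - {u}) (md(v := md v \<union> md u))
    (lab(v := merge_cotrees (E u v) (lab v) (lab u)))"
  unfolding modules_def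
proof (intro conjI ballI impI)
  have r: "represents (md w) (lab w)" if "w \<in> V" for w using m that by (simp add: modules_def)
  have d: "md z \<inter> md w = {}" "joined (E z w) (md z) (md w)" if "z \<in> V" "w \<in> V" "z \<noteq> w" for z w
    using m that by (auto simp: modules_def)
  have "joined (E u v) (md v) (md u)" using d(2)[of v u] uv E_sym by simp
  then have "represents (md v \<union> md u) (merge_cotrees (E u v) (lab v) (lab u))"
    using r d(1)[of v u] uv by (intro represents_merge) auto
  then show "represents ((md(v := md v \<union> md u)) w) ((lab(v := merge_cotrees (E u v) (lab v) (lab u))) w)"
    if "w \<in> V - {u}" for w using that r by simp
  have "(\<Union>w\<in>V - {u}. (md(v := md v \<union> md u)) w) = (\<Union>w\<in>V. md w)"
  proof -
    let ?W = "V - {u} - {v}"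
    have W: "V - {u} = insert v ?W" "V = insert v (insert u ?W)" using uv by auto
    have "(\<Union>w\<in>?W. (md(v := md v \<union> md u)) w) = (\<Union>w\<in>?W. md w)" by simp
    then have "(\<Union>w\<in>insert v ?W. (md(v := md v \<union> md u)) w) = md v \<union> (md u \<union> (\<Union>w\<in>?W. md w))"
      by (simp only: UN_insert fun_upd_same Un_assoc)
    also have "\<dots> = (\<Union>w\<in>insert v (insert u ?W). md w)" by (simp only: UN_insert)
    finally show ?thesis using W by (simp only: W(1)[symmetric] W(2)[symmetric])
  qed
  then show "(\<Union>w\<in>V - {u}. (md(v := md v \<union> md u)) w) = U" using m by (simp add: modules_def)
  fix z w assume zw: "z \<in> V - {u}" "w \<in> V - {u}" "z \<noteq> w"
  consider "z = v" | "w = v" "z \<noteq> v" | "z \<noteq> v" "w \<noteq> v" by blast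
  then have "(md(v := md v \<union> md u)) z \<inter> (md(v := md v \<union> md u)) w = {} \<and>
     joined (E z w) ((md(v := md v \<union> md u)) z) ((md(v := md v \<union> md u)) w)"
  proof cases
    case 1
    have "E v w = E u w" using twins[of w] zw 1 by auto
    then have "joined (E v w) (md v \<union> md u) (md w)"
      using d(2)[of v w] d(2)[of u w] zw uv 1 by auto
    moreover have "(md v \<union> md u) \<inter> md w = {}"
      using d(1)[of v w] d(1)[of u w] zw uv 1 by auto
    ultimately show ?thesis using 1 zw by simp
  next
    case 2
    have "E z v = E z u" using twins[of z] zw 2 E_sym by auto
    then have "joined (E z v) (md z) (md v \<union> md u)"
      using d(2)[of z v] d(2)[of z u] zw uv 2 by auto
    moreover have "md z \<inter> (md v \<union> md u) = {}"
      using d(1)[of z v] d(1)[of z u] zw uv 2 by auto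
    ultimately show ?thesis using 2 zw by simp
  next
    case 3
    then show ?thesis using d[of z w] zw by simp
  qed
  then show "(md(v := md v \<union> md u)) z \<inter> (md(v := md v \<union> md u)) w = {}"
    "joined (E z w) ((md(v := md v \<union> md u)) z) ((md(v := md v \<union> md u)) w)" by blast+
qed

lemma modules_initial: "modules U U (\<lambda>v. {v}) (\<lambda>_. Leaf)"
  by (auto simp: modules_def joined_def intro: leaf)

lemma modules_size:
  assumes "modules U V md lab" "finite U" "u \<in> V" "v \<in> V" "u \<noteq> v"
  shows "size (kids a (lab v) + kids a (lab u)) \<le> card U"
proof -
  have r: "represents (md v) (lab v)" "represents (md u) (lab u)" "md v \<inter> md u = {}"
    using assms(1,3-5) by (simp_all add: modules_def)
  have "md v \<subseteq> U" "md u \<subseteq> U" using assms(1,3,4) unfolding modules_def by blast+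
  then have s: "md v \<union> md u \<subseteq> U" by simp
  have f: "finite (md v)" "finite (md u)" "size (kids a (lab v)) \<le> card (md v)" "size (kids a (lab u)) \<le> card (md u)"
    using family_finite[OF represents_kids[OF r(1)]] family_finite[OF represents_kids[OF r(2)]] by auto
  then show ?thesis using card_mono[OF assms(2) s] card_Un_disjoint[OF f(1,2) r(3)] by simp
qed

end

section \<open>The main loop: invariant, progress and total time\<close>

locale p4_free_graph = simple_graph E for E :: "nat \<Rightarrow> nat \<Rightarrow> bool" +
  fixes n :: nat
  assumes p4: "p4_free {..<n}"
begin

definition alive :: "ram_state \<Rightarrow> nat set" where
  "alive s = {z. z < n \<and> arrs s deadA z = 0}"

definition labels_ok :: "ram_state \<Rightarrow> (nat \<Rightarrow> cotree) \<Rightarrow> bool" where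
  "labels_ok s lab \<longleftrightarrow> (\<exists>tree_of key. table_of n s tree_of key \<and> trie_state s key \<and>
     (\<forall>v\<in>alive s. label_of n s tree_of v (lab v)))"

text \<open>For the last conjunct, a merge removes a vertex and adds at most one class. While two
  vertices are alive it gives \<open>countR < n\<close>, so a new class still has a column in the
  rows.\<close>

definition loop_inv :: "ram_state \<Rightarrow> bool" where
  "loop_inv s \<longleftrightarrow> regs s nR = n \<and> (\<forall>i<n. arrs s offA i = i * n) \<and>
     (\<forall>i<n. \<forall>j<n. arrs s matA (i * n + j) = of_bool (E i j)) \<and>
     regs s aliveR = card (alive s) \<and> chain (alive s) (arrs s stackA) (regs s heightR) \<and>
     (\<exists>lab md. labels_ok s lab \<and> modules {..<n} (alive s) md lab) \<and>
     regs s countR + card (alive s) \<le> n + 1"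

lemma finite_alive: "finite (alive s)"
  by (simp add: alive_def)

lemma labels_ok_cong:
  assumes "labels_ok s lab" "alive s' = alive s" "regs s' countR = regs s countR" "regs s' freshR = regs s freshR"
    "\<And>a. a \<in> {typeA, classA, rowA, swapA, downA, rightA, nodeA} \<Longrightarrow> arrs s' a = arrs s a"
  shows "labels_ok s' lab"
proof -
  from assms(1) obtain tree_of key where k: "table_of n s tree_of key" "trie_state s key"
    "\<forall>v\<in>alive s. label_of n s tree_of v (lab v)" unfolding labels_ok_def by blast
  have "trie_state s' key" by (rule trie_state_cong[OF k(2)]) (use assms in simp_all)
  with k assms show ?thesis unfolding labels_ok_def by (intro exI[of _ tree_of] exI[of _ key]) simp
qed

lemma push:
  assumes T: "T \<ge> X + 40" and inv: "loop_inv s"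
    and uv: "regs s uR = arrs s stackA (regs s heightR - 1)" "regs s vR = arrs s stackA (regs s heightR - 1 - 1)"
    and e: "regs s eR = of_bool (E (regs s uR) (regs s vR))" and g: "regs s gR = of_bool (E (regs s uR) (regs s wR))"
    and w: "regs s wR \<in> alive s" "regs s wR \<noteq> regs s uR" "regs s wR \<noteq> regs s vR"
    and d: "regs s uR = regs s vR \<or> E (regs s vR) (regs s wR) \<noteq> E (regs s uR) (regs s wR)"
  shows "run push (\<lambda>T' s'. T' \<ge> X \<and> loop_inv s' \<and> alive s' = alive s \<and>
     regs s' heightR = Suc (regs s heightR)) T s"
proof -
  let ?h = "regs s heightR" and ?S = "arrs s stackA"
  let ?u = "regs s uR" and ?v = "regs s vR" and ?w = "regs s wR"
  define S' where "S' = (if E ?u ?w = E ?u ?v then ?S(?h - 1 - 1 := ?u, ?h - 1 := ?v) else ?S)"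
  have c: "chain (alive s) ?S ?h" using inv by (simp add: loop_inv_def)
  have h1: "1 \<le> ?h" using chainD(1)[OF c] .
  have chain': "chain (alive s) (S'(?h := ?w)) (Suc ?h)"
  proof (cases "?h = 1")
    case True
    then have "S' = ?S" "?u = ?S 0" using uv by (auto simp: S'_def)
    have "chain (alive s) (?S(Suc 0 := ?w)) (Suc (Suc 0))"
    proof (rule chain_extend)
      show "chain (alive s) ?S (Suc 0)" using c True by simp
    qed (use w \<open>?u = ?S 0\<close> in auto)
    then show ?thesis using True \<open>S' = ?S\<close> by simp
  next
    case False
    with h1 have "?h = Suc (Suc (?h - 2))" by simp
    then obtain m where m: "?h = Suc (Suc m)" by blast
    have uv': "?u = ?S (Suc m)" "?v = ?S m" using uv m by simp_all
    have c': "chain (alive s) ?S (Suc (Suc m))" using c m by simp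
    have ne: "?u \<noteq> ?v" using chainD(3)[OF c', of m "Suc m"] uv' by simp
    have p4': "p4_free (alive s)" using p4 unfolding p4_free_def alive_def by blast
    show ?thesis
    proof (cases "E ?u ?w = E ?u ?v")
      case False
      then have "chain (alive s) (?S(Suc (Suc m) := ?w)) (Suc (Suc (Suc m)))"
        using d ne w unfolding uv' by (intro chain_push[OF c' p4']) auto
      then show ?thesis using False m by (simp add: S'_def)
    next
      case True
      have "chain (alive s) ((?S(m := ?u, Suc m := ?v))(Suc (Suc m) := ?w)) (Suc (Suc (Suc m)))"
      proof (rule chain_push[OF _ p4'])
        show "chain (alive s) (?S(m := ?u, Suc m := ?v)) (Suc (Suc m))"
          using chain_swap[OF c'] unfolding uv' .
        show "?w \<in> alive s" "?w \<noteq> (?S(m := ?u, Suc m := ?v)) m" "?w \<noteq> (?S(m := ?u, Suc m := ?v)) (Suc m)"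
          using w by simp_all
        show "E ((?S(m := ?u, Suc m := ?v)) m) ?w \<noteq> E ((?S(m := ?u, Suc m := ?v)) (Suc m)) ?w"
          using d ne by auto
        show "E ((?S(m := ?u, Suc m := ?v)) (Suc m)) ?w \<noteq>
            E ((?S(m := ?u, Suc m := ?v)) (Suc m)) ((?S(m := ?u, Suc m := ?v)) m)"
          using True d ne E_sym[of ?u ?v] by simp
      qed
      then show ?thesis using True m by (simp add: S'_def)
    qed
  qed
  let ?s = "s\<lparr>arrs := (arrs s)(stackA := S'(?h := ?w)), regs := (regs s)(heightR := ?h + 1)\<rparr>"
  have al: "alive ?s = alive s" by (simp add: alive_def)
  from inv obtain lab md where lm: "labels_ok s lab" "modules {..<n} (alive s) md lab"
    unfolding loop_inv_def by blast
  have lab: "labels_ok ?s lab" by (rule labels_ok_cong[OF lm(1) al]) auto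
  have inv': "loop_inv ?s" using inv chain' lab lm(2) unfolding loop_inv_def al by auto
  have "run push Q T s" if Q: "\<And>T6. T6 \<ge> X \<Longrightarrow> Q T6 ?s" for Q
  proof (cases "E ?u ?w = E ?u ?v")
    case True
    then have "regs s gR = regs s eR" using e g by simp
    moreover have "?s = s\<lparr>arrs := (arrs s)(stackA := ?S(?h - 1 - 1 := ?u, ?h - 1 := ?v, ?h := ?w)),
       regs := (regs s)(heightR := ?h + 1)\<rparr>" using True by (simp add: S'_def)
    ultimately show ?thesis unfolding push_def block.simps
      using Q[of "T - 19"] T by (simp add: Nat.le_diff_conv2 del: One_nat_def)
  next
    case False
    then have "regs s gR \<noteq> regs s eR" using e g by simp
    moreover have "?s = s\<lparr>arrs := (arrs s)(stackA := ?S(?h := ?w)),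
       regs := (regs s)(heightR := ?h + 1)\<rparr>" using False by (simp add: S'_def)
    ultimately show ?thesis unfolding push_def block.simps
      using Q[of "T - 11"] T by (simp add: Nat.le_diff_conv2 del: One_nat_def)
  qed
  note step = this
  show ?thesis by (rule step) (use inv' al in simp)
qed

lemma merge_step:
  assumes T: "T \<ge> X + 300 * n + 200" and inv: "loop_inv s" and h: "regs s heightR = Suc (Suc m)"
    and uv: "regs s uR = arrs s stackA (Suc m)" "regs s vR = arrs s stackA m"
    and e: "regs s eR = of_bool (E (regs s uR) (regs s vR))"
    and twins: "\<And>z. z \<in> alive s \<Longrightarrow> z \<noteq> regs s uR \<Longrightarrow> z \<noteq> regs s vR \<Longrightarrow> E (regs s vR) z = E (regs s uR) z"
  shows "run merge_twins (\<lambda>T' s'. T' \<ge> X \<and> loop_inv s' \<and> alive s' = alive s - {regs s uR} \<and>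
     regs s' heightR = Suc m \<and> regs s uR \<in> alive s) T s"
proof -
  let ?u = "regs s uR" and ?v = "regs s vR"
  have c: "chain (alive s) (arrs s stackA) (Suc (Suc m))" using inv h by (simp add: loop_inv_def)
  have V: "?u \<in> alive s" "?v \<in> alive s" "?u \<noteq> ?v"
    using chainD(2)[OF c, of m] chainD(2)[OF c, of "Suc m"] chainD(3)[OF c, of m "Suc m"] uv by auto
  then have lt: "?u < n" "?v < n" by (auto simp: alive_def)
  from inv obtain lab md where lm: "labels_ok s lab" "modules {..<n} (alive s) md lab"
    unfolding loop_inv_def by blast
  then obtain tree_of key where k: "table_of n s tree_of key" "trie_state s key"
    "\<And>v. v \<in> alive s \<Longrightarrow> label_of n s tree_of v (lab v)" unfolding labels_ok_def by blast
  have "card {?u, ?v} \<le> card (alive s)" using V by (intro card_mono finite_alive) auto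
  then have "2 \<le> card (alive s)" using V(3) by simp
  then have K: "regs s countR < n" using inv by (simp add: loop_inv_def)
  have sz: "size (kids (E ?u ?v) (lab ?v) + kids (E ?u ?v) (lab ?u)) \<le> n"
    using modules_size[OF lm(2) _ V] by simp
  have off: "\<And>i. i < n \<Longrightarrow> arrs s offA i = i * n" and nn: "regs s nR = n"
    using inv by (auto simp: loop_inv_def)
  show ?thesis
  proof (rule run_mono[OF merge_twins[OF T nn off refl lt(2) refl lt(1) V(3) e k(1,2) k(3)[OF V(2)] k(3)[OF V(1)] K sz]], goal_cases)
    case (1 i)
    then show ?case .
  next
    case (2 T' s')
    then obtain tree_of' key' where k': "table_of n s' tree_of' key'" "trie_state s' key'"
        "label_of n s' tree_of' ?v (merge_cotrees (E ?u ?v) (lab ?v) (lab ?u))"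
        "\<And>w t. w < n \<Longrightarrow> w \<noteq> ?v \<Longrightarrow> label_of n s tree_of w t \<Longrightarrow> label_of n s' tree_of' w t" by blast
    have un: "merge_frame s s'"
      and hs: "regs s' heightR = regs s heightR - 1" "regs s' aliveR = regs s aliveR - 1"
        "arrs s' deadA = (arrs s deadA)(?u := 1)" "regs s' countR \<le> Suc (regs s countR)" "T' \<ge> X"
      using 2 by blast+
    have al: "alive s' = alive s - {?u}" unfolding alive_def hs(3) by auto
    let ?lab = "lab(?v := merge_cotrees (E ?u ?v) (lab ?v) (lab ?u))"
    have "label_of n s' tree_of' w (?lab w)" if "w \<in> alive s'" for w
      using that k'(3) k'(4)[of w "lab w"] k(3)[of w] unfolding al by (cases "w = ?v") (auto simp: alive_def)
    then have lab: "labels_ok s' ?lab" unfolding labels_ok_def using k'(1,2) by blast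
    have md: "modules {..<n} (alive s') (md(?v := md ?v \<union> md ?u)) ?lab"
      unfolding al using modules_merge[OF lm(2) V twins] by simp
    have ch: "chain (alive s') (arrs s' stackA) (Suc m)"
      using chain_pop[OF c] un unfolding al uv by (simp add: unchanged_def)
    have ca: "card (alive s') = card (alive s) - 1" unfolding al using V(1) by simp
    have "loop_inv s'" unfolding loop_inv_def
    proof (intro conjI)
      show "regs s' nR = n" "\<forall>i<n. arrs s' offA i = i * n" "\<forall>i<n. \<forall>j<n. arrs s' matA (i * n + j) = of_bool (E i j)"
        using inv un by (simp_all add: loop_inv_def unchanged_def)
      show "regs s' aliveR = card (alive s')" using hs ca inv by (simp add: loop_inv_def)
      show "chain (alive s') (arrs s' stackA) (regs s' heightR)" using ch hs h by simp
      show "\<exists>lab md. labels_ok s' lab \<and> modules {..<n} (alive s') md lab" using lab md by blast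
      show "regs s' countR + card (alive s') \<le> n + 1"
      proof -
        have "regs s countR + card (alive s) \<le> n + 1" using inv by (simp add: loop_inv_def)
        then show ?thesis using hs(4) ca \<open>2 \<le> card (alive s)\<close> by linarith
      qed
    qed
    then show ?case using hs al h V by simp
  qed
qed

lemma loop_inv_scan:
  assumes inv: "loop_inv s" and un: "unchanged R {} s s'"
    and R: "R \<inter> {nR, aliveR, heightR, countR, freshR} = {}"
  shows "loop_inv s'" "alive s' = alive s"
proof -
  have a: "arrs s' = arrs s" using un by (auto simp: unchanged_def)
  have r: "regs s' r = regs s r" if "r \<in> {nR, aliveR, heightR, countR, freshR}" for r
    using un R that unfolding unchanged_def by blast
  show al: "alive s' = alive s" by (simp add: alive_def a)
  from inv obtain lab md where lm: "labels_ok s lab" "modules {..<n} (alive s) md lab"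
    unfolding loop_inv_def by blast
  have "labels_ok s' lab" by (rule labels_ok_cong[OF lm(1) al]) (simp_all add: a r)
  with lm(2) inv show "loop_inv s'" unfolding loop_inv_def al a by (auto simp: r)
qed

text \<open>A push raises the height by one, a merge lowers the height and the number of survivors
  by one each; counting survivors twice makes both count as progress. The height is at most the
  number of survivors, so the subtraction is never truncated.\<close>

lemma iteration:
  assumes T: "T \<ge> X + 400 * n + 400" and inv: "loop_inv s" and k: "card (alive s) > 1"
  shows "run iteration (\<lambda>T' s'. T' \<ge> X \<and> loop_inv s' \<and>
     2 * card (alive s') - regs s' heightR < 2 * card (alive s) - regs s heightR) T s"
proof -
  let ?h = "regs s heightR" and ?S = "arrs s stackA"
  define u where "u = ?S (?h - 1)"
  define v where "v = ?S (?h - 1 - 1)"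
  let ?s = "s\<lparr>regs := (regs s)(vR := v, uR := u)\<rparr>"
  have c: "chain (alive s) ?S ?h" using inv by (simp add: loop_inv_def)
  have h1: "1 \<le> ?h" "?h \<le> card (alive s)" using chainD(1)[OF c] chain_height[OF c finite_alive] by auto
  have lt: "u < n" "v < n" using chainD(2)[OF c, of "?h - 1"] chainD(2)[OF c, of "?h - 1 - 1"] h1
    by (auto simp: u_def v_def alive_def)
  define cand where "cand = (\<lambda>z. z < n \<and> arrs ?s deadA z = 0 \<and> z \<noteq> u \<and> z \<noteq> v \<and> (u = v \<or> E v z \<noteq> E u z))"
  have inv1: "loop_inv ?s" "alive ?s = alive s"
    using loop_inv_scan[OF inv, of "{vR, uR}" ?s] by (auto simp: unchanged_def)
  have start: "run iteration Q T s" if "run scan (run (Cond (Eq (Reg foundR) (Const 1)) push merge_twins) Q) (T - 9) ?s" for Q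
    unfolding iteration_def block.simps run_Seq using that T
    by (simp add: Nat.le_diff_conv2 u_def v_def del: One_nat_def)
  show ?thesis
  proof (rule start, rule run_mono[OF scan[where X = "X + 300 * n + 250" and n = n and v = v and u = u and E = E and cand = cand]], goal_cases)
    case 1
    then show ?case using T by simp
  next
    case 2
    then show ?case using inv by (simp add: loop_inv_def)
  next
    case (3 i)
    then show ?case using inv by (simp add: loop_inv_def)
  next
    case (4 i j)
    then show ?case using inv by (simp add: loop_inv_def)
  next
    case (9 z)
    then show ?case by (simp add: cand_def)
  next
    case (10 T1 s1)
    have T1: "T1 \<ge> X + 300 * n + 250" and un: "unchanged {pR, qR, zR, foundR, eR, wR, gR} {} ?s s1"
      and e: "regs s1 eR = of_bool (E u v)" using 10 by blast+
    have inv2: "loop_inv s1" "alive s1 = alive s"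
      using loop_inv_scan[OF inv1(1) un] inv1(2) by auto
    have val: "regs s1 uR = u" "regs s1 vR = v" "regs s1 heightR = ?h" "arrs s1 stackA = ?S"
      using un by (auto simp: unchanged_def)
    have cand: "cand z \<longleftrightarrow> z \<in> alive s \<and> z \<noteq> u \<and> z \<noteq> v \<and> (u = v \<or> E v z \<noteq> E u z)" for z
      by (auto simp: cand_def alive_def)
    have cost: "run (Cond (Eq (Reg foundR) (Const 1)) push merge_twins) Q T1 s1"
      if "if regs s1 foundR = 1 then run push Q (T1 - 4) s1 else run merge_twins Q (T1 - 4) s1" for Q
      using that T1 by (cases "regs s1 foundR = 1") (simp_all del: One_nat_def)
    show ?case
    proof (cases "\<exists>z. cand z")
      case True
      then have f: "regs s1 foundR = 1" "cand (regs s1 wR)" "regs s1 gR = of_bool (E u (regs s1 wR))"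
        using 10 by auto
      have "run push (\<lambda>T' s'. T' \<ge> X \<and> loop_inv s' \<and> alive s' = alive s1 \<and>
         regs s' heightR = Suc (regs s1 heightR)) (T1 - 4) s1"
      proof (rule push[OF _ inv2(1)])
        show "X + 40 \<le> T1 - 4" using T1 by simp
      qed (use f e cand inv2 val in \<open>auto simp: u_def v_def\<close>)
      then have "run push (\<lambda>T' s'. T' \<ge> X \<and> loop_inv s' \<and>
         2 * card (alive s') - regs s' heightR < 2 * card (alive s) - ?h) (T1 - 4) s1"
        by (rule run_mono) (use val inv2 h1 k in auto)
      then show ?thesis by (intro cost) (simp add: f(1))
    next
      case False
      then have f: "regs s1 foundR = 0" using 10 by auto
      \<comment> \<open>On a stack of height 1 every other survivor is a candidate, and there is
        one. So a fruitless scan means that the two top entries are distinct, hence twins.\<close>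
      have "?h \<noteq> 1"
      proof
        assume "?h = 1"
        then have "u = v" by (simp add: u_def v_def)
        have "\<not> alive s \<subseteq> {u}"
          using k card_mono[of "{u}" "alive s"] by auto
        then obtain z where "z \<in> alive s" "z \<noteq> u" by blast
        then have "cand z" using cand \<open>u = v\<close> by simp
        with False show False by blast
      qed
      with h1 have "?h = Suc (Suc (?h - 2))" by simp
    then obtain m where m: "?h = Suc (Suc m)" by blast
      have uv: "u = ?S (Suc m)" "v = ?S m" by (simp_all add: u_def v_def m)
      have ne: "u \<noteq> v" using chainD(3)[OF c, of m "Suc m"] m uv by simp
      have tw: "E v z = E u z" if "z \<in> alive s" "z \<noteq> u" "z \<noteq> v" for z
        using False cand[of z] that ne by blast
      have "run merge_twins (\<lambda>T' s'. T' \<ge> X \<and> loop_inv s' \<and> alive s' = alive s1 - {regs s1 uR} \<and>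
         regs s' heightR = Suc m \<and> regs s1 uR \<in> alive s1) (T1 - 4) s1"
      proof (rule merge_step[OF _ inv2(1)])
        show "X + 300 * n + 200 \<le> T1 - 4" using T1 by simp
      qed (use e val inv2 m uv tw in auto)
      then have "run merge_twins (\<lambda>T' s'. T' \<ge> X \<and> loop_inv s' \<and>
         2 * card (alive s') - regs s' heightR < 2 * card (alive s) - ?h) (T1 - 4) s1"
      proof (rule run_mono)
        fix T' s' assume q: "T' \<ge> X \<and> loop_inv s' \<and> alive s' = alive s1 - {regs s1 uR} \<and>
         regs s' heightR = Suc m \<and> regs s1 uR \<in> alive s1"
        then have "card (alive s') = card (alive s) - 1" using inv2 finite_alive by simp
        then show "T' \<ge> X \<and> loop_inv s' \<and>
         2 * card (alive s') - regs s' heightR < 2 * card (alive s) - ?h"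
          using q m h1 k by simp
      qed
      then show ?thesis by (intro cost) (simp add: f)
    qed
  qed (use lt in simp_all)
qed

text \<open>Zeros are a valid start: all vertices are living leaves of class 0, the trie consists of
  its roots, and vertex 0 forms the stack.\<close>

lemma loop_inv_initial:
  assumes n: "0 < n" and s: "regs s nR = n" "regs s aliveR = n" "regs s heightR = 1" "regs s countR = 1" "regs s freshR = 3"
    and off: "\<forall>i<n. arrs s offA i = i * n"
    and mat: "\<And>i j. i < n \<Longrightarrow> j < n \<Longrightarrow> arrs s matA (i * n + j) = of_bool (E i j)"
    and z: "\<And>a i. a \<notin> {matA, offA} \<Longrightarrow> arrs s a i = 0"
  shows "loop_inv s" "alive s = {..<n}"
proof -
  show al: "alive s = {..<n}" using z by (auto simp: alive_def)
  define key :: "nat \<Rightarrow> key" where "key = (\<lambda>x. (x = 2, [], 0))"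
  have "trie 3 (\<lambda>b. arrs s (if b then rightA else downA)) key"
  proof -
    have 12: "{1..<3} = {1, 2::nat}" by auto
    have "step_key b k \<notin> key ` {1..<3}" for b k
    proof
      assume "step_key b k \<in> key ` {1..<3}"
      then obtain x :: nat where "step_key b k = (x = 2, [], 0)" unfolding key_def by blast
      with step_key_root show False by blast
    qed
    moreover have "inj_on key {1..<3}" unfolding 12 by (simp add: key_def)
    ultimately show ?thesis unfolding trie_def using z by (simp add: key_def)
  qed
  then have tr: "trie_state s key" using s by (simp add: trie_state_def)
  have "table_of n s (\<lambda>_. Leaf) key"
    unfolding class_table_def using z s swappable_Leaf by (auto simp: inj_on_def)
  moreover have "label_of n s (\<lambda>_. Leaf) v Leaf" for v
    unfolding labelled_def using z s by simp
  ultimately have "labels_ok s (\<lambda>_. Leaf)"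
    unfolding labels_ok_def using tr by blast
  moreover have "modules {..<n} (alive s) (\<lambda>v. {v}) (\<lambda>_. Leaf)"
    unfolding al by (rule modules_initial)
  moreover have "chain (alive s) (arrs s stackA) (regs s heightR)"
    using z n s unfolding al by (simp add: chain_def)
  ultimately show "loop_inv s" unfolding loop_inv_def using s off mat al by auto
qed

lemma decide_swappable:
  assumes n: "0 < n" and T: "T \<ge> 1000 * n * n + 1000 * n + 100"
    and s: "regs s nR = n"
    and mat: "\<And>i j. i < n \<Longrightarrow> j < n \<Longrightarrow> arrs s matA (i * n + j) = of_bool (E i j)"
    and z: "\<And>a i. a \<noteq> matA \<Longrightarrow> arrs s a i = 0"
  shows "run decide_swappable (\<lambda>T' s'. \<exists>t. represents {..<n} t \<and> regs s' outR = of_bool (swappable t)) T s"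
    (is "run _ ?Q _ _")
proof -
  \<comment> \<open>Credits left after \<open>init_offsets\<close>. They cover \<open>2 * n\<close>
    rounds of \<open>400 * n + 410\<close> credits, loop test included, with a margin.\<close>
  let ?X = "900 * n * n + 900 * n + 60"
  have loop: "run (While (Lt (Const 1) (Reg aliveR)) iteration)
      (\<lambda>T' s'. T' \<ge> 10 \<and> loop_inv s' \<and> card (alive s') \<le> 1) T2 s2"
    if T2: "T2 \<ge> 2 * n * (400 * n + 410) + 20" and inv: "loop_inv s2" "alive s2 = {..<n}" for T2 s2
  proof (rule run_While[where I = "\<lambda>T s'. loop_inv s' \<and>
       T \<ge> 20 + (2 * card (alive s') - regs s' heightR) * (400 * n + 410)"], goal_cases)
    case 1
    have "(2 * card (alive s2) - regs s2 heightR) * (400 * n + 410) \<le> 2 * n * (400 * n + 410)"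
      by (rule mult_le_mono1) (simp add: inv(2))
    then have "T2 \<ge> 20 + (2 * card (alive s2) - regs s2 heightR) * (400 * n + 410)"
      using T2 by linarith
    then show ?case using inv(1) by blast
  next
    case (2 T s')
    then show ?case by simp
  next
    case (3 T s')
    then have inv: "loop_inv s'" and k: "card (alive s') > 1" by (auto simp: loop_inv_def)
    define d where "d = 2 * card (alive s') - regs s' heightR"
    have "chain (alive s') (arrs s' stackA) (regs s' heightR)" using inv by (simp add: loop_inv_def)
    then have "regs s' heightR \<le> card (alive s')" using chain_height finite_alive by blast
    then have "d \<ge> 1" using k by (simp add: d_def)
    then obtain d' where d': "d = Suc d'" by (cases d) auto
    have T: "T \<ge> 20 + d' * (400 * n + 410) + (400 * n + 410)" using 3 d' unfolding d_def[symmetric] by simp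
    show ?case
    proof (rule run_mono[OF iteration[where X = "20 + d' * (400 * n + 410)"]], goal_cases)
      case (4 T' s'')
      then have "2 * card (alive s'') - regs s'' heightR \<le> d'" using d' unfolding d_def by simp
      then have "(2 * card (alive s'') - regs s'' heightR) * (400 * n + 410) \<le> d' * (400 * n + 410)"
        by (rule mult_le_mono1)
      moreover have "20 + d' * (400 * n + 410) \<le> T'" using 4 by blast
      ultimately have "20 + (2 * card (alive s'') - regs s'' heightR) * (400 * n + 410) \<le> T'" by linarith
      then show ?case using 4 by blast
    qed (use T inv k in simp_all)
  next
    case (4 T s')
    then have t: "T \<ge> 20" and inv: "loop_inv s'" and k: "\<not> 1 < regs s' aliveR" by auto
    have "10 \<le> T - (1 + test_cost (Lt (Const 1) (Reg aliveR)))" using t by simp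
    moreover have "card (alive s') \<le> 1" using inv k by (simp add: loop_inv_def)
    ultimately show ?case using inv by blast
  qed
  show ?thesis unfolding decide_swappable_def block.simps run_Seq
  proof (rule run_mono[OF init_offsets[where X = ?X and n = n]], goal_cases)
    case 1
    then show ?case using T by simp
  next
    case 2
    then show ?case using s .
  next
    case (3 T1 s1)
    let ?s2 = "s1\<lparr>regs := (regs s1)(aliveR := n, heightR := 1, countR := 1, freshR := 3)\<rparr>"
    have s1: "T1 \<ge> ?X" "unchanged {zR, pR, cR} {offA} s s1" "\<forall>i<n. arrs s1 offA i = i * n" using 3 by blast+
    have n1: "regs s1 nR = n" using s1(2) s by (simp add: unchanged_def)
    have a1: "arrs s1 a = arrs s a" if "a \<noteq> offA" for a using s1(2) that by (simp add: unchanged_def)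
    have inv: "loop_inv ?s2" "alive ?s2 = {..<n}"
      using loop_inv_initial[of ?s2] n n1 s1(3) mat z a1 by auto
    have fin: "run (Assign outR (Read swapA (Read classA (Read stackA (Const 0))))) ?Q T3 s3"
      if "T3 \<ge> 10" "loop_inv s3" "card (alive s3) \<le> 1" for T3 s3
    proof -
      let ?v = "arrs s3 stackA 0"
      have c: "chain (alive s3) (arrs s3 stackA) (regs s3 heightR)" using that by (simp add: loop_inv_def)
      \<comment> \<open>The stack is never empty, so its bottom is the last survivor, whose set is
        the whole graph.\<close>
      have "?v \<in> alive s3" using chainD(1)[OF c] chainD(2)[OF c, of 0] by simp
      moreover have "alive s3 \<subseteq> {?v}"
      proof
        fix x assume "x \<in> alive s3"
        then have "card {x, ?v} \<le> card (alive s3)" using \<open>?v \<in> alive s3\<close> finite_alive by (intro card_mono) auto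
        then show "x \<in> {?v}" using that(3) by (cases "x = ?v") auto
      qed
      ultimately have al: "alive s3 = {?v}" by blast
      from that(2) obtain lab md where lm: "labels_ok s3 lab" "modules {..<n} (alive s3) md lab"
        unfolding loop_inv_def by blast
      then obtain tree_of key where k: "table_of n s3 tree_of key" "label_of n s3 tree_of ?v (lab ?v)"
        unfolding labels_ok_def al by blast
      have md: "represents (md ?v) (lab ?v)" "md ?v = {..<n}"
        using lm(2) unfolding al modules_def by (blast, simp)
      have "represents {..<n} (lab ?v)" using md(1) unfolding md(2) .
      moreover have "arrs s3 swapA (arrs s3 classA ?v) = of_bool (swappable (lab ?v))"
        using k unfolding class_table_def labelled_def by auto
      ultimately show ?thesis using that(1) by auto
    qed
    have main: "run (While (Lt (Const 1) (Reg aliveR)) iteration)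
       (run (Assign outR (Read swapA (Read classA (Read stackA (Const 0))))) ?Q) (T1 - 8) ?s2"
    proof (rule run_mono[OF loop[OF _ inv]])
      show "2 * n * (400 * n + 410) + 20 \<le> T1 - 8" using s1(1) n by (simp add: algebra_simps)
    qed (use fin in blast)
    have step: "run (Assign aliveR (Reg nR)) (run (Assign heightR (Const 1)) (run (Assign countR (Const 1))
        (run (Assign freshR (Const 3)) R))) T1 s1" if "R (T1 - 8) ?s2" for R
      using that s1(1) n1 by (simp add: Nat.le_diff_conv2 del: One_nat_def)
    show ?case by (rule step, rule main)
  qed
qed

end

section \<open>The Perron vector of a connected graph\<close>

text \<open>Connectedness as a closure principle. It is applied to the zero set of an eigenvector
  and to the set of vertices heavier than their partners.\<close>

locale connected_graph = simple_graph E for E :: "nat \<Rightarrow> nat \<Rightarrow> bool" +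
  fixes n :: nat
  assumes n_pos: "0 < n"
    and connected: "\<And>S. S \<subseteq> {..<n} \<Longrightarrow> S \<noteq> {} \<Longrightarrow> (\<And>x y. x \<in> S \<Longrightarrow> y < n \<Longrightarrow> E x y \<Longrightarrow> y \<in> S) \<Longrightarrow> S = {..<n}"
begin

definition adj :: "nat \<Rightarrow> nat \<Rightarrow> real" where
  "adj i j = of_bool (E i j)"

definition app :: "(nat \<Rightarrow> real) \<Rightarrow> nat \<Rightarrow> real" where
  "app x i = (\<Sum>j<n. adj i j * x j)"

definition form :: "(nat \<Rightarrow> real) \<Rightarrow> real" where
  "form x = (\<Sum>i<n. x i * app x i)"

definition sqn :: "(nat \<Rightarrow> real) \<Rightarrow> real" where
  "sqn x = (\<Sum>i<n. (x i)\<^sup>2)"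

lemma adj_sym: "adj i j = adj j i"
  using E_sym by (simp add: adj_def)

lemma adj_nonneg: "0 \<le> adj i j"
  by (simp add: adj_def)

lemma app_symmetric: "(\<Sum>i<n. y i * app x i) = (\<Sum>i<n. x i * app y i)"
proof -
  have "(\<Sum>i<n. y i * app x i) = (\<Sum>i<n. \<Sum>j<n. y i * (adj i j * x j))"
    by (simp add: app_def sum_distrib_left)
  also have "\<dots> = (\<Sum>j<n. \<Sum>i<n. y i * (adj i j * x j))" by (rule sum.swap)
  also have "\<dots> = (\<Sum>j<n. \<Sum>i<n. x j * (adj j i * y i))"
    by (intro sum.cong refl) (use adj_sym in \<open>simp add: mult_ac\<close>)
  finally show ?thesis by (simp add: app_def sum_distrib_left)
qed

lemma app_linear: "app (\<lambda>i. x i + t * y i) i = app x i + t * app y i"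
  by (simp add: app_def algebra_simps sum.distrib sum_distrib_left)

lemma form_perturb:
  "form (\<lambda>i. x i + t * y i) = form x + 2 * t * (\<Sum>i<n. y i * app x i) + t\<^sup>2 * form y"
proof -
  have "form (\<lambda>i. x i + t * y i) =
      (\<Sum>i<n. x i * app x i + t * (x i * app y i) + t * (y i * app x i) + t\<^sup>2 * (y i * app y i))"
    unfolding form_def app_linear by (intro sum.cong refl) (simp add: algebra_simps power2_eq_square)
  also have "\<dots> = form x + t * (\<Sum>i<n. x i * app y i) + t * (\<Sum>i<n. y i * app x i) + t\<^sup>2 * form y"
    by (simp add: sum.distrib sum_distrib_left form_def)
  finally show ?thesis by (simp add: app_symmetric[of x y])
qed

lemma sqn_perturb:
  "sqn (\<lambda>i. x i + t * y i) = sqn x + 2 * t * (\<Sum>i<n. y i * x i) + t\<^sup>2 * sqn y"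
proof -
  have "sqn (\<lambda>i. x i + t * y i) = (\<Sum>i<n. (x i)\<^sup>2 + 2 * t * (y i * x i) + t\<^sup>2 * (y i)\<^sup>2)"
    unfolding sqn_def by (intro sum.cong refl) (simp add: algebra_simps power2_eq_square)
  then show ?thesis by (simp add: sqn_def sum.distrib sum_distrib_left)
qed

lemma form_abs: "form x \<le> form (\<lambda>i. \<bar>x i\<bar>)"
  unfolding form_def app_def sum_distrib_left
proof (intro sum_mono)
  fix i j
  have "x i * (adj i j * x j) = adj i j * (x i * x j)" by simp
  also have "\<dots> \<le> adj i j * \<bar>x i * x j\<bar>" by (intro mult_left_mono adj_nonneg) simp
  also have "\<dots> = \<bar>x i\<bar> * (adj i j * \<bar>x j\<bar>)" by (simp add: abs_mult)
  finally show "x i * (adj i j * x j) \<le> \<bar>x i\<bar> * (adj i j * \<bar>x j\<bar>)" .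
qed

text \<open>Vectors are functions on all of \<open>nat\<close> that vanish from \<open>n\<close> on,
  so compactness can be drawn from the product topology.\<close>

definition sphere :: "(nat \<Rightarrow> real) set" where
  "sphere = {x. (\<forall>i\<ge>n. x i = 0) \<and> sqn x = 1}"

lemma compact_sphere: "compact sphere"
proof -
  define B where "B = (\<lambda>i. if i < n then {-1..1} else {0::real})"
  have "compactin (product_topology (\<lambda>i. euclidean) UNIV) (PiE UNIV B)"
    unfolding compactin_PiE by (auto simp: B_def)
  then have c: "compact (PiE UNIV B)"
    by (simp add: euclidean_product_topology)
  have "continuous_on UNIV sqn"
    unfolding sqn_def by (intro continuous_intros) simp
  then have "closed (sqn -` {1})" by (intro closed_vimage) auto
  with c have "compact (PiE UNIV B \<inter> sqn -` {1})" by (rule compact_Int_closed)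
  moreover have "sphere = PiE UNIV B \<inter> sqn -` {1}"
  proof (intro equalityI subsetI)
    fix x assume x: "x \<in> sphere"
    have "x i \<in> {-1..1}" if "i < n" for i
    proof -
      have "(x i)\<^sup>2 \<le> sqn x" unfolding sqn_def using that by (intro member_le_sum) auto
      then have "(x i)\<^sup>2 \<le> 1" using x by (simp add: sphere_def)
      then show ?thesis by (simp add: abs_square_le_1 abs_le_iff)
    qed
    then show "x \<in> PiE UNIV B \<inter> sqn -` {1}" using x by (auto simp: sphere_def B_def)
  next
    fix x assume x: "x \<in> PiE UNIV B \<inter> sqn -` {1}"
    then have "x i \<in> B i" for i by auto
    then have "x i = 0" if "i \<ge> n" for i using that by (metis B_def singletonD not_le)
    then show "x \<in> sphere" using x by (simp add: sphere_def)
  qed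
  ultimately show ?thesis by simp
qed

definition eigen :: "real \<Rightarrow> (nat \<Rightarrow> real) \<Rightarrow> bool" where
  "eigen l x \<longleftrightarrow> (\<forall>i<n. app x i = l * x i)"

text \<open>At a zero of \<open>x\<close> the nonnegative entries of the neighbours sum to 0. The
  zero set is thus closed under neighbours, hence empty or everything.\<close>

lemma eigen_positive:
  assumes e: "eigen l x" and nn: "\<And>i. i < n \<Longrightarrow> 0 \<le> x i" and z: "i < n" "x i \<noteq> 0"
  shows "\<forall>i<n. 0 < x i"
proof -
  define S where "S = {i. i < n \<and> x i = 0}"
  have "S = {}"
  proof (rule ccontr)
    assume "S \<noteq> {}"
    have "S = {..<n}"
    proof (rule connected)
      fix i j assume i: "i \<in> S" and j: "j < n" and E: "E i j"
      have "(\<Sum>k<n. adj i k * x k) = 0" using e i by (simp add: eigen_def app_def S_def)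
      then have "adj i j * x j = 0"
        using sum_nonneg_eq_0_iff[of "{..<n}" "\<lambda>k. adj i k * x k"] nn adj_nonneg j by simp
      then show "j \<in> S" using E j by (simp add: adj_def S_def)
    qed (use \<open>S \<noteq> {}\<close> in \<open>auto simp: S_def\<close>)
    then show False using z by (auto simp: S_def)
  qed
  then show ?thesis using nn by (force simp: S_def)
qed

text \<open>Take a maximiser of the form on the unit sphere. Absolute values do not decrease the
  form, so the maximiser may be chosen nonnegative and is then positive. The bound for all
  \<open>y\<close> will make \<open>l\<close> the largest eigenvalue.\<close>

lemma perron_exists:
  "\<exists>l x. eigen l x \<and> (\<forall>i<n. 0 < x i) \<and> (\<forall>y. form y \<le> l * sqn y)"
proof -
  define e0 where "e0 = (\<lambda>i::nat. of_bool (i = 0) :: real)"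
  have "sqn e0 = 1"
  proof -
    have "sqn e0 = (\<Sum>i<n. if i = 0 then 1 else 0)"
      unfolding sqn_def e0_def by (intro sum.cong) auto
    then show ?thesis using n_pos by simp
  qed
  then have "e0 \<in> sphere" using n_pos by (auto simp: sphere_def e0_def)
  have "continuous_on sphere form"
    unfolding form_def app_def by (intro continuous_intros) (auto intro: continuous_on_subset[OF continuous_on_product_coordinates])
  then obtain x0 where x0: "x0 \<in> sphere" "\<And>y. y \<in> sphere \<Longrightarrow> form y \<le> form x0"
    using continuous_attains_sup[OF compact_sphere] \<open>e0 \<in> sphere\<close> by blast
  define x where "x = (\<lambda>i. \<bar>x0 i\<bar>)"
  have xs: "x \<in> sphere" using x0(1) by (simp add: sphere_def x_def sqn_def)
  define l where "l = form x"
  have max: "form y \<le> l" if "y \<in> sphere" for y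
    using x0(2)[OF that] form_abs[of x0] by (simp add: l_def x_def)
  have bound: "form y \<le> l * sqn y" for y
  proof (cases "sqn y = 0")
    case True
    then have "\<forall>i<n. y i = 0" by (simp add: sqn_def sum_nonneg_eq_0_iff)
    then have "form y = 0" by (simp add: form_def)
    with True show ?thesis by simp
  next
    case False
    then have pos: "0 < sqn y" unfolding sqn_def by (metis sum_nonneg zero_le_power2 less_eq_real_def)
    define s where "s = sqrt (sqn y)"
    have s: "s > 0" "s\<^sup>2 = sqn y" using pos by (auto simp: s_def)
    define z where "z = (\<lambda>i. if i < n then y i / s else 0)"
    have "sqn z = (\<Sum>i<n. (y i)\<^sup>2) / s\<^sup>2"
      unfolding sqn_def z_def sum_divide_distrib by (intro sum.cong refl) (simp add: power_divide)
    then have "sqn z = 1" using s pos by (simp add: sqn_def[symmetric])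
    then have "z \<in> sphere" by (simp add: sphere_def z_def)
    have "app z i = app y i / s" for i
      unfolding app_def z_def sum_divide_distrib by (intro sum.cong refl) simp
    then have "form z = form y / s\<^sup>2"
      unfolding form_def sum_divide_distrib by (intro sum.cong refl) (simp add: z_def power2_eq_square)
    with max[OF \<open>z \<in> sphere\<close>] s pos show ?thesis by (simp add: divide_le_eq)
  qed
  have "eigen l x" unfolding eigen_def
  proof (intro allI impI)
    fix k assume k: "k < n"
    define d where "d = (\<lambda>i. of_bool (i = k) :: real)"
    have sd: "(\<Sum>i<n. d i * f i) = f k" for f
      using k by (simp add: d_def of_bool_def if_distrib[of "\<lambda>a. a * _"] cong: if_cong)
    have "app d k = adj k k"
      unfolding app_def using sd[of "adj k"] by (simp add: mult.commute)
    then have "app d k = 0" using E_irrefl by (simp add: adj_def)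
    then have fd: "form d = 0" unfolding form_def sd .
    have qd: "sqn d = 1" unfolding sqn_def using sd[of d] by (simp add: power2_eq_square d_def)
    define c where "c = app x k - l * x k"
    have sx: "sqn x = 1" using xs by (simp add: sphere_def)
    (* first-order condition at the maximiser \<open>x\<close> of the Rayleigh quotient *)
    have le: "2 * t * c \<le> l * t\<^sup>2" for t
    proof -
      have "form (\<lambda>i. x i + t * d i) \<le> l * sqn (\<lambda>i. x i + t * d i)" by (rule bound)
      then show ?thesis unfolding form_perturb sqn_perturb sd fd qd sx l_def[symmetric]
        by (simp add: c_def algebra_simps)
    qed
    \<comment> \<open>With \<open>t = c / m\<close>, where \<open>m\<close> is positive and at least
      \<open>l\<close>, the inequality bounds twice \<open>c * c / m\<close> by
      \<open>c * c / m\<close>, so \<open>c\<close> is 0.\<close>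
    define m where "m = \<bar>l\<bar> + 1"
    have m: "m > 0" "l \<le> m" by (auto simp: m_def)
    have "2 * (c / m) * c \<le> l * (c / m)\<^sup>2" by (rule le)
    also have "\<dots> \<le> m * (c / m)\<^sup>2" using m by (intro mult_right_mono) auto
    also have "\<dots> = c\<^sup>2 / m" using m by (simp add: power2_eq_square)
    finally have "2 * c\<^sup>2 / m \<le> c\<^sup>2 / m" by (simp add: power2_eq_square)
    then have "c\<^sup>2 / m \<le> 0" by simp
    then have "c\<^sup>2 \<le> 0" using m by (simp add: divide_le_0_iff)
    then show "app x k = l * x k" by (simp add: c_def)
  qed
  moreover have "\<exists>i<n. x i \<noteq> 0"
  proof (rule ccontr)
    assume "\<not> ?thesis"
    then have "sqn x = 0" by (simp add: sqn_def)
    then show False using xs by (simp add: sphere_def)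
  qed
  ultimately have "\<forall>i<n. 0 < x i" using eigen_positive[of l x] by (auto simp: x_def)
  with \<open>eigen l x\<close> bound show ?thesis by blast
qed

text \<open>Subtract the largest multiple of \<open>y\<close> that keeps \<open>x\<close>
  nonnegative. The difference satisfies the eigenvalue equation and has a zero entry, so
  \<open>eigen_positive\<close> makes it vanish.\<close>

lemma eigen_proportional:
  assumes "eigen l x" "eigen l y" "\<forall>i<n. 0 < x i" "\<forall>i<n. 0 < y i"
  shows "\<exists>t>0. \<forall>i<n. x i = t * y i"
proof -
  define t where "t = Min ((\<lambda>i. x i / y i) ` {..<n})"
  have ne: "(\<lambda>i. x i / y i) ` {..<n} \<noteq> {}" using n_pos by auto
  have "t \<in> (\<lambda>i. x i / y i) ` {..<n}" unfolding t_def by (intro Min_in) (use ne in auto)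
  then obtain k where k: "k < n" "t = x k / y k" by auto
  have t: "t > 0" using k assms by simp
  define z where "z = (\<lambda>i. x i + (- t) * y i)"
  have "eigen l z" using assms(1,2) unfolding eigen_def z_def app_linear by (simp add: algebra_simps)
  have nn: "0 \<le> z i" if "i < n" for i
  proof -
    have "t \<le> x i / y i" unfolding t_def using that by (intro Min_le) auto
    then show ?thesis using assms(4) that by (simp add: z_def pos_le_divide_eq)
  qed
  have "y k \<noteq> 0" using assms(4) k(1) by (simp add: less_imp_neq[symmetric])
  then have "z k = 0" using k by (simp add: z_def)
  then have "z i = 0" if "i < n" for i
    using eigen_positive[OF \<open>eigen l z\<close> nn that] k(1) by fastforce
  then show ?thesis using t by (intro exI[of _ t]) (auto simp: z_def)
qed

end

section \<open>The Perron vector of the adjacency matrix\<close>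

locale graph_on = connected_graph E n for E n +
  fixes G :: "nat pair_pre_digraph"
  assumes verts: "pverts G = {..<n}" and arcs: "\<And>i j. (i, j) \<in> parcs G \<longleftrightarrow> E i j"
begin

lemma A_carrier: "adjacency_matrix G \<in> carrier_mat n n"
  by (simp add: adjacency_matrix_def verts)

lemma A_mult:
  assumes "v \<in> carrier_vec n" "i < n"
  shows "(adjacency_matrix G *\<^sub>v v) $ i = app (\<lambda>j. v $ j) i"
proof -
  have "(adjacency_matrix G *\<^sub>v v) $ i = (\<Sum>j<n. adjacency_matrix G $$ (i, j) * v $ j)"
    using assms A_carrier by (simp add: scalar_prod_def lessThan_atLeast0)
  also have "\<dots> = app (\<lambda>j. v $ j) i" unfolding app_def
    by (intro sum.cong refl) (use assms in \<open>simp add: adjacency_matrix_def verts arcs adj_def\<close>)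
  finally show ?thesis .
qed

lemma eigenvector_iff:
  "eigenvector (adjacency_matrix G) v l \<longleftrightarrow>
     v \<in> carrier_vec n \<and> (\<exists>i<n. v $ i \<noteq> 0) \<and> eigen l (\<lambda>i. v $ i)"
proof -
  have "dim_row (adjacency_matrix G) = n" using A_carrier by simp
  moreover have "v \<noteq> 0\<^sub>v n \<longleftrightarrow> (\<exists>i<n. v $ i \<noteq> 0)" if "v \<in> carrier_vec n"
    using that by (auto intro!: eq_vecI)
  moreover have "adjacency_matrix G *\<^sub>v v = l \<cdot>\<^sub>v v \<longleftrightarrow> eigen l (\<lambda>i. v $ i)" if v: "v \<in> carrier_vec n"
  proof
    assume "adjacency_matrix G *\<^sub>v v = l \<cdot>\<^sub>v v"
    then show "eigen l (\<lambda>i. v $ i)" unfolding eigen_def using A_mult[OF v] v by auto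
  next
    assume "eigen l (\<lambda>i. v $ i)"
    then show "adjacency_matrix G *\<^sub>v v = l \<cdot>\<^sub>v v"
      using A_mult[OF v] A_carrier v by (intro eq_vecI) (auto simp: eigen_def)
  qed
  ultimately show ?thesis unfolding eigenvector_def by auto
qed

text \<open>The form of an eigenvector divided by its squared norm is its eigenvalue, so the bound
  on the form caps the whole spectrum by \<open>l\<close>.\<close>

lemma perron_root:
  obtains l x where "Max (spectrum (adjacency_matrix G)) = l" "eigen l x" "\<forall>i<n. 0 < x i"
proof -
  obtain l x where x: "eigen l x" "\<forall>i<n. 0 < x i" "\<And>y. form y \<le> l * sqn y"
    using perron_exists by blast
  have "l \<in> spectrum (adjacency_matrix G)"
  proof -
    have "eigenvector (adjacency_matrix G) (vec n x) l"
      unfolding eigenvector_iff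
    proof (intro conjI)
      show "\<exists>i<n. vec n x $ i \<noteq> 0" using x(2) n_pos by (intro exI[of _ 0]) auto
      have "app (\<lambda>i. vec n x $ i) = app x" unfolding app_def by (intro ext sum.cong) auto
      then show "eigen l (\<lambda>i. vec n x $ i)" using x(1) unfolding eigen_def by simp
    qed simp
    then show ?thesis by (auto simp: spectrum_def eigenvalue_def)
  qed
  moreover have "m \<le> l" if m: "m \<in> spectrum (adjacency_matrix G)" for m
  proof -
    from m obtain v where v: "\<exists>i<n. v $ i \<noteq> 0" "eigen m (\<lambda>i. v $ i)"
      by (auto simp: spectrum_def eigenvalue_def eigenvector_iff)
    let ?y = "\<lambda>i. v $ i"
    have "form ?y = m * sqn ?y"
      unfolding form_def sqn_def sum_distrib_left
      by (intro sum.cong refl) (use v(2) in \<open>simp add: eigen_def power2_eq_square\<close>)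
    moreover have "sqn ?y > 0"
    proof -
      have "sqn ?y \<noteq> 0" using v(1) by (auto simp: sqn_def sum_nonneg_eq_0_iff)
      moreover have "sqn ?y \<ge> 0" unfolding sqn_def by (intro sum_nonneg) simp
      ultimately show ?thesis by simp
    qed
    ultimately show ?thesis using x(3)[of ?y] by simp
  qed
  ultimately have "Max (spectrum (adjacency_matrix G)) = l"
    using card_finite_spectrum(1)[OF A_carrier] by (intro Max_eqI) auto
  with x that show thesis by blast
qed

text \<open>Makes the description definite. Dividing by the minimum gives existence; two solutions
  are proportional, and their common minimum 1 fixes the factor.\<close>

lemma perron_vector:
  defines "P \<equiv> \<lambda>x. eigenvector (adjacency_matrix G) x (Max (spectrum (adjacency_matrix G))) \<and>
             (\<forall>u\<in>pverts G. 0 < x $ u) \<and> Min ((\<lambda>u. x $ u) ` pverts G) = 1"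
  shows "P (perron_vector G)" "\<And>x. P x \<Longrightarrow> x = perron_vector G"
proof -
  obtain l x where l: "Max (spectrum (adjacency_matrix G)) = l" and x: "eigen l x" "\<forall>i<n. 0 < x i"
    using perron_root by blast
  have P: "P v \<longleftrightarrow> v \<in> carrier_vec n \<and> eigen l (\<lambda>i. v $ i) \<and> (\<forall>i<n. 0 < v $ i) \<and>
      Min ((\<lambda>u. v $ u) ` {..<n}) = 1" for v
  proof -
    have "\<exists>i<n. v $ i \<noteq> 0" if "\<forall>i<n. 0 < v $ i" using that n_pos by (intro exI[of _ 0]) auto
    then show ?thesis unfolding P_def l eigenvector_iff verts by auto
  qed
  define m where "m = Min (x ` {..<n})"
  have "m \<in> x ` {..<n}" unfolding m_def using n_pos by (intro Min_in) auto
  then have m: "m > 0" using x(2) by auto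
  define v where "v = vec n (\<lambda>i. x i / m)"
  have vi: "v $ i = x i / m" if "i < n" for i using that by (simp add: v_def)
  have "P v" unfolding P
  proof (intro conjI)
    have "app (\<lambda>i. v $ i) i = app x i / m" for i
      unfolding app_def sum_divide_distrib by (intro sum.cong refl) (simp add: vi)
    then show "eigen l (\<lambda>i. v $ i)" using x(1) vi by (simp add: eigen_def)
    show "\<forall>i<n. 0 < v $ i" using x(2) m vi by simp
    show "Min ((\<lambda>u. v $ u) ` {..<n}) = 1"
    proof (rule Min_eqI)
      show "1 \<in> (\<lambda>u. v $ u) ` {..<n}" using \<open>m \<in> x ` {..<n}\<close> m vi by force
      fix y assume "y \<in> (\<lambda>u. v $ u) ` {..<n}"
      then obtain i where i: "i < n" "y = x i / m" using vi by auto
      have "m \<le> x i" unfolding m_def using i(1) by (intro Min_le) auto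
      then show "1 \<le> y" using i m by simp
    qed simp
  qed (simp add: v_def)
  have unique: "a = b" if a: "P a" and b: "P b" for a b
  proof -
    obtain t where t: "t > 0" "\<forall>i<n. a $ i = t * b $ i"
      using eigen_proportional[of l "\<lambda>i. a $ i" "\<lambda>i. b $ i"] a b unfolding P by blast
    have "Min ((\<lambda>u. a $ u) ` {..<n}) = t"
    proof (rule Min_eqI)
      have bm: "Min ((\<lambda>u. b $ u) ` {..<n}) = 1" using b P by blast
      have "Min ((\<lambda>u. b $ u) ` {..<n}) \<in> (\<lambda>u. b $ u) ` {..<n}" using n_pos by (intro Min_in) auto
      then obtain k where k: "k < n" "b $ k = 1" using bm by auto
      then show "t \<in> (\<lambda>u. a $ u) ` {..<n}" using t by force
      fix y assume "y \<in> (\<lambda>u. a $ u) ` {..<n}"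
      then obtain i where i: "i < n" "y = t * b $ i" using t by auto
      have "1 \<le> b $ i" unfolding bm[symmetric] using i(1) by (intro Min_le) auto
      then show "t \<le> y" using i t by simp
    qed simp
    then have "t = 1" using a P by simp
    then show ?thesis using t a b P by (intro eq_vecI) auto
  qed
  have pv: "perron_vector G = (THE v. P v)" unfolding perron_vector_def P_def ..
  show "P (perron_vector G)" unfolding pv by (rule theI[of P, OF \<open>P v\<close>]) (rule unique[OF _ \<open>P v\<close>])
  then show "x = perron_vector G" if "P x" for x using unique that by blast
qed

lemma perron_positive: "u < n \<Longrightarrow> 0 < perron_vector G $ u"
  using perron_vector(1) verts by auto

lemma perron_automorphism:
  assumes s: "bij_betw s {..<n} {..<n}" and e: "\<And>i j. i < n \<Longrightarrow> j < n \<Longrightarrow> E (s i) (s j) = E i j" and u: "u < n"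
  shows "perron_vector G $ s u = perron_vector G $ u"
proof -
  let ?p = "perron_vector G"
  define v where "v = Matrix.vec n (\<lambda>i. ?p $ s i)"
  have sn: "s i < n" if "i < n" for i using s that by (auto simp: bij_betw_def)
  have p: "eigenvector (adjacency_matrix G) ?p (Max (spectrum (adjacency_matrix G)))"
    "\<forall>u\<in>pverts G. 0 < ?p $ u" "Min ((\<lambda>u. ?p $ u) ` pverts G) = 1"
    using perron_vector(1) by auto
  let ?l = "Max (spectrum (adjacency_matrix G))"
  have vi: "v $ i = ?p $ s i" if "i < n" for i using that by (simp add: v_def)
  have pe: "eigen ?l (\<lambda>i. ?p $ i)" using p(1) by (simp add: eigenvector_iff)
  have "app (\<lambda>i. v $ i) i = app (\<lambda>i. ?p $ i) (s i)" if i: "i < n" for i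
  proof -
    have "app (\<lambda>i. v $ i) i = (\<Sum>j<n. adj (s i) (s j) * ?p $ s j)"
      unfolding app_def by (intro sum.cong refl) (use i e vi in \<open>simp add: adj_def\<close>)
    also have "\<dots> = (\<Sum>j<n. adj (s i) j * ?p $ j)"
      by (rule sum.reindex_bij_betw[OF s])
    finally show ?thesis by (simp add: app_def)
  qed
  then have "eigen ?l (\<lambda>i. v $ i)" using pe sn vi by (simp add: eigen_def)
  moreover have "(\<lambda>u. v $ u) ` {..<n} = (\<lambda>u. ?p $ u) ` (s ` {..<n})"
    using vi by (force simp: image_iff)
  then have "(\<lambda>u. v $ u) ` {..<n} = (\<lambda>u. ?p $ u) ` {..<n}" using s by (simp add: bij_betw_def)
  moreover have pos: "0 < v $ i" if "i < n" for i using that vi sn perron_positive by simp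
  moreover have "\<exists>i<n. v $ i \<noteq> 0" using pos n_pos by (metis less_irrefl)
  ultimately have "v = ?p"
    using p(3) verts by (intro perron_vector(2)) (simp add: eigenvector_iff v_def)
  then show ?thesis using vi[OF u] by simp
qed

end

section \<open>Partitions into pairs and involutions\<close>

lemma partner_function:
  assumes P: "partition_on V P" and two: "\<And>C. C \<in> P \<Longrightarrow> card C = 2"
  obtains f where "\<And>x. x \<in> V \<Longrightarrow> f x \<in> V \<and> f x \<noteq> x \<and> f (f x) = x \<and> {x, f x} \<in> P"
proof -
  have ex: "\<exists>y. y \<noteq> x \<and> {x, y} \<in> P" if x: "x \<in> V" for x
  proof -
    obtain C where C: "C \<in> P" "x \<in> C" using P x by (auto simp: partition_on_def)
    then obtain a b where ab: "C = {a, b}" "a \<noteq> b" using two[of C] by (auto simp: card_2_iff)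
    show ?thesis
    proof (cases "x = a")
      case True
      then show ?thesis using C ab by auto
    next
      case False
      then have "C = {x, a}" "a \<noteq> x" using C ab by auto
      then show ?thesis using C by auto
    qed
  qed
  define f where "f x = (SOME y. y \<noteq> x \<and> {x, y} \<in> P)" for x
  have f: "f x \<noteq> x \<and> {x, f x} \<in> P" if "x \<in> V" for x
    unfolding f_def using someI_ex[OF ex[OF that]] .
  have fV: "f x \<in> V" if "x \<in> V" for x using f[OF that] P by (auto simp: partition_on_def)
  have "f (f x) = x" if x: "x \<in> V" for x
  proof -
    have "{x, f x} = {f x, f (f x)}"
    proof (rule ccontr)
      assume "{x, f x} \<noteq> {f x, f (f x)}"
      moreover have "disjoint P" "{x, f x} \<in> P" "{f x, f (f x)} \<in> P"
        using P f[OF x] f[OF fV[OF x]] by (simp_all add: partition_on_def)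
      ultimately have "{x, f x} \<inter> {f x, f (f x)} = {}" by (meson disjointD)
      then show False by simp
    qed
    then have "f (f x) \<in> {x, f x}" by simp
    then show ?thesis using f[OF fV[OF x]] by blast
  qed
  with f fV show thesis by (intro that[of f]) simp
qed

lemma orbit_partition:
  assumes f: "\<And>x. x \<in> V \<Longrightarrow> f x \<in> V \<and> f x \<noteq> x \<and> f (f x) = x" and fin: "finite V"
  defines "P \<equiv> (\<lambda>x. {x, f x}) ` V"
  shows "partition_on V P" and "\<And>C. C \<in> P \<Longrightarrow> card C = 2" and "2 * card P = card V"
proof -
  show two: "card C = 2" if C: "C \<in> P" for C
  proof -
    obtain x where x: "x \<in> V" "C = {x, f x}" using C unfolding P_def by blast
    have "f x \<noteq> x" using f[OF x(1)] by blast
    then have "x \<noteq> f x" by metis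
    then show ?thesis using x by simp
  qed
  have dis: "{x, f x} = {y, f y}" if "x \<in> V" "y \<in> V" "{x, f x} \<inter> {y, f y} \<noteq> {}" for x y
  proof -
    from that(3) have "x = y \<or> x = f y \<or> f x = y \<or> f x = f y" by blast
    moreover have "f (f x) = x" "f (f y) = y" using f that by blast+
    ultimately show ?thesis by (metis insert_commute)
  qed
  have U: "\<Union>P = V" unfolding P_def using f by blast
  have D: "C \<inter> D = {}" if "C \<in> P" "D \<in> P" "C \<noteq> D" for C D
    using that dis unfolding P_def by blast
  show "partition_on V P"
    unfolding partition_on_def disjoint_def
  proof (intro conjI ballI impI)
    show "\<Union>P = V" by (rule U)
    show "{} \<notin> P" unfolding P_def by blast
  qed (rule D)
  have "2 * card P = card (\<Union>P)"
    by (rule card_partition) (use fin two D U in \<open>simp_all add: P_def\<close>)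
  then show "2 * card P = card V" by (simp only: U)
qed

context graph_on
begin

lemma into_pairs_iff:
  "into_pairs G P \<longleftrightarrow> real (card P) = real n / 2 \<and> (\<forall>C\<in>P. card C = 2)"
  by (simp add: into_pairs_def verts)

lemma neighbours_pair:
  assumes "v \<noteq> w"
  shows "neighbours_in G {v, w} u = (if E u v then {v} else {}) \<union> (if E u w then {w} else {})"
  using assms by (auto simp: neighbours_in_def arcs)

lemma neighbours_image:
  assumes f: "\<And>x. x < n \<Longrightarrow> f x < n \<and> f (f x) = x" "\<And>x y. x < n \<Longrightarrow> y < n \<Longrightarrow> E (f x) (f y) = E x y"
    and D: "D \<subseteq> {..<n}" "f ` D = D" and u: "u < n"
  shows "neighbours_in G D (f u) = f ` neighbours_in G D u"
proof (intro equalityI subsetI)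
  fix v assume v: "v \<in> neighbours_in G D (f u)"
  then have vD: "v \<in> D" "v < n" "E (f u) v" using D(1) by (auto simp: neighbours_in_def arcs)
  then have "f v \<in> D" using D(2) by blast
  moreover have "E u (f v)" using f(2)[of u "f v"] f(1)[of v] vD u by simp
  ultimately have "f v \<in> neighbours_in G D u" by (simp add: neighbours_in_def arcs)
  moreover have "v = f (f v)" using f(1)[of v] vD by simp
  ultimately show "v \<in> f ` neighbours_in G D u" by (rule rev_image_eqI)
next
  fix v assume "v \<in> f ` neighbours_in G D u"
  then obtain w where w: "v = f w" "w \<in> D" "E u w" by (auto simp: neighbours_in_def arcs)
  then have "w < n" using D(1) by auto
  then have "E (f u) v" using f(2)[of u w] u w by simp
  moreover have "v \<in> D" using w D(2) by blast
  ultimately show "v \<in> neighbours_in G D (f u)" by (simp add: neighbours_in_def arcs)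
qed

text \<open>Common ground for both kinds of partition. Each cell is an orbit and thus mapped to
  itself, so \<open>f\<close> carries the neighbours of \<open>u\<close> in a cell to those of
  \<open>f u\<close> in the same cell.\<close>

lemma involution_cells:
  assumes "fpf_involution f {..<n}"
  defines "P \<equiv> (\<lambda>x. {x, f x}) ` {..<n}"
  shows "partition_on {..<n} P" "into_pairs G P"
    and "\<And>C D u u'. C \<in> P \<Longrightarrow> D \<in> P \<Longrightarrow> u \<in> C \<Longrightarrow> u' \<in> C \<Longrightarrow> u' \<noteq> u \<Longrightarrow>
       u < n \<and> u' = f u \<and> inj_on f (neighbours_in G D u) \<and> neighbours_in G D u' = f ` neighbours_in G D u"
    and "bij_betw f {..<n} {..<n}" "\<And>i j. i < n \<Longrightarrow> j < n \<Longrightarrow> E (f i) (f j) = E i j"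
    and "\<And>D v u. D \<in> P \<Longrightarrow> v \<in> neighbours_in G D u \<Longrightarrow> v < n"
proof -
  note d = assms(1)[unfolded fpf_involution_def]
  have f: "f x \<in> {..<n} \<and> f x \<noteq> x \<and> f (f x) = x" if "x \<in> {..<n}" for x using d that by blast
  show e: "E (f i) (f j) = E i j" if "i < n" "j < n" for i j using d that by simp
  have fn: "f x < n \<and> f (f x) = x" if "x < n" for x using f[of x] that by simp
  show part: "partition_on {..<n} P" unfolding P_def by (rule orbit_partition(1)[OF f]) simp_all
  have "2 * card P = n" unfolding P_def using orbit_partition(3)[OF f] by simp
  then have "real (card P) = real n / 2" by linarith
  moreover have "\<forall>C\<in>P. card C = 2" unfolding P_def using orbit_partition(2)[OF f] by blast
  ultimately show "into_pairs G P" unfolding into_pairs_iff by blast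
  have inj: "inj_on f {..<n}" by (rule inj_on_inverseI[of _ f]) (use f in blast)
  have "f ` {..<n} = {..<n}"
  proof (intro equalityI subsetI)
    fix x assume x: "x \<in> {..<n}"
    then have "f x \<in> {..<n}" "x = f (f x)" using f[of x] by simp_all
    then show "x \<in> f ` {..<n}" by (rule rev_image_eqI)
  qed (use f in blast)
  then show "bij_betw f {..<n} {..<n}" using inj by (simp add: bij_betw_def)
  have sub: "D \<subseteq> {..<n}" if "D \<in> P" for D using that f unfolding P_def by blast
  show "v < n" if "D \<in> P" "v \<in> neighbours_in G D u" for D v u
    using that sub unfolding neighbours_in_def by blast
  show "u < n \<and> u' = f u \<and> inj_on f (neighbours_in G D u) \<and> neighbours_in G D u' = f ` neighbours_in G D u"
    if C: "C \<in> P" and D: "D \<in> P" and u: "u \<in> C" "u' \<in> C" "u' \<noteq> u" for C D u u'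
  proof -
    have un: "u < n" using sub[OF C] u by auto
    obtain x where x: "x \<in> {..<n}" "C = {x, f x}" using C unfolding P_def by blast
    have "f (f x) = x" using f[OF x(1)] by blast
    then have u': "u' = f u" using u x(2) by auto
    obtain y where y: "y \<in> {..<n}" "D = {y, f y}" using D unfolding P_def by blast
    have "f (f y) = y" using f[OF y(1)] by blast
    then have "f ` D = D" using y(2) by auto
    moreover have "neighbours_in G D u \<subseteq> {..<n}" using sub[OF D] by (auto simp: neighbours_in_def)
    then have "inj_on f (neighbours_in G D u)" by (rule inj_on_subset[OF inj])
    ultimately show ?thesis using neighbours_image[OF fn e sub[OF D] _ un] un u' by simp
  qed
qed

lemma involution_imp_equitable:
  assumes "fpf_involution f {..<n}"
  shows "\<exists>P. equitable_partition G P \<and> into_pairs G P"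
proof -
  let ?P = "(\<lambda>x. {x, f x}) ` {..<n}"
  note c = involution_cells[OF assms]
  have "card (neighbours_in G D u) = card (neighbours_in G D u')"
    if "C \<in> ?P" "D \<in> ?P" "u \<in> C" "u' \<in> C" for C D u u'
  proof (cases "u' = u")
    case False
    note k = c(3)[OF that False]
    then have "inj_on f (neighbours_in G D u)" "neighbours_in G D u' = f ` neighbours_in G D u" by blast+
    then show ?thesis by (simp only: card_image)
  qed simp
  then show ?thesis using c(1,2) unfolding equitable_partition_def verts by blast
qed

lemma involution_imp_weight_equitable:
  assumes "fpf_involution f {..<n}"
  shows "\<exists>P. weight_equitable_partition G P \<and> into_pairs G P"
proof -
  let ?P = "(\<lambda>x. {x, f x}) ` {..<n}"
  note c = involution_cells[OF assms]
  have inv: "perron_vector G $ f u = perron_vector G $ u" if "u < n" for u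
    using perron_automorphism[OF c(4,5) that] .
  have "weighted_degree_into G D u = weighted_degree_into G D u'"
    if "C \<in> ?P" "D \<in> ?P" "u \<in> C" "u' \<in> C" for C D u u'
  proof (cases "u' = u")
    case False
    note k = c(3)[OF that False]
    have kk: "u < n" "u' = f u" "inj_on f (neighbours_in G D u)"
      "neighbours_in G D u' = f ` neighbours_in G D u" using k by blast+
    have "(\<Sum>v\<in>neighbours_in G D u'. perron_vector G $ v) =
        (\<Sum>v\<in>neighbours_in G D u. perron_vector G $ f v)"
      unfolding kk(4) using kk(3) by (simp add: sum.reindex)
    also have "\<dots> = (\<Sum>v\<in>neighbours_in G D u. perron_vector G $ v)"
      by (intro sum.cong refl inv c(6)[OF that(2)])
    finally have "(\<Sum>v\<in>neighbours_in G D u'. perron_vector G $ v) =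
        (\<Sum>v\<in>neighbours_in G D u. perron_vector G $ v)" .
    moreover have "perron_vector G $ u' = perron_vector G $ u" unfolding kk(2) by (rule inv[OF kk(1)])
    ultimately show ?thesis unfolding weighted_degree_into_def by simp
  qed simp
  then show ?thesis using c(1,2) unfolding weight_equitable_partition_def verts by blast
qed

text \<open>Adjacency between two cells is a 2 by 2 matrix of zeros and ones. The hypothesis equates
  its row sums and, as the graph is undirected, its column sums; together they make the diagonal
  entries equal.\<close>

lemma regular_involution:
  assumes f: "\<And>x. x < n \<Longrightarrow> f x < n \<and> f x \<noteq> x \<and> f (f x) = x"
    and reg: "\<And>u v. u < n \<Longrightarrow> v < n \<Longrightarrow>
      of_bool (E u v) + of_bool (E u (f v)) = (of_bool (E (f u) v) + of_bool (E (f u) (f v)) :: nat)"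
  shows "fpf_involution f {..<n}"
  unfolding fpf_involution_def
proof (intro conjI ballI)
  fix u v assume "u \<in> {..<n}" "v \<in> {..<n}"
  then have uv: "u < n" "v < n" by auto
  have "of_bool (E u v) + of_bool (E (f u) v) = (of_bool (E u (f v)) + of_bool (E (f u) (f v)) :: nat)"
    using reg[OF uv(2,1)] by (simp only: E_sym[of v u] E_sym[of v "f u"] E_sym[of "f v" u] E_sym[of "f v" "f u"])
  then show "E (f u) (f v) = E u v"
    using reg[OF uv]
    by (cases "E u v"; cases "E u (f v)"; cases "E (f u) v"; cases "E (f u) (f v)") simp_all
qed (use f in simp_all)

lemma equitable_imp_involution:
  assumes "equitable_partition G P" "into_pairs G P"
  shows "\<exists>f. fpf_involution f {..<n}"
proof -
  have P: "partition_on {..<n} P" and two: "\<And>C. C \<in> P \<Longrightarrow> card C = 2"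
    and eq: "\<And>C D u u'. C \<in> P \<Longrightarrow> D \<in> P \<Longrightarrow> u \<in> C \<Longrightarrow> u' \<in> C \<Longrightarrow>
      card (neighbours_in G D u) = card (neighbours_in G D u')"
    using assms unfolding equitable_partition_def into_pairs_iff verts by blast+
  from partner_function[OF P two] obtain f where
    f: "\<And>x. x \<in> {..<n} \<Longrightarrow> f x \<in> {..<n} \<and> f x \<noteq> x \<and> f (f x) = x \<and> {x, f x} \<in> P" by blast
  have c: "card (neighbours_in G {v, f v} u) = of_bool (E u v) + of_bool (E u (f v))" if "v < n" for u v
  proof -
    have "v \<noteq> f v" using f[of v] that by (metis lessThan_iff)
    then show ?thesis by (simp add: neighbours_pair)
  qed
  have "fpf_involution f {..<n}"
  proof (rule regular_involution)
    fix u v assume uv: "u < n" "v < n"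
    have "card (neighbours_in G {v, f v} u) = card (neighbours_in G {v, f v} (f u))"
      by (rule eq[of "{u, f u}" "{v, f v}"]) (use f uv in simp_all)
    then show "of_bool (E u v) + of_bool (E u (f v)) = (of_bool (E (f u) v) + of_bool (E (f u) (f v)) :: nat)"
      unfolding c[OF uv(2)] .
  next
    fix x assume "x < n"
    then show "f x < n \<and> f x \<noteq> x \<and> f (f x) = x" using f[of x] by simp
  qed
  then show ?thesis by (rule exI[of _ f])
qed

text \<open>\<open>a > a'\<close> are the weights in one cell, \<open>b\<close> and
  \<open>b'\<close> those in another; \<open>p\<close>, \<open>q\<close> are the adjacencies of the
  heavier vertex to that cell, \<open>r\<close>, \<open>s\<close> those of the lighter one.
  \<open>sp\<close> excludes two patterns with three edges, and the equation leaves only the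
  matching \<open>p\<close>, \<open>s\<close>, for which the weight ratios agree.\<close>

lemma bigger_neighbour:
  fixes a a' b b' :: real and p q r s :: bool
  assumes pos: "0 < a" "0 < a'" "0 < b" "0 < b'" and big: "a' < a"
    and p: p
    and 1: "(of_bool p * b + of_bool q * b') * a' = (of_bool r * b + of_bool s * b') * a"
    and sp: "\<not> (q \<and> r \<and> \<not> s)" "\<not> (q \<and> \<not> r \<and> s)"
  shows "b' < b"
proof -
  have "\<not> (\<not> r \<and> \<not> s)"
  proof
    assume "\<not> r \<and> \<not> s"
    then have "(b + of_bool q * b') * a' = 0" using 1 p by simp
    moreover have "0 < b + of_bool q * b'" using pos by (simp add: add_pos_nonneg)
    ultimately show False using pos by simp
  qed
  moreover have "\<not> (r \<and> \<not> q)"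
  proof
    assume h: "r \<and> \<not> q"
    have "b * a' < b * a" using pos big by simp
    also have "\<dots> \<le> (b + of_bool s * b') * a" using pos by (intro mult_right_mono) auto
    finally show False using 1 p h by simp
  qed
  moreover have "\<not> (q \<and> r \<and> s)"
  proof
    assume "q \<and> r \<and> s"
    then have "(b + b') * a' = (b + b') * a" using 1 p by simp
    then show False using pos big by simp
  qed
  ultimately have "\<not> q" "\<not> r" "s" using sp by blast+
  then have e: "b * a' = b' * a" using 1 p by simp
  have "b' * a = b * a'" using e by simp
  also have "\<dots> < b * a" using pos big by simp
  finally show ?thesis using pos by simp
qed

lemma weight_equitable_imp_involution:
  assumes "weight_equitable_partition G P" "into_pairs G P"
    and p4: "p4_free {..<n}"
  shows "\<exists>f. fpf_involution f {..<n}"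
proof -
  have P: "partition_on {..<n} P" and two: "\<And>C. C \<in> P \<Longrightarrow> card C = 2"
    and eq: "\<And>C D u u'. C \<in> P \<Longrightarrow> D \<in> P \<Longrightarrow> u \<in> C \<Longrightarrow> u' \<in> C \<Longrightarrow>
      weighted_degree_into G D u = weighted_degree_into G D u'"
    using assms(1,2) unfolding weight_equitable_partition_def into_pairs_iff verts by blast+
  from partner_function[OF P two] obtain f where
    f: "\<And>x. x \<in> {..<n} \<Longrightarrow> f x \<in> {..<n} \<and> f x \<noteq> x \<and> f (f x) = x \<and> {x, f x} \<in> P" by blast
  have fn: "f x < n" "f x \<noteq> x" "f (f x) = x" "{x, f x} \<in> P" if "x < n" for x using f[of x] that by simp_all
  define w where "w u = perron_vector G $ u" for u
  have w: "0 < w u" if "u < n" for u using perron_positive[OF that] by (simp add: w_def)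
  have c: "(\<Sum>x\<in>neighbours_in G {v, f v} u. perron_vector G $ x) =
      of_bool (E u v) * w v + of_bool (E u (f v)) * w (f v)" if "v < n" for u v
  proof -
    have "v \<noteq> f v" using fn(2)[OF that] by metis
    then show ?thesis by (simp add: neighbours_pair w_def)
  qed
  have K: "(of_bool (E u v) * w v + of_bool (E u (f v)) * w (f v)) * w (f u) =
      (of_bool (E (f u) v) * w v + of_bool (E (f u) (f v)) * w (f v)) * w u" if "u < n" "v < n" for u v
  proof -
    have "weighted_degree_into G {v, f v} u = weighted_degree_into G {v, f v} (f u)"
      by (rule eq[OF fn(4)[OF that(1)] fn(4)[OF that(2)]]) simp_all
    then have "1 / w u * (of_bool (E u v) * w v + of_bool (E u (f v)) * w (f v)) =
      1 / w (f u) * (of_bool (E (f u) v) * w v + of_bool (E (f u) (f v)) * w (f v))"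
      unfolding weighted_degree_into_def c[OF that(2)] w_def .
    moreover have "w u \<noteq> 0" "w (f u) \<noteq> 0"
      using w[OF that(1)] w[OF fn(1)[OF that(1)]] by simp_all
    ultimately show ?thesis by (simp add: frac_eq_eq)
  qed
  \<comment> \<open>The equation of a cell against itself: an edge inside a cell forces equal
    weights.\<close>
  have cell: "w (f v) = w v" if v: "v < n" "E v (f v)" for v
  proof -
    have "w (f v) * w (f v) = w v * w v"
      using K[OF v(1) v(1)] v E_irrefl E_sym[of "f v" v] by simp
    then have "(w (f v))\<^sup>2 = (w v)\<^sup>2" by (simp add: power2_eq_square)
    then show ?thesis using w[OF v(1)] w[OF fn(1)[OF v(1)]] by (simp add: power2_eq_iff_nonneg)
  qed
  have grow: "w (f v) < w v" if u: "u < n" "w (f u) < w u" and v: "v < n" "E u v" for u v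
  proof -
    note K1 = K[OF u(1) v(1)]
    have K2: "(of_bool (E u v) * w u + of_bool (E (f u) v) * w (f u)) * w (f v) =
      (of_bool (E u (f v)) * w u + of_bool (E (f u) (f v)) * w (f u)) * w v"
      using K[OF v(1) u(1)]
      by (simp only: E_sym[of v u] E_sym[of v "f u"] E_sym[of "f v" u] E_sym[of "f v" "f u"])
    have nu: "\<not> E u (f u)" using cell[of u] u by auto
    have pos: "0 < w u" "0 < w (f u)" "0 < w v" "0 < w (f v)"
      using w[OF u(1)] w[OF v(1)] w[OF fn(1)[OF u(1)]] w[OF fn(1)[OF v(1)]] by simp_all
    have in4: "u \<in> {..<n}" "f u \<in> {..<n}" "v \<in> {..<n}" "f v \<in> {..<n}"
      using u(1) v(1) fn(1)[OF u(1)] fn(1)[OF v(1)] by simp_all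
    \<comment> \<open>If \<open>v\<close> and \<open>f v\<close> are adjacent, their weights agree
      and the equation with the cells exchanged makes \<open>w (f u)\<close> vanish. Otherwise
      \<open>f v\<close>, \<open>u\<close>, \<open>v\<close>, \<open>f u\<close> is an induced
      path.\<close>
    have s1: "\<not> (E u (f v) \<and> E (f u) v \<and> \<not> E (f u) (f v))"
    proof
      assume h: "E u (f v) \<and> E (f u) v \<and> \<not> E (f u) (f v)"
      show False
      proof (cases "E v (f v)")
        case True
        then have e: "w (f v) = w v" using cell v by simp
        have "(w u + w (f u)) * w v = w u * w v" using K2 h v(2) unfolding e by simp
        then show False using pos by simp
      next
        case False
        show False
          by (rule p4_freeD[OF p4 in4(4,1,3,2)])
            (use h v nu False E_sym[of "f v" u] E_sym[of "f v" v] E_sym[of "f v" "f u"] E_sym[of v "f u"] in simp_all)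
      qed
    qed
    have s2: "\<not> (E u (f v) \<and> \<not> E (f u) v \<and> E (f u) (f v))"
    proof
      assume h: "E u (f v) \<and> \<not> E (f u) v \<and> E (f u) (f v)"
      show False
      proof (cases "E v (f v)")
        case True
        then have e: "w (f v) = w v" using cell v by simp
        have "w u * w v = (w u + w (f u)) * w v" using K2 h v(2) unfolding e by simp
        then show False using pos by simp
      next
        case False
        show False
          by (rule p4_freeD[OF p4 in4(3,1,4,2)])
            (use h v nu False E_sym[of v u] E_sym[of "f v" "f u"] E_sym[of v "f u"] in simp_all)
      qed
    qed
    show ?thesis by (rule bigger_neighbour[OF pos u(2) v(2) K1 s1 s2])
  qed
  \<comment> \<open>By \<open>grow\<close> this set is closed under neighbours. If it were nonempty,
    every vertex would be heavier than its partner, which is absurd.\<close>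
  define S where "S = {u. u < n \<and> w (f u) < w u}"
  have "S = {}"
  proof (rule ccontr)
    assume ne: "S \<noteq> {}"
    then obtain u where u: "u < n" "w (f u) < w u" by (auto simp: S_def)
    have "S = {..<n}"
    proof (rule connected[OF _ ne])
      fix x y assume "x \<in> S" "y < n" "E x y"
      then show "y \<in> S" using grow[of x y] by (simp add: S_def)
    qed (auto simp: S_def)
    then have "f u \<in> S" using fn(1)[OF u(1)] by simp
    then show False using u fn(3)[OF u(1)] by (simp add: S_def)
  qed
  then have le: "w u \<le> w (f u)" if "u < n" for u
  proof -
    have "u \<notin> S" using \<open>S = {}\<close> by simp
    then show ?thesis using that by (simp add: S_def not_less)
  qed
  have same: "w (f u) = w u" if "u < n" for u using le[OF that] le[OF fn(1)[OF that]] fn(3)[OF that] by simp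
  have "fpf_involution f {..<n}"
  proof (rule regular_involution)
    fix u v assume uv: "u < n" "v < n"
    have "(of_bool (E u v) + of_bool (E u (f v))) * (w v * w u) =
      (of_bool (E (f u) v) + of_bool (E (f u) (f v))) * (w v * w u)"
      using K[OF uv] unfolding same[OF uv(1)] same[OF uv(2)] by (simp only: distrib_right mult.assoc)
    then have "(of_bool (E u v) + of_bool (E u (f v)) :: real) = of_bool (E (f u) v) + of_bool (E (f u) (f v))"
      using w[OF uv(1)] w[OF uv(2)] by simp
    then show "of_bool (E u v) + of_bool (E u (f v)) = (of_bool (E (f u) v) + of_bool (E (f u) (f v)) :: nat)"
      by (cases "E u v"; cases "E u (f v)"; cases "E (f u) v"; cases "E (f u) (f v)") simp_all
  qed (use fn in simp)
  then show ?thesis by (rule exI[of _ f])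
qed

end

section \<open>Cographs as instances, and the two decision problems\<close>

lemma connected_cograph_graph_on:
  assumes G: "connected_cograph G" and V: "pverts G = {..<n}"
  defines "E \<equiv> \<lambda>i j. (i, j) \<in> parcs G"
  shows "graph_on E n G" and "simple_graph.p4_free E {..<n}"
proof -
  from G have pg: "pair_graph G" and np: "\<nexists>p. induced_P4 G p"
    and con: "strongly_connected (mk_symmetric (with_proj G))"
    by (auto simp: connected_cograph_def cograph_def Digraph_Component.connected_def)
  interpret pair_graph G by (rule pg)
  have sym: "E x y \<longleftrightarrow> E y x" for x y unfolding E_def using arcs_symmetric by blast
  have irrefl: "\<not> E x x" for x unfolding E_def using pair_no_loops by force
  \<comment> \<open>The arc set is symmetric already, so the symmetric closure in the definition of
    connectedness adds nothing.\<close>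
  have arcs: "parcs (mk_symmetric (with_proj G)) = parcs G"
    using sym unfolding mk_symmetric_def E_def by auto
  have pv: "pverts (mk_symmetric (with_proj G)) = {..<n}" by (simp add: mk_symmetric_def V)
  \<comment> \<open>Strong connectedness includes the existence of a vertex, which excludes
    \<open>n = 0\<close>.\<close>
  from con have ne: "{..<n} \<noteq> {}"
    and reach: "\<And>u v. u < n \<Longrightarrow> v < n \<Longrightarrow> (u, v) \<in> rtrancl_on {..<n} (parcs G)"
    unfolding strongly_connected_def reachable_def by (auto simp: pv arcs V)
  show "graph_on E n G"
  proof
    show "0 < n" using ne by auto
    fix S assume S: "S \<subseteq> {..<n}" "S \<noteq> {}" and closed: "\<And>x y. x \<in> S \<Longrightarrow> y < n \<Longrightarrow> E x y \<Longrightarrow> y \<in> S"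
    then obtain u where u: "u \<in> S" "u < n" by auto
    have "v \<in> S" if v: "v < n" for v
      using reach[OF u(2) v]
    proof (induction rule: rtrancl_on_induct)
      case base
      then show ?case using u by simp
    next
      case (step y z)
      then show ?case using closed by (auto simp: E_def)
    qed
    then show "S = {..<n}" using S by auto
  next
    show "E x y \<longleftrightarrow> E y x" for x y by (rule sym)
  qed (use irrefl V in \<open>auto simp: E_def\<close>)
  have simple: "simple_graph E" by unfold_locales (rule sym, rule irrefl)
  show "simple_graph.p4_free E {..<n}"
    unfolding simple_graph.p4_free_def[OF simple]
  proof (intro ballI notI)
    fix a b c d assume V4: "a \<in> {..<n}" "b \<in> {..<n}" "c \<in> {..<n}" "d \<in> {..<n}"
      and p: "E a b \<and> E b c \<and> E c d \<and> \<not> E a c \<and> \<not> E b d \<and> \<not> E a d"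
    define q where "q = (\<lambda>i::nat. if i = 0 then a else if i = 1 then b else if i = 2 then c else d)"
    have four: "{..<4::nat} = {0, 1, 2, 3}" by auto
    have q: "q 0 = a" "q 1 = b" "q 2 = c" "q 3 = d" by (simp_all add: q_def)
    have ne: "a \<noteq> b" "b \<noteq> c" "c \<noteq> d" "a \<noteq> c" "b \<noteq> d" "a \<noteq> d" using p irrefl sym by blast+
    have ind: "\<forall>i\<in>{0,1,2,3::nat}. \<forall>j\<in>{0,1,2,3}. E (q i) (q j) \<longleftrightarrow> j = Suc i \<or> i = Suc j"
      using p irrefl sym[of b a] sym[of c b] sym[of d c] sym[of c a] sym[of d b] sym[of d a]
      by (simp add: q[simplified])
    have "induced_P4 G q"
      unfolding induced_P4_def
    proof (intro conjI)
      show "inj_on q {..<4}" unfolding four using ne by (auto simp: inj_on_def q[simplified])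
      show "q ` {..<4} \<subseteq> pverts G" unfolding four V using V4 by (auto simp: q[simplified])
      show "\<forall>i<4. \<forall>j<4. ((q i, q j) \<in> parcs G) = (j = Suc i \<or> i = Suc j)"
      proof (intro allI impI)
        fix i j :: nat assume "i < 4" "j < 4"
        then have "i \<in> {0, 1, 2, 3}" "j \<in> {0, 1, 2, 3}" using four by blast+
        then show "((q i, q j) \<in> parcs G) = (j = Suc i \<or> i = Suc j)"
          using ind unfolding E_def by blast
      qed
    qed
    then show False using np by blast
  qed
qed

text \<open>\<open>Q\<close> is kept general because one program with one time bound answers both
  questions.\<close>

lemma decide_swappable_decides:
  assumes Q: "\<And>n G. connected_cograph G \<Longrightarrow> pverts G = {..<n} \<Longrightarrow>
    Q G \<longleftrightarrow> (\<exists>f. simple_graph.fpf_involution (\<lambda>i j. (i, j) \<in> parcs G) f {..<n})"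
  shows "decides_within decide_swappable (\<lambda>n. 1000 * n * n + 1000 * n + 100) {G. connected_cograph G} Q"
  unfolding decides_within_def
proof (intro allI ballI impI)
  fix n and G :: "nat pair_pre_digraph"
  assume G: "G \<in> {G. connected_cograph G}" and V: "pverts G = {..<n}"
  define E where "E = (\<lambda>i j. (i, j) \<in> parcs G)"
  interpret graph_on E n G
    unfolding E_def using connected_cograph_graph_on(1) G V by blast
  have p4: "p4_free {..<n}"
    unfolding E_def using connected_cograph_graph_on(2) G V by blast
  have mat: "arrs (input_state n G) matA (i * n + j) = of_bool (E i j)" if ij: "i < n" "j < n" for i j
  proof -
    have "Suc i * n \<le> n * n" using ij(1) by (intro mult_le_mono1) simp
    then have "i * n + j < n * n" using ij(2) by simp
    moreover have "(i * n + j) div n = i" "(i * n + j) mod n = j" using ij(2) by simp_all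
    ultimately show ?thesis by (simp add: input_state_def E_def)
  qed
  interpret p4_free_graph E n by unfold_locales (rule p4)
  have "run decide_swappable
      (\<lambda>T' s'. \<exists>t. represents {..<n} t \<and> regs s' outR = of_bool (swappable t))
      (1000 * n * n + 1000 * n + 100) (input_state n G)"
    by (rule decide_swappable[OF n_pos order_refl _ mat]) (simp_all add: input_state_def)
  then obtain t s c where run: "exec decide_swappable (input_state n G) t s"
      "t \<le> 1000 * n * n + 1000 * n + 100" "regs s outR = of_bool (swappable c)"
    and c: "represents {..<n} c"
    unfolding run_def by blast
  have "swappable c \<longleftrightarrow> Q G"
    using swappable_imp_fpf_involution[OF _ c] fpf_involution_imp_swappable[OF c] Q[of G n] G V
    unfolding E_def by blast
  with run show "\<exists>t s. exec decide_swappable (input_state n G) t s \<and>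
      t \<le> 1000 * n * n + 1000 * n + 100 \<and> regs s 1 = (if Q G then 1 else 0)"
    by (intro exI[of _ t] exI[of _ s]) simp
qed

text \<open>2100 is the sum of the three coefficients: both \<open>n\<close> and 1 are at most
  \<open>n * n\<close> as soon as \<open>n\<close> is at least 1.\<close>

lemma quadratic_bound: "(\<lambda>n. real (1000 * n * n + 1000 * n + 100)) \<in> O(\<lambda>n. real n ^ 2)"
proof (rule bigoI[of _ 2100])
  have "norm (real (1000 * n * n + 1000 * n + 100)) \<le> 2100 * norm (real n ^ 2)" if "n \<ge> 1" for n :: nat
  proof -
    have "n \<le> n * n" "1 \<le> n * n" "1000 * n * n = 1000 * (n * n)" using that by simp_all
    then have "1000 * n * n + 1000 * n + 100 \<le> 2100 * (n * n)" by linarith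
    then have "real (1000 * n * n + 1000 * n + 100) \<le> real (2100 * (n * n))" by (rule of_nat_mono)
    then show ?thesis by (simp add: power2_eq_square)
  qed
  then show "\<forall>\<^sub>F n in sequentially. norm (real (1000 * n * n + 1000 * n + 100)) \<le> 2100 * norm (real n ^ 2)"
    unfolding eventually_sequentially by blast
qed

theorem theorem5p9:
  shows "decidable_in_time (\<lambda>n. real n ^ 2) {G. connected_cograph G}
           (\<lambda>G. \<exists>P. equitable_partition G P \<and> into_pairs G P)
       \<and> decidable_in_time (\<lambda>n. real n ^ 2) {G. connected_cograph G}
           (\<lambda>G. \<exists>P. weight_equitable_partition G P \<and> into_pairs G P)"
proof -
  have eq: "(\<exists>P. equitable_partition G P \<and> into_pairs G P) \<longleftrightarrow>
      (\<exists>f. simple_graph.fpf_involution (\<lambda>i j. (i, j) \<in> parcs G) f {..<n})"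
    and weq: "(\<exists>P. weight_equitable_partition G P \<and> into_pairs G P) \<longleftrightarrow>
      (\<exists>f. simple_graph.fpf_involution (\<lambda>i j. (i, j) \<in> parcs G) f {..<n})"
    if "connected_cograph G" "pverts G = {..<n}" for G :: "nat pair_pre_digraph" and n
  proof -
    interpret graph_on "\<lambda>i j. (i, j) \<in> parcs G" n G
      by (rule connected_cograph_graph_on(1)[OF that])
    note p4 = connected_cograph_graph_on(2)[OF that]
    show "(\<exists>P. equitable_partition G P \<and> into_pairs G P) \<longleftrightarrow>
      (\<exists>f. simple_graph.fpf_involution (\<lambda>i j. (i, j) \<in> parcs G) f {..<n})"
      using involution_imp_equitable equitable_imp_involution by blast
    show "(\<exists>P. weight_equitable_partition G P \<and> into_pairs G P) \<longleftrightarrow>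
      (\<exists>f. simple_graph.fpf_involution (\<lambda>i j. (i, j) \<in> parcs G) f {..<n})"
      using involution_imp_weight_equitable weight_equitable_imp_involution p4 by blast
  qed
  show ?thesis
    unfolding decidable_in_time_def
    using decide_swappable_decides[OF eq] decide_swappable_decides[OF weq] quadratic_bound by blast
qed

end
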